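(* Let $\iota: R\to A$ be a Frobenius extension and let $T$ be a finitely generated projective generator of the category of left $R$-modules. Put $U=A\otimes_R T$, $S=\operatorname{End}_R(T)$ and $B=\operatorname{End}_A(U)$. Then $U$ is a finitely generated projective generator of the category of left $A$-modules, and the natural homomorphism of endomorphism rings $\rho: S\to B$, $\rho(s)=1_A\otimes s$, is a Frobenius extension.
   Context: All rings are associative with unit; modules are left modules unless otherwise specified. A ring extension $\iota:R\to A$ is a unital ring homomorphism. It is a Frobenius extension if $A$ is finitely generated projective as a left $R$-module and $A\cong\operatorname{Hom}_R(A,R)$ as $A$-$R$-bimodules, where $(af)(x)=f(xa)$ and $(fr)(x)=f(x)r$. Endomorphism rings use the right-action convention: for $s_1,s_2\in S$, $t(s_1s_2)=(ts_1)s_2$, i.e. $s_1s_2=s_2\circ s_1$, and similarly for $B$. Explicitly, $(a\otimes t)\rho(s)=a\otimes ts$. *)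

theory Defs
  imports "HOL-Algebra.Free_Abelian_Groups" "HOL-Algebra.Module"
begin

section \<open>Left modules over noncommutative rings\<close>

text \<open>The axioms of the library locale \<^locale>\<open>module\<close>, which insists on a commutative ring.
  The carrier of a ring may be trivial, and the multiplication and unit of the underlying
  ring record of a module are irrelevant.\<close>

locale left_module = R?: ring R + M?: abelian_group M
  for R :: "('r, 'i) ring_scheme" (structure) and M :: "('r, 'm, 'j) module_scheme" (structure) +
  assumes smult_closed [simp, intro]:
      "\<lbrakk>a \<in> carrier R; x \<in> carrier M\<rbrakk> \<Longrightarrow> a \<odot>\<^bsub>M\<^esub> x \<in> carrier M"
    and smult_l_distr:
      "\<lbrakk>a \<in> carrier R; b \<in> carrier R; x \<in> carrier M\<rbrakk> \<Longrightarrow>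
        (a \<oplus> b) \<odot>\<^bsub>M\<^esub> x = a \<odot>\<^bsub>M\<^esub> x \<oplus>\<^bsub>M\<^esub> b \<odot>\<^bsub>M\<^esub> x"
    and smult_r_distr:
      "\<lbrakk>a \<in> carrier R; x \<in> carrier M; y \<in> carrier M\<rbrakk> \<Longrightarrow>
        a \<odot>\<^bsub>M\<^esub> (x \<oplus>\<^bsub>M\<^esub> y) = a \<odot>\<^bsub>M\<^esub> x \<oplus>\<^bsub>M\<^esub> a \<odot>\<^bsub>M\<^esub> y"
    and smult_assoc:
      "\<lbrakk>a \<in> carrier R; b \<in> carrier R; x \<in> carrier M\<rbrakk> \<Longrightarrow>
        (a \<otimes> b) \<odot>\<^bsub>M\<^esub> x = a \<odot>\<^bsub>M\<^esub> (b \<odot>\<^bsub>M\<^esub> x)"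
    and smult_one [simp]:
      "x \<in> carrier M \<Longrightarrow> \<one> \<odot>\<^bsub>M\<^esub> x = x"

text \<open>Homomorphisms are extensional functions, so that equality of homomorphisms is
  equality on the carrier.\<close>

definition lmod_hom ::
  "('r, 'i) ring_scheme \<Rightarrow> ('r, 'm, 'j) module_scheme \<Rightarrow> ('r, 'n, 'k) module_scheme \<Rightarrow> ('m \<Rightarrow> 'n) set"
  where "lmod_hom R M N =
    {f \<in> carrier M \<rightarrow>\<^sub>E carrier N.
       (\<forall>x\<in>carrier M. \<forall>y\<in>carrier M. f (x \<oplus>\<^bsub>M\<^esub> y) = f x \<oplus>\<^bsub>N\<^esub> f y) \<and>
       (\<forall>r\<in>carrier R. \<forall>x\<in>carrier M. f (r \<odot>\<^bsub>M\<^esub> x) = r \<odot>\<^bsub>N\<^esub> f x)}"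

text \<open>Endomorphisms act on the right: the product \<open>s\<^sub>1 s\<^sub>2\<close> is the composite
  \<open>s\<^sub>2 \<circ> s\<^sub>1\<close>.\<close>

definition lmod_End ::
  "('r, 'i) ring_scheme \<Rightarrow> ('r, 'm, 'j) module_scheme \<Rightarrow> ('m \<Rightarrow> 'm) ring"
  where "lmod_End R M =
    \<lparr>carrier = lmod_hom R M M,
     mult = (\<lambda>s\<^sub>1 s\<^sub>2. compose (carrier M) s\<^sub>2 s\<^sub>1),
     one = (\<lambda>x\<in>carrier M. x),
     zero = (\<lambda>x\<in>carrier M. \<zero>\<^bsub>M\<^esub>),
     add = (\<lambda>s\<^sub>1 s\<^sub>2. \<lambda>x\<in>carrier M. s\<^sub>1 x \<oplus>\<^bsub>M\<^esub> s\<^sub>2 x)\<rparr>"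


section \<open>Finitely generated projective generators\<close>

definition fin_gen :: "('r, 'i) ring_scheme \<Rightarrow> ('r, 'm, 'j) module_scheme \<Rightarrow> bool"
  where "fin_gen R M \<longleftrightarrow> left_module R M \<and>
    (\<exists>X. finite X \<and> X \<subseteq> carrier M \<and>
      (\<forall>m\<in>carrier M. \<exists>c\<in>X \<rightarrow> carrier R. m = (\<Oplus>\<^bsub>M\<^esub>x\<in>X. c x \<odot>\<^bsub>M\<^esub> x)))"

text \<open>Projective modules and generators are defined by their usual categorical properties.
  Both quantify over all left modules, whereas a HOL formula can only quantify over modules
  on a given type; that type \<open>'u\<close> is passed as an argument. A conclusion stated for a
  type variable covers every type. As a hypothesis on a finitely generated module over
  \<open>R :: 'r ring\<close>, the single type \<open>(nat \<Rightarrow> 'r) set\<close> is as good as all types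
  together, since it contains copies of the free modules \<open>R\<^sup>n\<close> (with singletons as
  elements) and of their quotients (with cosets as elements).\<close>

definition projective ::
  "'u itself \<Rightarrow> ('r, 'i) ring_scheme \<Rightarrow> ('r, 'm, 'j) module_scheme \<Rightarrow> bool"
  where "projective _ R P \<longleftrightarrow> left_module R P \<and>
    (\<forall>(M :: ('r, 'u) module) (N :: ('r, 'u) module) g f.
       left_module R M \<longrightarrow> left_module R N \<longrightarrow>
       g \<in> lmod_hom R M N \<longrightarrow> g ` carrier M = carrier N \<longrightarrow>
       f \<in> lmod_hom R P N \<longrightarrow>
       (\<exists>h\<in>lmod_hom R P M. compose (carrier P) g h = f))"

definition generator ::
  "'u itself \<Rightarrow> ('r, 'i) ring_scheme \<Rightarrow> ('r, 'm, 'j) module_scheme \<Rightarrow> bool"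
  where "generator _ R G \<longleftrightarrow> left_module R G \<and>
    (\<forall>(M :: ('r, 'u) module) (N :: ('r, 'u) module) f g.
       left_module R M \<longrightarrow> left_module R N \<longrightarrow>
       f \<in> lmod_hom R M N \<longrightarrow> g \<in> lmod_hom R M N \<longrightarrow> f \<noteq> g \<longrightarrow>
       (\<exists>h\<in>lmod_hom R G M. compose (carrier G) f h \<noteq> compose (carrier G) g h))"

definition fg_projective_generator ::
  "'u itself \<Rightarrow> ('r, 'i) ring_scheme \<Rightarrow> ('r, 'm, 'j) module_scheme \<Rightarrow> bool"
  where "fg_projective_generator u R T \<longleftrightarrow>
    fin_gen R T \<and> projective u R T \<and> generator u R T"


section \<open>Frobenius extensions\<close>

record ('a, 'r, 'm) bimodule = "('a, 'm) module" +
  rsmult :: "'m \<Rightarrow> 'r \<Rightarrow> 'm"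

definition bimodule_iso ::
  "('a, 'i) ring_scheme \<Rightarrow> ('r, 'j) ring_scheme \<Rightarrow>
   ('a, 'r, 'm, 'k) bimodule_scheme \<Rightarrow> ('a, 'r, 'n, 'l) bimodule_scheme \<Rightarrow> ('m \<Rightarrow> 'n) set"
  where "bimodule_iso A R M N =
    {\<phi>. bij_betw \<phi> (carrier M) (carrier N) \<and>
       (\<forall>x\<in>carrier M. \<forall>y\<in>carrier M. \<phi> (x \<oplus>\<^bsub>M\<^esub> y) = \<phi> x \<oplus>\<^bsub>N\<^esub> \<phi> y) \<and>
       (\<forall>a\<in>carrier A. \<forall>x\<in>carrier M. \<phi> (a \<odot>\<^bsub>M\<^esub> x) = a \<odot>\<^bsub>N\<^esub> \<phi> x) \<and>
       (\<forall>x\<in>carrier M. \<forall>r\<in>carrier R. \<phi> (rsmult M x r) = rsmult N (\<phi> x) r)}"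

text \<open>For a ring extension \<open>\<iota> : R \<rightarrow> A\<close>: the ring \<open>A\<close> as a left \<open>R\<close>-module and
  as an \<open>A\<close>-\<open>R\<close>-bimodule, and the \<open>A\<close>-\<open>R\<close>-bimodule of left \<open>R\<close>-linear maps
  from \<open>A\<close> to \<open>R\<close>. The left \<open>R\<close>-module \<open>R\<close> is the case \<open>\<iota> = id\<close> of
  the first.\<close>

definition ext_module :: "('r \<Rightarrow> 'a) \<Rightarrow> ('a, 'i) ring_scheme \<Rightarrow> ('r, 'a) module"
  where "ext_module \<iota> A =
    \<lparr>carrier = carrier A, mult = mult A, one = \<one>\<^bsub>A\<^esub>,
     zero = \<zero>\<^bsub>A\<^esub>, add = add A,
     smult = (\<lambda>r a. \<iota> r \<otimes>\<^bsub>A\<^esub> a)\<rparr>"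

definition ext_bimodule :: "('r \<Rightarrow> 'a) \<Rightarrow> ('a, 'i) ring_scheme \<Rightarrow> ('a, 'r, 'a) bimodule"
  where "ext_bimodule \<iota> A =
    \<lparr>carrier = carrier A, mult = mult A, one = \<one>\<^bsub>A\<^esub>,
     zero = \<zero>\<^bsub>A\<^esub>, add = add A,
     smult = (\<lambda>b a. b \<otimes>\<^bsub>A\<^esub> a), rsmult = (\<lambda>a r. a \<otimes>\<^bsub>A\<^esub> \<iota> r)\<rparr>"

definition ext_dual ::
  "('r \<Rightarrow> 'a) \<Rightarrow> ('r, 'i) ring_scheme \<Rightarrow> ('a, 'j) ring_scheme \<Rightarrow> ('a, 'r, 'a \<Rightarrow> 'r) bimodule"
  where "ext_dual \<iota> R A =
    \<lparr>carrier = lmod_hom R (ext_module \<iota> A) (ext_module id R),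
     mult = undefined, one = undefined,
     zero = (\<lambda>x\<in>carrier A. \<zero>\<^bsub>R\<^esub>),
     add = (\<lambda>f g. \<lambda>x\<in>carrier A. f x \<oplus>\<^bsub>R\<^esub> g x),
     smult = (\<lambda>a f. \<lambda>x\<in>carrier A. f (x \<otimes>\<^bsub>A\<^esub> a)),
     rsmult = (\<lambda>f r. \<lambda>x\<in>carrier A. f x \<otimes>\<^bsub>R\<^esub> r)\<rparr>"

definition frobenius_extension ::
  "'u itself \<Rightarrow> ('r, 'i) ring_scheme \<Rightarrow> ('a, 'j) ring_scheme \<Rightarrow> ('r \<Rightarrow> 'a) \<Rightarrow> bool"
  where "frobenius_extension u R A \<iota> \<longleftrightarrow>
    ring R \<and> ring A \<and> \<iota> \<in> ring_hom R A \<and>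
    fin_gen R (ext_module \<iota> A) \<and> projective u R (ext_module \<iota> A) \<and>
    bimodule_iso A R (ext_bimodule \<iota> A) (ext_dual \<iota> R A) \<noteq> {}"


section \<open>Tensor products\<close>

text \<open>\<open>M \<otimes>\<^sub>R N\<close> is the free abelian group on pairs modulo the subgroup generated by the
  relations of balanced biadditivity.\<close>

definition tensor_rel ::
  "('r, 'i) ring_scheme \<Rightarrow> ('a, 'r, 'm, 'j) bimodule_scheme \<Rightarrow> ('r, 'n, 'k) module_scheme \<Rightarrow>
   ('m \<times> 'n \<Rightarrow>\<^sub>0 int) set"
  where "tensor_rel R M N =
    {frag_of (x \<oplus>\<^bsub>M\<^esub> x', y) - frag_of (x, y) - frag_of (x', y) | x x' y.
       x \<in> carrier M \<and> x' \<in> carrier M \<and> y \<in> carrier N} \<union>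
    {frag_of (x, y \<oplus>\<^bsub>N\<^esub> y') - frag_of (x, y) - frag_of (x, y') | x y y'.
       x \<in> carrier M \<and> y \<in> carrier N \<and> y' \<in> carrier N} \<union>
    {frag_of (rsmult M x r, y) - frag_of (x, r \<odot>\<^bsub>N\<^esub> y) | x r y.
       x \<in> carrier M \<and> r \<in> carrier R \<and> y \<in> carrier N}"

definition tensor_ker ::
  "('r, 'i) ring_scheme \<Rightarrow> ('a, 'r, 'm, 'j) bimodule_scheme \<Rightarrow> ('r, 'n, 'k) module_scheme \<Rightarrow>
   ('m \<times> 'n \<Rightarrow>\<^sub>0 int) set"
  where "tensor_ker R M N =
    generate (free_Abelian_group (carrier M \<times> carrier N)) (tensor_rel R M N)"

definition tensor_group ::
  "('r, 'i) ring_scheme \<Rightarrow> ('a, 'r, 'm, 'j) bimodule_scheme \<Rightarrow> ('r, 'n, 'k) module_scheme \<Rightarrow>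
   ('m \<times> 'n \<Rightarrow>\<^sub>0 int) set monoid"
  where "tensor_group R M N =
    free_Abelian_group (carrier M \<times> carrier N) Mod tensor_ker R M N"

definition pure_tensor ::
  "('r, 'i) ring_scheme \<Rightarrow> ('a, 'r, 'm, 'j) bimodule_scheme \<Rightarrow> ('r, 'n, 'k) module_scheme \<Rightarrow>
   'm \<Rightarrow> 'n \<Rightarrow> ('m \<times> 'n \<Rightarrow>\<^sub>0 int) set"
  where "pure_tensor R M N x y =
    tensor_ker R M N #>\<^bsub>free_Abelian_group (carrier M \<times> carrier N)\<^esub> frag_of (x, y)"

text \<open>The map \<open>f \<otimes> g\<close> from \<open>M \<otimes>\<^sub>R N\<close> to \<open>M' \<otimes>\<^sub>R N'\<close>. The image of a
  coset under the induced map of free abelian groups need only be contained in a coset, so the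
  target subgroup is added to it.\<close>

definition tensor_map ::
  "('r, 'i) ring_scheme \<Rightarrow> ('a, 'r, 'm, 'j) bimodule_scheme \<Rightarrow> ('r, 'n, 'k) module_scheme \<Rightarrow>
   ('b, 'r, 'p, 'l) bimodule_scheme \<Rightarrow> ('r, 'q, 'h) module_scheme \<Rightarrow>
   ('m \<Rightarrow> 'p) \<Rightarrow> ('n \<Rightarrow> 'q) \<Rightarrow> ('m \<times> 'n \<Rightarrow>\<^sub>0 int) set \<Rightarrow> ('p \<times> 'q \<Rightarrow>\<^sub>0 int) set"
  where "tensor_map R M N M' N' f g =
    (\<lambda>X\<in>carrier (tensor_group R M N).
       tensor_ker R M' N' <#>\<^bsub>free_Abelian_group (carrier M' \<times> carrier N')\<^esub>
         frag_extend (\<lambda>(x, y). frag_of (f x, g y)) ` X)"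

text \<open>For an \<open>A\<close>-\<open>R\<close>-bimodule \<open>M\<close>, the left \<open>A\<close>-module \<open>M \<otimes>\<^sub>R N\<close>.\<close>

definition tensor ::
  "('r, 'i) ring_scheme \<Rightarrow> ('a, 'r, 'm, 'j) bimodule_scheme \<Rightarrow> ('r, 'n, 'k) module_scheme \<Rightarrow>
   ('a, ('m \<times> 'n \<Rightarrow>\<^sub>0 int) set) module"
  where "tensor R M N =
    \<lparr>carrier = carrier (tensor_group R M N),
     mult = undefined, one = undefined,
     zero = \<one>\<^bsub>tensor_group R M N\<^esub>,
     add = monoid.mult (tensor_group R M N),
     smult = (\<lambda>a. tensor_map R M N M N (\<lambda>x. a \<odot>\<^bsub>M\<^esub> x) (\<lambda>y. y))\<rparr>"

lemma tensor_rel_subset: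
  assumes "\<And>x y. x \<in> carrier M \<Longrightarrow> y \<in> carrier M \<Longrightarrow> x \<oplus>\<^bsub>M\<^esub> y \<in> carrier M"
  and "\<And>x y. x \<in> carrier N \<Longrightarrow> y \<in> carrier N \<Longrightarrow> x \<oplus>\<^bsub>N\<^esub> y \<in> carrier N"
  and "\<And>x r. x \<in> carrier M \<Longrightarrow> r \<in> carrier R \<Longrightarrow> rsmult M x r \<in> carrier M"
  and "\<And>x r. x \<in> carrier N \<Longrightarrow> r \<in> carrier R \<Longrightarrow> r \<odot>\<^bsub>N\<^esub> x \<in> carrier N"
  shows "tensor_rel R M N \<subseteq> carrier (free_Abelian_group (carrier M \<times> carrier N))"
proof -
  have k: "Poly_Mapping.keys (a - b) \<subseteq> Z" if "Poly_Mapping.keys a \<subseteq> Z" "Poly_Mapping.keys b \<subseteq> Z" for a b :: "'z \<Rightarrow>\<^sub>0 int" and Z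
    using that keys_diff[of a b] by blast
  show ?thesis unfolding tensor_rel_def 
    by (intro subsetI) (elim UnE CollectE exE conjE; hypsubst; unfold carrier_free_Abelian_group_iff; intro k; simp add: assms)
qed

lemma tensor_map_pure_tensor:
  assumes ab: "\<And>x y. x \<in> carrier M \<Longrightarrow> y \<in> carrier M \<Longrightarrow> x \<oplus>\<^bsub>M\<^esub> y \<in> carrier M"
   "\<And>x y. x \<in> carrier N \<Longrightarrow> y \<in> carrier N \<Longrightarrow> x \<oplus>\<^bsub>N\<^esub> y \<in> carrier N"
   "\<And>x r. x \<in> carrier M \<Longrightarrow> r \<in> carrier R \<Longrightarrow> rsmult M x r \<in> carrier M"
   "\<And>x r. x \<in> carrier N \<Longrightarrow> r \<in> carrier R \<Longrightarrow> r \<odot>\<^bsub>N\<^esub> x \<in> carrier N"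
   and ab': "\<And>x y. x \<in> carrier M' \<Longrightarrow> y \<in> carrier M' \<Longrightarrow> x \<oplus>\<^bsub>M'\<^esub> y \<in> carrier M'"
   "\<And>x y. x \<in> carrier N' \<Longrightarrow> y \<in> carrier N' \<Longrightarrow> x \<oplus>\<^bsub>N'\<^esub> y \<in> carrier N'"
   "\<And>x r. x \<in> carrier M' \<Longrightarrow> r \<in> carrier R \<Longrightarrow> rsmult M' x r \<in> carrier M'"
   "\<And>x r. x \<in> carrier N' \<Longrightarrow> r \<in> carrier R \<Longrightarrow> r \<odot>\<^bsub>N'\<^esub> x \<in> carrier N'"
  and f: "\<And>x. x \<in> carrier M \<Longrightarrow> f x \<in> carrier M'"
    "\<And>x y. x \<in> carrier M \<Longrightarrow> y \<in> carrier M \<Longrightarrow> f (x \<oplus>\<^bsub>M\<^esub> y) = f x \<oplus>\<^bsub>M'\<^esub> f y"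
    "\<And>x r. x \<in> carrier M \<Longrightarrow> r \<in> carrier R \<Longrightarrow> f (rsmult M x r) = rsmult M' (f x) r"
  and g: "\<And>x. x \<in> carrier N \<Longrightarrow> g x \<in> carrier N'"
    "\<And>x y. x \<in> carrier N \<Longrightarrow> y \<in> carrier N \<Longrightarrow> g (x \<oplus>\<^bsub>N\<^esub> y) = g x \<oplus>\<^bsub>N'\<^esub> g y"
    "\<And>x r. x \<in> carrier N \<Longrightarrow> r \<in> carrier R \<Longrightarrow> g (r \<odot>\<^bsub>N\<^esub> x) = r \<odot>\<^bsub>N'\<^esub> g x"
  and xy: "x \<in> carrier M" "y \<in> carrier N"
  shows "tensor_map R M N M' N' f g (pure_tensor R M N x y) = pure_tensor R M' N' (f x) (g y)"
proof -
  let ?F = "frag_extend (\<lambda>(x, y). frag_of (f x, g y))"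
  let ?G = "free_Abelian_group (carrier M \<times> carrier N)" 
  let ?G' = "free_Abelian_group (carrier M' \<times> carrier N')"
  have sub: "tensor_rel R M N \<subseteq> carrier ?G" by (rule tensor_rel_subset) (fact ab)+
  have sub': "tensor_rel R M' N' \<subseteq> carrier ?G'" by (rule tensor_rel_subset) (fact ab')+
  interpret G': group ?G' by simp
  interpret G: group ?G by simp
  have sg: "subgroup (tensor_ker R M N) ?G" unfolding tensor_ker_def by (rule G.generate_is_subgroup[OF sub])
  have sg': "subgroup (tensor_ker R M' N') ?G'" unfolding tensor_ker_def by (rule G'.generate_is_subgroup[OF sub'])
  have r: "?F c \<in> tensor_rel R M' N'" if "c \<in> tensor_rel R M N" for c
    using that unfolding tensor_rel_def
    apply (elim UnE CollectE exE conjE; simp add: frag_extend_diff frag_extend_add ab f g)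
    by (metis f g)+
  have F: "?F c \<in> tensor_ker R M' N'" if "c \<in> tensor_ker R M N" for c
    using that unfolding tensor_ker_def
  proof (induction rule: generate.induct)
    case one then show ?case using generate.one[of ?G'] by simp
  next
    case (incl h) then show ?case using r generate.incl by metis
  next
    case (inv h) 
    have "Poly_Mapping.keys h \<subseteq> carrier M \<times> carrier N" using inv sub unfolding subset_iff[of "tensor_rel R M N"] carrier_free_Abelian_group_iff by blast
    moreover have "Poly_Mapping.keys (?F h) \<subseteq> carrier M' \<times> carrier N'" using r[OF inv] sub' unfolding subset_iff[of "tensor_rel R M' N'"] carrier_free_Abelian_group_iff by blast
    ultimately show ?case using generate.inv[OF r[OF inv], of ?G'] by (simp add: frag_extend_minus)
  next
    case (eng a b) then show ?case using generate.eng[of _ ?G'] by (fastforce simp: frag_extend_add)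
  qed
  have z: "0 \<in> tensor_ker R M N" using subgroup.one_closed[OF sg] by simp
  have plus: "a + b \<in> tensor_ker R M' N'" if "a \<in> tensor_ker R M' N'" "b \<in> tensor_ker R M' N'" for a b
    using subgroup.m_closed[OF sg' that] by simp
  have Fadd: "?F (h + frag_of (x,y)) = ?F h + frag_of (f x, g y)" for h by (simp add: frag_extend_add)
  have dom: "pure_tensor R M N x y \<in> carrier (tensor_group R M N)"
    using xy by (auto simp: tensor_group_def carrier_FactGroup pure_tensor_def)
  have coset: "pure_tensor R M N x y = (\<lambda>h. h + frag_of (x, y)) ` tensor_ker R M N"
    "pure_tensor R M' N' (f x) (g y) = (\<lambda>k. k + frag_of (f x, g y)) ` tensor_ker R M' N'"
    by (auto simp: pure_tensor_def r_coset_def)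
  have "tensor_map R M N M' N' f g (pure_tensor R M N x y) =
    {k + ?F c | k c. k \<in> tensor_ker R M' N' \<and> c \<in> pure_tensor R M N x y}"
    using dom by (auto simp: tensor_map_def set_mult_def)
  also have "\<dots> = {k + (?F h + frag_of (f x, g y)) | k h. k \<in> tensor_ker R M' N' \<and> h \<in> tensor_ker R M N}"
    unfolding coset Fadd[symmetric] by blast
  also have "\<dots> = pure_tensor R M' N' (f x) (g y)"
    unfolding coset
  proof (intro subset_antisym subsetI)
    fix c assume "c \<in> {k + (?F h + frag_of (f x, g y)) | k h. k \<in> tensor_ker R M' N' \<and> h \<in> tensor_ker R M N}"
    then obtain k h where "k \<in> tensor_ker R M' N'" "h \<in> tensor_ker R M N"
      "c = (k + ?F h) + frag_of (f x, g y)"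
      unfolding add.assoc by blast
    then show "c \<in> (\<lambda>k. k + frag_of (f x, g y)) ` tensor_ker R M' N'"
      using plus F by blast
  next
    fix c assume "c \<in> (\<lambda>k. k + frag_of (f x, g y)) ` tensor_ker R M' N'"
    then obtain k where "k \<in> tensor_ker R M' N'" "c = k + (?F 0 + frag_of (f x, g y))"
      by auto
    then show "c \<in> {k + (?F h + frag_of (f x, g y)) | k h. k \<in> tensor_ker R M' N' \<and> h \<in> tensor_ker R M N}"
      using z by blast
  qed
  finally show ?thesis .
qed

lemma rho_pure_tensor:
  assumes "ring R" "ring A" "\<iota> \<in> ring_hom R A" "left_module R T" "s \<in> carrier (lmod_End R T)"
    and "a \<in> carrier A" "t \<in> carrier T"
  shows "tensor_map R (ext_bimodule \<iota> A) T (ext_bimodule \<iota> A) T (\<lambda>a. a) s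
           (pure_tensor R (ext_bimodule \<iota> A) T a t) =
         pure_tensor R (ext_bimodule \<iota> A) T a (s t)"
proof -
  interpret R: ring R by fact
  interpret A: ring A by fact
  interpret T: left_module R T by fact
  have s: "s x \<in> carrier T" if "x \<in> carrier T" for x
    using assms(5) that by (auto simp: lmod_End_def lmod_hom_def)
  show ?thesis
    using assms ring_hom_closed[OF assms(3)] s
    by (intro tensor_map_pure_tensor) (simp_all add: ext_bimodule_def lmod_End_def lmod_hom_def)
qed

lemma tensor_smult_pure_tensor:
  assumes "ring R" "ring A" "\<iota> \<in> ring_hom R A" "left_module R T"
    and "b \<in> carrier A" "a \<in> carrier A" "t \<in> carrier T"
  shows "b \<odot>\<^bsub>tensor R (ext_bimodule \<iota> A) T\<^esub> pure_tensor R (ext_bimodule \<iota> A) T a t =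
         pure_tensor R (ext_bimodule \<iota> A) T (b \<otimes>\<^bsub>A\<^esub> a) t"
proof -
  interpret R: ring R by fact
  interpret A: ring A by fact
  interpret T: left_module R T by fact
  have "b \<odot>\<^bsub>tensor R (ext_bimodule \<iota> A) T\<^esub> pure_tensor R (ext_bimodule \<iota> A) T a t =
      pure_tensor R (ext_bimodule \<iota> A) T (b \<odot>\<^bsub>ext_bimodule \<iota> A\<^esub> a) t"
    unfolding tensor_def module.simps
    using assms ring_hom_closed[OF assms(3)]
    by (intro tensor_map_pure_tensor) (simp_all add: ext_bimodule_def A.r_distr A.m_assoc)
  then show ?thesis
    by (simp add: ext_bimodule_def)
qed

end

theory Submission
  imports Defs
begin

text \<open>A Frobenius extension \<open>R \<rightarrow> A\<close> amounts to an \<open>R\<close>-\<open>R\<close>-bilinear map \<open>E : A \<rightarrow> R\<close> with finitely many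
  \<open>x\<^sub>i, y\<^sub>i\<close> such that \<open>\<Sum>\<^sub>i E(a y\<^sub>i) x\<^sub>i = a = \<Sum>\<^sub>i y\<^sub>i E(x\<^sub>i a)\<close>. Let \<open>(t\<^sub>k, \<tau>\<^sub>k)\<close> be a dual basis of \<open>T\<close>,
  and let \<open>g\<^sub>j : T \<rightarrow> R\<close> and \<open>u\<^sub>j \<in> T\<close> satisfy \<open>\<Sum>\<^sub>j g\<^sub>j(u\<^sub>j) = 1\<close>, which is what being a generator means.
  The functionals \<open>1 \<otimes> \<tau>\<^sub>k\<close> and \<open>1 \<otimes> g\<^sub>j\<close> exhibit a dual basis and a partition of unity for
  \<open>U = A \<otimes>\<^sub>R T\<close>. The extension \<open>S \<rightarrow> B\<close> has the Frobenius homomorphism that sends \<open>b\<close> to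
  \<open>s \<mapsto> (E \<otimes> 1)(b(1 \<otimes> s))\<close>, with dual bases
  \<open>x\<^sub>k\<^sub>i\<^sub>j(v) = (1 \<otimes> g\<^sub>j)(v) (x\<^sub>i \<otimes> t\<^sub>k)\<close> and \<open>y\<^sub>k\<^sub>i\<^sub>j(v) = (1 \<otimes> \<tau>\<^sub>k)(v) (y\<^sub>i \<otimes> u\<^sub>j)\<close>.\<close>

section \<open>Left modules\<close>

text \<open>Morita theory dictates the formulas. Restriction to \<open>1 \<otimes> T\<close>
  identifies \<open>B\<close> with Hom_R(T, A \<otimes> T) and, \<open>T\<close> being finitely
  generated projective, with Hom_R(T, R) \<otimes> A \<otimes> T, tensors being over
  \<open>R\<close>; likewise \<open>S\<close> is Hom_R(T, R) \<otimes> T. In this picture the new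
  Frobenius homomorphism is \<open>1 \<otimes> E \<otimes> 1\<close>, and the dual bases are the
  tensors \<open>g\<^sub>j \<otimes> x\<^sub>i \<otimes> t\<^sub>k\<close> and
  \<open>\<tau>\<^sub>k \<otimes> y\<^sub>i \<otimes> u\<^sub>j\<close>. In their products
  \<open>g\<^sub>j\<close> meets \<open>u\<^sub>j\<close>, so the sum over \<open>j\<close>
  collapses to 1; the sum over \<open>i\<close> is a dual basis identity of \<open>A\<close>, and
  the sum over \<open>k\<close> is an expansion in \<open>T\<close>. The obstacle is that the
  hypotheses test only modules on \<open>(nat \<Rightarrow> 'r) set\<close>, whereas the conclusions
  concern modules on any type. The hypotheses are therefore converted into finite equational data
  that mention no test modules, and the conclusions are read off from such data over
  \<open>A\<close> and \<open>S\<close>.\<close>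

lemma (in abelian_monoid) finsum_product:
  assumes "finite I" "finite J" "\<And>i j. i \<in> I \<Longrightarrow> j \<in> J \<Longrightarrow> h i j \<in> carrier G"
  shows "(\<Oplus>p\<in>I \<times> J. h (fst p) (snd p)) = (\<Oplus>i\<in>I. \<Oplus>j\<in>J. h i j)"
  using assms(1,3)
proof (induction I rule: finite_induct)
  case empty
  then show ?case by simp
next
  case (insert i I)
  have eq: "insert i I \<times> J = Pair i ` J \<union> I \<times> J" by auto
  have disj: "Pair i ` J \<inter> I \<times> J = {}" using insert.hyps by auto
  have "(\<Oplus>p\<in>Pair i ` J. h (fst p) (snd p)) = (\<Oplus>j\<in>J. h i j)"
    using insert.prems by (subst finsum_reindex) (auto simp: inj_on_def)
  then show ?case
    unfolding eq using insert assms(2) disj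
    by (subst finsum_Un_disjoint) (auto intro!: finsum_closed simp: Pi_def)
qed

text \<open>\<open>I\<close> may be infinite: both sums are then zero by convention, and additivity
  forces \<open>f\<close> to preserve zero, because the image of zero is idempotent for
  addition.\<close>

lemma additive_finsum:
  assumes "abelian_group M" "abelian_group N"
    and "\<And>x. x \<in> carrier M \<Longrightarrow> f x \<in> carrier N"
    and "\<And>x y. x \<in> carrier M \<Longrightarrow> y \<in> carrier M \<Longrightarrow> f (x \<oplus>\<^bsub>M\<^esub> y) = f x \<oplus>\<^bsub>N\<^esub> f y"
    and "\<And>i. i \<in> I \<Longrightarrow> g i \<in> carrier M"
  shows "f (\<Oplus>\<^bsub>M\<^esub>i\<in>I. g i) = (\<Oplus>\<^bsub>N\<^esub>i\<in>I. f (g i))"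
proof -
  interpret M: abelian_group M by fact
  interpret N: abelian_group N by fact
  have "f \<zero>\<^bsub>M\<^esub> \<oplus>\<^bsub>N\<^esub> f \<zero>\<^bsub>M\<^esub> = f \<zero>\<^bsub>M\<^esub>"
    by (metis M.l_zero M.zero_closed assms(4))
  then have z: "f \<zero>\<^bsub>M\<^esub> = \<zero>\<^bsub>N\<^esub>"
    using N.add.l_cancel_one assms(3) by blast
  show ?thesis
    using assms(5)
  proof (induction I rule: infinite_finite_induct)
    case (insert i I)
    then show ?case by (simp add: assms(3,4) Pi_def M.finsum_closed)
  qed (simp_all add: z)
qed

context left_module
begin

lemma smult_l_null [simp]:
  assumes "x \<in> carrier M"
  shows "\<zero> \<odot>\<^bsub>M\<^esub> x = \<zero>\<^bsub>M\<^esub>"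
  using smult_l_distr[OF R.zero_closed R.zero_closed assms] assms M.add.l_cancel_one
  by (metis R.l_zero R.zero_closed smult_closed)

lemma smult_r_null [simp]:
  assumes "a \<in> carrier R"
  shows "a \<odot>\<^bsub>M\<^esub> \<zero>\<^bsub>M\<^esub> = \<zero>\<^bsub>M\<^esub>"
  using smult_r_distr[OF assms M.zero_closed M.zero_closed] assms M.add.l_cancel_one
  by (metis M.l_zero M.zero_closed smult_closed)

lemma finsum_smult_r:
  assumes "a \<in> carrier R" "\<And>i. i \<in> I \<Longrightarrow> x i \<in> carrier M"
  shows "a \<odot>\<^bsub>M\<^esub> (\<Oplus>\<^bsub>M\<^esub>i\<in>I. x i) = (\<Oplus>\<^bsub>M\<^esub>i\<in>I. a \<odot>\<^bsub>M\<^esub> x i)"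
  using assms M.abelian_group_axioms by (intro additive_finsum) (auto simp: smult_r_distr)

lemma finsum_smult_l:
  assumes "x \<in> carrier M" "\<And>i. i \<in> I \<Longrightarrow> a i \<in> carrier R"
  shows "(\<Oplus>i\<in>I. a i) \<odot>\<^bsub>M\<^esub> x = (\<Oplus>\<^bsub>M\<^esub>i\<in>I. a i \<odot>\<^bsub>M\<^esub> x)"
  using assms R.abelian_group_axioms M.abelian_group_axioms
  by (intro additive_finsum[where f="\<lambda>a. a \<odot>\<^bsub>M\<^esub> x"]) (auto simp: smult_l_distr)

end

section \<open>Extensional linear maps\<close>

lemma lmod_homI:
  assumes "\<And>x. x \<in> carrier M \<Longrightarrow> f x \<in> carrier N"
    and "\<And>x y. x \<in> carrier M \<Longrightarrow> y \<in> carrier M \<Longrightarrow> f (x \<oplus>\<^bsub>M\<^esub> y) = f x \<oplus>\<^bsub>N\<^esub> f y"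
    and "\<And>r x. r \<in> carrier R \<Longrightarrow> x \<in> carrier M \<Longrightarrow> f (r \<odot>\<^bsub>M\<^esub> x) = r \<odot>\<^bsub>N\<^esub> f x"
    and "\<And>x. x \<notin> carrier M \<Longrightarrow> f x = undefined"
  shows "f \<in> lmod_hom R M N"
  using assms by (auto simp: lmod_hom_def)

text \<open>The module axioms enter through the closure of the carrier: a restricted function can be
  evaluated at a sum or a scalar multiple only if these lie in the carrier.\<close>

lemma lmod_hom_restrictI:
  assumes "left_module R M"
    and "\<And>x. x \<in> carrier M \<Longrightarrow> f x \<in> carrier N"
    and "\<And>x y. x \<in> carrier M \<Longrightarrow> y \<in> carrier M \<Longrightarrow> f (x \<oplus>\<^bsub>M\<^esub> y) = f x \<oplus>\<^bsub>N\<^esub> f y"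
    and "\<And>r x. r \<in> carrier R \<Longrightarrow> x \<in> carrier M \<Longrightarrow> f (r \<odot>\<^bsub>M\<^esub> x) = r \<odot>\<^bsub>N\<^esub> f x"
  shows "restrict f (carrier M) \<in> lmod_hom R M N"
proof -
  interpret left_module R M by fact
  show ?thesis using assms(2-) by (intro lmod_homI) auto
qed

lemma
  assumes "f \<in> lmod_hom R M N"
  shows lmod_hom_closed: "x \<in> carrier M \<Longrightarrow> f x \<in> carrier N"
    and lmod_hom_add: "x \<in> carrier M \<Longrightarrow> y \<in> carrier M \<Longrightarrow> f (x \<oplus>\<^bsub>M\<^esub> y) = f x \<oplus>\<^bsub>N\<^esub> f y"
    and lmod_hom_smult: "r \<in> carrier R \<Longrightarrow> x \<in> carrier M \<Longrightarrow> f (r \<odot>\<^bsub>M\<^esub> x) = r \<odot>\<^bsub>N\<^esub> f x"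
  using assms by (auto simp: lmod_hom_def)

lemma lmod_hom_eqI:
  assumes "f \<in> lmod_hom R M N" "g \<in> lmod_hom R M N'"
    and "\<And>x. x \<in> carrier M \<Longrightarrow> f x = g x"
  shows "f = g"
  using assms by (intro extensionalityI[of f "carrier M" g]) (auto simp: lmod_hom_def PiE_def)

lemma lmod_hom_compose:
  assumes "left_module R M" "f \<in> lmod_hom R M N" "g \<in> lmod_hom R N P"
  shows "compose (carrier M) g f \<in> lmod_hom R M P"
  unfolding compose_def
  using assms
  by (intro lmod_hom_restrictI)
    (simp_all add: lmod_hom_closed[OF assms(2)] lmod_hom_closed[OF assms(3)]
      lmod_hom_add[OF assms(2)] lmod_hom_add[OF assms(3)]
      lmod_hom_smult[OF assms(2)] lmod_hom_smult[OF assms(3)])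

lemma lmod_hom_finsum:
  assumes "left_module R M" "left_module R N" "f \<in> lmod_hom R M N" "\<And>i. i \<in> I \<Longrightarrow> g i \<in> carrier M"
  shows "f (\<Oplus>\<^bsub>M\<^esub>i\<in>I. g i) = (\<Oplus>\<^bsub>N\<^esub>i\<in>I. f (g i))"
proof -
  interpret M: left_module R M by fact
  interpret N: left_module R N by fact
  show ?thesis
    using assms M.M.abelian_group_axioms N.M.abelian_group_axioms
    by (intro additive_finsum) (simp_all add: lmod_hom_closed lmod_hom_add)
qed

section \<open>A ring as a left module along a ring homomorphism\<close>

lemma ext_module_simps [simp]:
  "carrier (ext_module \<iota> A) = carrier A"
  "add (ext_module \<iota> A) = add A"
  "zero (ext_module \<iota> A) = zero A"
  "smult (ext_module \<iota> A) = (\<lambda>r a. \<iota> r \<otimes>\<^bsub>A\<^esub> a)"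
  by (simp_all add: ext_module_def)

text \<open>\<open>finsum\<close> sees only the carrier, the addition and the zero, which
  \<open>ext_module\<close> takes over from \<open>A\<close>; so sums in the module can be computed
  in the ring.\<close>

lemma finsum_ext_module [simp]: "finsum (ext_module \<iota> A) = finsum A"
  by (intro ext) (simp add: finsum_def ext_module_def finprod_def)

lemma left_module_ext_module:
  assumes "ring R" "ring A" "\<iota> \<in> ring_hom R A"
  shows "left_module R (ext_module \<iota> A)"
proof -
  interpret R: ring R by fact
  interpret A: ring A by fact
  have "abelian_group (ext_module \<iota> A)"
  proof (rule abelian_groupI)
    fix x assume "x \<in> carrier (ext_module \<iota> A)"
    then show "\<exists>y\<in>carrier (ext_module \<iota> A). y \<oplus>\<^bsub>ext_module \<iota> A\<^esub> x = \<zero>\<^bsub>ext_module \<iota> A\<^esub>"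
      by (intro bexI[of _ "\<ominus>\<^bsub>A\<^esub> x"]) (auto simp: A.l_neg)
  qed (auto simp: A.a_ac)
  then show ?thesis
    using ring_hom_closed[OF assms(3)] ring_hom_add[OF assms(3)] ring_hom_mult[OF assms(3)]
      ring_hom_one[OF assms(3)] R.ring_axioms
    by (intro left_module.intro left_module_axioms.intro)
      (simp_all add: A.l_distr A.r_distr A.m_assoc)
qed

lemma left_module_regular: "ring R \<Longrightarrow> left_module R (ext_module id R)"
  by (intro left_module_ext_module) (auto simp: ring_hom_def)

text \<open>Provides quotients and isomorphic copies of a module on a prescribed type: \<open>e\<close> need only be
  compatible with the operations.\<close>

definition image_module :: "('m \<Rightarrow> 'n) \<Rightarrow> ('r, 'm, 'j) module_scheme \<Rightarrow> ('r, 'n) module"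
  where "image_module e M =
    \<lparr>carrier = e ` carrier M, mult = undefined, one = undefined, zero = e \<zero>\<^bsub>M\<^esub>,
     add = (\<lambda>u v. e (inv_into (carrier M) e u \<oplus>\<^bsub>M\<^esub> inv_into (carrier M) e v)),
     smult = (\<lambda>r u. e (r \<odot>\<^bsub>M\<^esub> inv_into (carrier M) e u))\<rparr>"

locale module_congruence = left_module +
  fixes e :: "'c \<Rightarrow> 'f"
  assumes cong_add: "\<lbrakk>x \<in> carrier M; x' \<in> carrier M; y \<in> carrier M; y' \<in> carrier M;
      e x = e x'; e y = e y'\<rbrakk> \<Longrightarrow> e (x \<oplus>\<^bsub>M\<^esub> y) = e (x' \<oplus>\<^bsub>M\<^esub> y')"
    and cong_smult: "\<lbrakk>r \<in> carrier R; x \<in> carrier M; x' \<in> carrier M; e x = e x'\<rbrakk> \<Longrightarrow>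
      e (r \<odot>\<^bsub>M\<^esub> x) = e (r \<odot>\<^bsub>M\<^esub> x')"
begin

lemma carrier_image_module [simp]: "carrier (image_module e M) = e ` carrier M"
  and zero_image_module [simp]: "\<zero>\<^bsub>image_module e M\<^esub> = e \<zero>\<^bsub>M\<^esub>"
  by (simp_all add: image_module_def)

lemma add_image_module [simp]:
  assumes "x \<in> carrier M" "y \<in> carrier M"
  shows "e x \<oplus>\<^bsub>image_module e M\<^esub> e y = e (x \<oplus>\<^bsub>M\<^esub> y)"
  unfolding image_module_def using assms
  by (auto intro!: cong_add simp: inv_into_into f_inv_into_f)

lemma smult_image_module [simp]:
  assumes "r \<in> carrier R" "x \<in> carrier M"
  shows "r \<odot>\<^bsub>image_module e M\<^esub> e x = e (r \<odot>\<^bsub>M\<^esub> x)"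
  unfolding image_module_def using assms
  by (auto intro!: cong_smult simp: inv_into_into f_inv_into_f)

lemma left_module_image_module: "left_module R (image_module e M)"
proof (intro left_module.intro left_module_axioms.intro)
  show "abelian_group (image_module e M)"
  proof (rule abelian_groupI)
    fix u assume "u \<in> carrier (image_module e M)"
    then obtain x where "x \<in> carrier M" "u = e x" by auto
    then show "\<exists>v\<in>carrier (image_module e M). v \<oplus>\<^bsub>image_module e M\<^esub> u = \<zero>\<^bsub>image_module e M\<^esub>"
      by (intro bexI[of _ "e (\<ominus>\<^bsub>M\<^esub> x)"]) (auto simp: M.l_neg)
  qed (auto simp: M.a_ac)
qed (auto simp: R.ring_axioms smult_l_distr smult_r_distr smult_assoc)

lemma image_module_hom: "restrict e (carrier M) \<in> lmod_hom R M (image_module e M)"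
  by (intro lmod_hom_restrictI left_module_axioms) auto

end

context left_module
begin

lemma module_congruence_inj: "inj_on e (carrier M) \<Longrightarrow> module_congruence R M e"
  by unfold_locales (auto simp: inj_on_def)

text \<open>Together with \<open>image_module_hom\<close> this makes an injective image an
  isomorphic copy, so that maps found on a prescribed type can be carried back to the original
  module.\<close>

lemma image_module_inv_hom:
  assumes "inj_on e (carrier M)"
  shows "restrict (inv_into (carrier M) e) (e ` carrier M) \<in> lmod_hom R (image_module e M) M"
proof -
  interpret e: module_congruence R M e
    using assms by (rule module_congruence_inj)
  show ?thesis
    unfolding e.carrier_image_module[symmetric]
    using assms by (intro lmod_hom_restrictI e.left_module_image_module) auto
qed

end

section \<open>Dual bases and generators\<close>

definition power_module :: "('r, 'i) ring_scheme \<Rightarrow> nat \<Rightarrow> ('r, nat \<Rightarrow> 'r) module"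
  where "power_module R n =
    \<lparr>carrier = {..<n} \<rightarrow>\<^sub>E carrier R, mult = undefined, one = undefined,
     zero = (\<lambda>i\<in>{..<n}. \<zero>\<^bsub>R\<^esub>), add = (\<lambda>f g. \<lambda>i\<in>{..<n}. f i \<oplus>\<^bsub>R\<^esub> g i),
     smult = (\<lambda>r f. \<lambda>i\<in>{..<n}. r \<otimes>\<^bsub>R\<^esub> f i)\<rparr>"

lemma power_module_simps [simp]:
  "carrier (power_module R n) = {..<n} \<rightarrow>\<^sub>E carrier R"
  "\<zero>\<^bsub>power_module R n\<^esub> = (\<lambda>i\<in>{..<n}. \<zero>\<^bsub>R\<^esub>)"
  "f \<oplus>\<^bsub>power_module R n\<^esub> g = (\<lambda>i\<in>{..<n}. f i \<oplus>\<^bsub>R\<^esub> g i)"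
  "r \<odot>\<^bsub>power_module R n\<^esub> f = (\<lambda>i\<in>{..<n}. r \<otimes>\<^bsub>R\<^esub> f i)"
  by (simp_all add: power_module_def)

lemma (in ring) left_module_power_module: "left_module R (power_module R n)"
proof -
  let ?F = "power_module R n"
  have mem: "f i \<in> carrier R" if "f \<in> carrier ?F" "i < n" for f i
    using that by auto
  \<comment> \<open>A tuple is rewritten as a restricted abstraction, so that an identity of tuples
    becomes one of coordinates.\<close>
  have eqI: "f = (\<lambda>i\<in>{..<n}. h i)" if "f \<in> carrier ?F" "\<And>i. i < n \<Longrightarrow> f i = h i" for f h
    using that by (intro extensionalityI[of f "{..<n}"]) (auto simp: PiE_def)
  have "abelian_group ?F"
  proof (rule abelian_groupI)
    fix f assume f: "f \<in> carrier ?F"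
    show "\<zero>\<^bsub>?F\<^esub> \<oplus>\<^bsub>?F\<^esub> f = f"
      using mem[OF f] by (subst eqI[OF f, of f]) (simp_all cong: restrict_cong)
    show "\<exists>g\<in>carrier ?F. g \<oplus>\<^bsub>?F\<^esub> f = \<zero>\<^bsub>?F\<^esub>"
    proof
      show "(\<lambda>i\<in>{..<n}. \<ominus> f i) \<oplus>\<^bsub>?F\<^esub> f = \<zero>\<^bsub>?F\<^esub>"
        using mem[OF f] by (simp add: l_neg cong: restrict_cong)
      show "(\<lambda>i\<in>{..<n}. \<ominus> f i) \<in> carrier ?F"
        using mem[OF f] by simp
    qed
  next
    fix f g assume fg: "f \<in> carrier ?F" "g \<in> carrier ?F"
    show "f \<oplus>\<^bsub>?F\<^esub> g \<in> carrier ?F"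
      using mem[OF fg(1)] mem[OF fg(2)] by simp
    show "f \<oplus>\<^bsub>?F\<^esub> g = g \<oplus>\<^bsub>?F\<^esub> f"
      using mem[OF fg(1)] mem[OF fg(2)] by (simp add: a_comm cong: restrict_cong)
    fix h assume h: "h \<in> carrier ?F"
    show "f \<oplus>\<^bsub>?F\<^esub> g \<oplus>\<^bsub>?F\<^esub> h = f \<oplus>\<^bsub>?F\<^esub> (g \<oplus>\<^bsub>?F\<^esub> h)"
      using mem[OF fg(1)] mem[OF fg(2)] mem[OF h] by (simp add: a_assoc cong: restrict_cong)
  qed simp
  then show ?thesis
  proof (intro left_module.intro left_module_axioms.intro ring_axioms)
    fix f assume f: "f \<in> carrier ?F"
    show "\<one> \<odot>\<^bsub>?F\<^esub> f = f"
      using mem[OF f] by (subst eqI[OF f, of f]) (simp_all cong: restrict_cong)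
  next
    fix a f assume af: "a \<in> carrier R" "f \<in> carrier ?F"
    show "a \<odot>\<^bsub>?F\<^esub> f \<in> carrier ?F"
      using af(1) mem[OF af(2)] by simp
    fix b assume b: "b \<in> carrier R"
    show "(a \<oplus> b) \<odot>\<^bsub>?F\<^esub> f = a \<odot>\<^bsub>?F\<^esub> f \<oplus>\<^bsub>?F\<^esub> b \<odot>\<^bsub>?F\<^esub> f"
      "a \<otimes> b \<odot>\<^bsub>?F\<^esub> f = a \<odot>\<^bsub>?F\<^esub> (b \<odot>\<^bsub>?F\<^esub> f)"
      using af(1) b mem[OF af(2)] by (simp_all add: l_distr m_assoc cong: restrict_cong)
  next
    fix a f g assume afg: "a \<in> carrier R" "f \<in> carrier ?F" "g \<in> carrier ?F"
    show "a \<odot>\<^bsub>?F\<^esub> (f \<oplus>\<^bsub>?F\<^esub> g) = a \<odot>\<^bsub>?F\<^esub> f \<oplus>\<^bsub>?F\<^esub> a \<odot>\<^bsub>?F\<^esub> g"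
      using afg(1) mem[OF afg(2)] mem[OF afg(3)] by (simp add: r_distr cong: restrict_cong)
  qed
qed

text \<open>By the dual basis lemma such data exist exactly for finitely generated projective
  modules. In contrast to \<open>projective\<close> they mention no test modules, which makes the
  passage between types possible.\<close>

definition dual_basis ::
  "('r, 'i) ring_scheme \<Rightarrow> ('r, 'm, 'j) module_scheme \<Rightarrow> 'x set \<Rightarrow> ('x \<Rightarrow> 'm) \<Rightarrow> ('x \<Rightarrow> 'm \<Rightarrow> 'r) \<Rightarrow> bool"
  where "dual_basis R M I x \<xi> \<longleftrightarrow> left_module R M \<and> finite I \<and> x \<in> I \<rightarrow> carrier M \<and>
    \<xi> \<in> I \<rightarrow> lmod_hom R M (ext_module id R) \<and>
    (\<forall>m\<in>carrier M. m = (\<Oplus>\<^bsub>M\<^esub>i\<in>I. \<xi> i m \<odot>\<^bsub>M\<^esub> x i))"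

text \<open>No commutativity is at stake: linearity of \<open>\<xi>\<close> produces the scalar to
  the left of \<open>\<xi> p\<close>, where associativity of the action takes it out.\<close>

lemma lmod_hom_smult_const:
  assumes "left_module R P" "left_module R M" "\<xi> \<in> lmod_hom R P (ext_module id R)" "m \<in> carrier M"
  shows "(\<lambda>p\<in>carrier P. \<xi> p \<odot>\<^bsub>M\<^esub> m) \<in> lmod_hom R P M"
proof -
  interpret M: left_module R M by fact
  show ?thesis
    using assms(4) lmod_hom_closed[OF assms(3)]
    by (intro lmod_hom_restrictI[OF assms(1)])
      (simp_all add: lmod_hom_add[OF assms(3)] lmod_hom_smult[OF assms(3)] M.smult_l_distr M.smult_assoc)
qed

lemma lmod_hom_lincomb:
  assumes "left_module R P" "left_module R M" "\<And>i. i \<in> I \<Longrightarrow> \<xi> i \<in> lmod_hom R P (ext_module id R)"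
    and "\<And>i. i \<in> I \<Longrightarrow> y i \<in> carrier M"
  shows "(\<lambda>p\<in>carrier P. \<Oplus>\<^bsub>M\<^esub>i\<in>I. \<xi> i p \<odot>\<^bsub>M\<^esub> y i) \<in> lmod_hom R P M"
proof (rule lmod_hom_restrictI[OF assms(1)])
  interpret M: left_module R M by fact
  have c: "\<xi> i p \<in> carrier R" if "i \<in> I" "p \<in> carrier P" for i p
    using lmod_hom_closed[OF assms(3)[OF that(1)] that(2)] by simp
  show "(\<Oplus>\<^bsub>M\<^esub>i\<in>I. \<xi> i p \<odot>\<^bsub>M\<^esub> y i) \<in> carrier M" if "p \<in> carrier P" for p
    using that c assms(4) by (intro M.finsum_closed) auto
  show "(\<Oplus>\<^bsub>M\<^esub>i\<in>I. \<xi> i (p \<oplus>\<^bsub>P\<^esub> q) \<odot>\<^bsub>M\<^esub> y i) =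
      (\<Oplus>\<^bsub>M\<^esub>i\<in>I. \<xi> i p \<odot>\<^bsub>M\<^esub> y i) \<oplus>\<^bsub>M\<^esub> (\<Oplus>\<^bsub>M\<^esub>i\<in>I. \<xi> i q \<odot>\<^bsub>M\<^esub> y i)"
    if "p \<in> carrier P" "q \<in> carrier P" for p q
  proof -
    have "(\<Oplus>\<^bsub>M\<^esub>i\<in>I. \<xi> i (p \<oplus>\<^bsub>P\<^esub> q) \<odot>\<^bsub>M\<^esub> y i) = (\<Oplus>\<^bsub>M\<^esub>i\<in>I. \<xi> i p \<odot>\<^bsub>M\<^esub> y i \<oplus>\<^bsub>M\<^esub> \<xi> i q \<odot>\<^bsub>M\<^esub> y i)"
      using that c assms(4)
      by (intro M.finsum_cong') (auto simp: lmod_hom_add[OF assms(3)] M.smult_l_distr)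
    also have "\<dots> = (\<Oplus>\<^bsub>M\<^esub>i\<in>I. \<xi> i p \<odot>\<^bsub>M\<^esub> y i) \<oplus>\<^bsub>M\<^esub> (\<Oplus>\<^bsub>M\<^esub>i\<in>I. \<xi> i q \<odot>\<^bsub>M\<^esub> y i)"
      using that c assms(4) by (intro M.finsum_addf) auto
    finally show ?thesis .
  qed
  show "(\<Oplus>\<^bsub>M\<^esub>i\<in>I. \<xi> i (r \<odot>\<^bsub>P\<^esub> p) \<odot>\<^bsub>M\<^esub> y i) = r \<odot>\<^bsub>M\<^esub> (\<Oplus>\<^bsub>M\<^esub>i\<in>I. \<xi> i p \<odot>\<^bsub>M\<^esub> y i)"
    if "r \<in> carrier R" "p \<in> carrier P" for r p
    using that c assms(4) lmod_hom_smult[OF assms(3)]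
    by (subst M.finsum_smult_r) (auto intro!: M.finsum_cong' simp: M.smult_assoc)
qed

text \<open>A family may repeat a vector, whereas \<open>fin_gen\<close> asks for a set with one
  coefficient per element. The coefficients of equal vectors are collected by induction over the
  index set.\<close>

lemma fin_genI:
  fixes R (structure)
  assumes "left_module R M" "finite I" "x \<in> I \<rightarrow> carrier M"
    and gen: "\<And>m. m \<in> carrier M \<Longrightarrow> \<exists>c\<in>I \<rightarrow> carrier R. m = (\<Oplus>\<^bsub>M\<^esub>i\<in>I. c i \<odot>\<^bsub>M\<^esub> x i)"
  shows "fin_gen R M"
proof -
  interpret left_module R M by fact
  define X where "X = x ` I"
  have X: "finite X" "X \<subseteq> carrier M" using assms(2,3) by (auto simp: X_def)
  have comb: "\<exists>d\<in>X \<rightarrow> carrier R. (\<Oplus>\<^bsub>M\<^esub>i\<in>J. c i \<odot>\<^bsub>M\<^esub> x i) = (\<Oplus>\<^bsub>M\<^esub>v\<in>X. d v \<odot>\<^bsub>M\<^esub> v)"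
    if c: "c \<in> I \<rightarrow> carrier R" and "finite J" "J \<subseteq> I" for c J
    using that(2,3)
  proof (induction J rule: finite_induct)
    case empty
    have "(\<Oplus>\<^bsub>M\<^esub>v\<in>X. \<zero> \<odot>\<^bsub>M\<^esub> v) = \<zero>\<^bsub>M\<^esub>"
      using X by (intro M.add.finprod_one_eqI) auto
    then show ?case by (intro bexI[of _ "\<lambda>_. \<zero>"]) auto
  next
    case (insert i J)
    then obtain d where d: "d \<in> X \<rightarrow> carrier R"
      "(\<Oplus>\<^bsub>M\<^esub>i\<in>J. c i \<odot>\<^bsub>M\<^esub> x i) = (\<Oplus>\<^bsub>M\<^esub>v\<in>X. d v \<odot>\<^bsub>M\<^esub> v)" by auto
    \<comment> \<open>The new term is written as a sum over \<open>X\<close> concentrated at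
      \<open>x i\<close>; adding it changes only the coefficient there.\<close>
    let ?\<delta> = "\<lambda>v. if x i = v then c i \<odot>\<^bsub>M\<^esub> v else \<zero>\<^bsub>M\<^esub>"
    let ?d = "\<lambda>v. if x i = v then c i \<oplus> d v else d v"
    have i: "x i \<in> X" "c i \<in> carrier R" using insert.prems c by (auto simp: X_def)
    have xc: "(\<lambda>i. c i \<odot>\<^bsub>M\<^esub> x i) \<in> J \<rightarrow> carrier M" "c i \<odot>\<^bsub>M\<^esub> x i \<in> carrier M"
      using insert.prems c assms(3) by (auto simp: Pi_iff subset_iff)
    have "(\<Oplus>\<^bsub>M\<^esub>i\<in>insert i J. c i \<odot>\<^bsub>M\<^esub> x i) =
        (\<Oplus>\<^bsub>M\<^esub>v\<in>X. ?\<delta> v) \<oplus>\<^bsub>M\<^esub> (\<Oplus>\<^bsub>M\<^esub>v\<in>X. d v \<odot>\<^bsub>M\<^esub> v)"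
      using insert.hyps xc i X M.finsum_singleton[of "x i" X "\<lambda>v. c i \<odot>\<^bsub>M\<^esub> v"] d
      by (subst M.finsum_insert) (auto simp: subset_iff)
    also have "\<dots> = (\<Oplus>\<^bsub>M\<^esub>v\<in>X. ?\<delta> v \<oplus>\<^bsub>M\<^esub> d v \<odot>\<^bsub>M\<^esub> v)"
      using d(1) X i by (intro M.finsum_addf[symmetric]) auto
    also have "\<dots> = (\<Oplus>\<^bsub>M\<^esub>v\<in>X. ?d v \<odot>\<^bsub>M\<^esub> v)"
      using d(1) X i by (intro M.finsum_cong') (auto simp: smult_l_distr Pi_iff subset_iff)
    finally show ?case
      using d(1) i by (intro bexI[of _ ?d]) (auto simp: Pi_iff)
  qed
  have "\<exists>d\<in>X \<rightarrow> carrier R. m = (\<Oplus>\<^bsub>M\<^esub>v\<in>X. d v \<odot>\<^bsub>M\<^esub> v)" if m: "m \<in> carrier M" for m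
    using gen[OF m] comb[OF _ \<open>finite I\<close> order_refl] by force
  then show ?thesis
    unfolding fin_gen_def using X assms(1) by blast
qed

text \<open>The generators are numbered by an initial segment of the naturals because coefficient
  tuples must live on \<open>nat \<Rightarrow> 'r\<close>, from which the test type
  \<open>(nat \<Rightarrow> 'r) set\<close> is built.\<close>

lemma fin_genE:
  assumes "fin_gen R M"
  obtains n :: nat and x where "x \<in> {..<n} \<rightarrow> carrier M"
    "\<And>m. m \<in> carrier M \<Longrightarrow> \<exists>c\<in>{..<n} \<rightarrow> carrier R. m = (\<Oplus>\<^bsub>M\<^esub>i\<in>{..<n}. c i \<odot>\<^bsub>M\<^esub> x i)"
proof -
  obtain X where X: "finite X" "X \<subseteq> carrier M" and "left_module R M"
    and gen: "\<And>m. m \<in> carrier M \<Longrightarrow> \<exists>c\<in>X \<rightarrow> carrier R. m = (\<Oplus>\<^bsub>M\<^esub>x\<in>X. c x \<odot>\<^bsub>M\<^esub> x)"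
    using assms unfolding fin_gen_def by blast
  interpret left_module R M by fact
  obtain x where x: "bij_betw x {..<card X} X"
    using ex_bij_betw_nat_finite[OF X(1)] by (auto simp: atLeast0LessThan)
  have "\<exists>c\<in>{..<card X} \<rightarrow> carrier R. m = (\<Oplus>\<^bsub>M\<^esub>i\<in>{..<card X}. c i \<odot>\<^bsub>M\<^esub> x i)"
    if m: "m \<in> carrier M" for m
  proof -
    obtain c where c: "c \<in> X \<rightarrow> carrier R" "m = (\<Oplus>\<^bsub>M\<^esub>x\<in>X. c x \<odot>\<^bsub>M\<^esub> x)"
      using gen[OF m] by blast
    have "m = (\<Oplus>\<^bsub>M\<^esub>v\<in>x ` {..<card X}. c v \<odot>\<^bsub>M\<^esub> v)"
      using c(2) x by (simp add: bij_betw_def)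
    also have "\<dots> = (\<Oplus>\<^bsub>M\<^esub>i\<in>{..<card X}. c (x i) \<odot>\<^bsub>M\<^esub> x i)"
      using x c(1) X by (intro M.finsum_reindex) (auto simp: bij_betw_def)
    finally show ?thesis
      using c(1) x by (intro bexI[of _ "c \<circ> x"]) (auto simp: bij_betw_def Pi_iff)
  qed
  moreover have "x \<in> {..<card X} \<rightarrow> carrier M"
    using x X by (auto simp: bij_betw_def)
  ultimately show ?thesis by (rule that[rotated])
qed

lemma dual_basis_fin_gen:
  assumes "dual_basis R M I x \<xi>"
  shows "fin_gen R M"
proof (rule fin_genI)
  fix m assume "m \<in> carrier M"
  then show "\<exists>c\<in>I \<rightarrow> carrier R. m = (\<Oplus>\<^bsub>M\<^esub>i\<in>I. c i \<odot>\<^bsub>M\<^esub> x i)"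
    using assms lmod_hom_closed[of "\<xi> _" R M "ext_module id R"]
    by (intro bexI[of _ "\<lambda>i. \<xi> i m"]) (auto simp: dual_basis_def)
qed (use assms in \<open>auto simp: dual_basis_def\<close>)

text \<open>It suffices to lift the finitely many elements \<open>f (x i)\<close> through
  \<open>g\<close>; the functionals \<open>\<xi> i\<close> combine the lifts into a linear map. The
  argument is uniform in the type \<open>'u\<close>.\<close>

lemma dual_basis_projective:
  fixes R :: "('r, 'i) ring_scheme"
  assumes "dual_basis R P I x \<xi>"
  shows "projective TYPE('u) R P"
  unfolding projective_def
proof (intro conjI allI impI)
  show P: "left_module R P" using assms by (simp add: dual_basis_def)
  fix M N :: "('r, 'u) module" and g f
  assume M: "left_module R M" and N: "left_module R N" and g: "g \<in> lmod_hom R M N"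
    and surj: "g ` carrier M = carrier N" and f: "f \<in> lmod_hom R P N"
  interpret P: left_module R P by fact
  interpret M: left_module R M by fact
  interpret N: left_module R N by fact
  have x: "x i \<in> carrier P" and \<xi>: "\<xi> i \<in> lmod_hom R P (ext_module id R)" if "i \<in> I" for i
    using assms that by (auto simp: dual_basis_def)
  have \<xi>c [simp]: "\<xi> i p \<in> carrier R" if "i \<in> I" "p \<in> carrier P" for i p
    using lmod_hom_closed[OF \<xi>] that by simp
  have "\<exists>m\<in>carrier M. g m = f (x i)" if "i \<in> I" for i
    using lmod_hom_closed[OF f x[OF that]] surj by (metis imageE)
  then obtain y where y: "\<And>i. i \<in> I \<Longrightarrow> y i \<in> carrier M" "\<And>i. i \<in> I \<Longrightarrow> g (y i) = f (x i)"
    by metis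
  define h where "h = (\<lambda>p\<in>carrier P. \<Oplus>\<^bsub>M\<^esub>i\<in>I. \<xi> i p \<odot>\<^bsub>M\<^esub> y i)"
  have "h \<in> lmod_hom R P M"
    unfolding h_def using \<xi> y by (intro lmod_hom_lincomb P M)
  moreover have "compose (carrier P) g h = f"
  proof (rule lmod_hom_eqI[OF lmod_hom_compose[OF P \<open>h \<in> _\<close> g] f])
    fix p assume p: "p \<in> carrier P"
    have "g (h p) = (\<Oplus>\<^bsub>N\<^esub>i\<in>I. g (\<xi> i p \<odot>\<^bsub>M\<^esub> y i))"
      unfolding h_def using p y by (simp add: lmod_hom_finsum[OF M N g])
    also have "\<dots> = (\<Oplus>\<^bsub>N\<^esub>i\<in>I. f (\<xi> i p \<odot>\<^bsub>P\<^esub> x i))"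
      using p y x lmod_hom_closed[OF f x]
      by (intro N.finsum_cong') (auto simp: lmod_hom_smult[OF g] lmod_hom_smult[OF f])
    also have "\<dots> = f (\<Oplus>\<^bsub>P\<^esub>i\<in>I. \<xi> i p \<odot>\<^bsub>P\<^esub> x i)"
      using p x by (simp add: lmod_hom_finsum[OF P N f])
    also have "(\<Oplus>\<^bsub>P\<^esub>i\<in>I. \<xi> i p \<odot>\<^bsub>P\<^esub> x i) = p"
      using assms p by (simp add: dual_basis_def)
    finally show "compose (carrier P) g h p = f p"
      using p by (simp add: compose_def)
  qed
  ultimately show "\<exists>h\<in>lmod_hom R P M. compose (carrier P) g h = f" by blast
qed

text \<open>Projectivity is applied to a copy of \<open>R\<^sup>n\<close> mapping onto a copy of the module itself, whose
  elements are the fibres of the presentation.\<close>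

lemma fin_gen_projective_dual_basis:
  fixes R :: "('r, 'i) ring_scheme"
  assumes "fin_gen R M" and proj: "projective TYPE((nat \<Rightarrow> 'r) set) R M"
  obtains n :: nat and x \<xi> where "dual_basis R M {..<n} x \<xi>"
proof -
  interpret left_module R M using assms(1) by (simp add: fin_gen_def)
  obtain n :: nat and x where x: "x \<in> {..<n} \<rightarrow> carrier M"
    and gen: "\<And>m. m \<in> carrier M \<Longrightarrow> \<exists>c\<in>{..<n} \<rightarrow> carrier R. m = (\<Oplus>\<^bsub>M\<^esub>i\<in>{..<n}. c i \<odot>\<^bsub>M\<^esub> x i)"
    by (rule fin_genE[OF assms(1)]) (rule that)
  define F where "F = power_module R n"
  interpret F: left_module R F unfolding F_def by (rule left_module_power_module)
  define p where "p = (\<lambda>c\<in>carrier F. \<Oplus>\<^bsub>M\<^esub>i\<in>{..<n}. c i \<odot>\<^bsub>M\<^esub> x i)"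
  have p: "p \<in> lmod_hom R F M"
  proof -
    have "(\<lambda>c\<in>carrier F. c i) \<in> lmod_hom R F (ext_module id R)" if "i < n" for i
      using that by (intro lmod_hom_restrictI F.left_module_axioms) (auto simp: F_def)
    moreover have "p = (\<lambda>c\<in>carrier F. \<Oplus>\<^bsub>M\<^esub>i\<in>{..<n}. (\<lambda>c\<in>carrier F. c i) c \<odot>\<^bsub>M\<^esub> x i)"
      by (auto simp: p_def)
    ultimately show ?thesis
      using lmod_hom_lincomb[OF F.left_module_axioms left_module_axioms,
          of "{..<n}" "\<lambda>i. \<lambda>c\<in>carrier F. c i" x] x by auto
  qed
  have p_surj: "\<exists>c\<in>carrier F. p c = m" if m: "m \<in> carrier M" for m
  proof -
    obtain c where c: "c \<in> {..<n} \<rightarrow> carrier R" "m = (\<Oplus>\<^bsub>M\<^esub>i\<in>{..<n}. c i \<odot>\<^bsub>M\<^esub> x i)"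
      using gen[OF m] by blast
    have "p (restrict c {..<n}) = m"
      unfolding c(2) p_def using c(1) x
      by (auto simp: F_def intro!: M.finsum_cong')
    then show ?thesis using c(1) by (intro bexI[of _ "restrict c {..<n}"]) (auto simp: F_def)
  qed
  define e where "e m = {c \<in> carrier F. p c = m}" for m
  have e: "inj_on e (carrier M)"
  proof (rule inj_onI)
    fix m m' assume "m \<in> carrier M" and eq: "e m = e m'"
    then obtain c where "c \<in> carrier F" "p c = m" using p_surj by blast
    then have "c \<in> e m'" unfolding eq[symmetric] by (simp add: e_def)
    then show "m = m'" using \<open>p c = m\<close> by (simp add: e_def)
  qed
  define s :: "(nat \<Rightarrow> 'r) \<Rightarrow> (nat \<Rightarrow> 'r) set" where "s c = {c}" for c
  have s: "inj_on s (carrier F)" by (simp add: inj_on_def s_def)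
  interpret e: module_congruence R M e using e by (rule module_congruence_inj)
  interpret s: module_congruence R F s using s by (rule F.module_congruence_inj)
  \<comment> \<open>The presentation \<open>p\<close>, transported to the two copies on the test
    type.\<close>
  define q where "q = compose (carrier (image_module s F)) (compose (carrier F) (restrict e (carrier M)) p)
    (restrict (inv_into (carrier F) s) (s ` carrier F))"
  have q: "q \<in> lmod_hom R (image_module s F) (image_module e M)"
    unfolding q_def
    by (rule lmod_hom_compose[OF s.left_module_image_module F.image_module_inv_hom[OF s]
        lmod_hom_compose[OF F.left_module_axioms p e.image_module_hom]])
  have q_eq: "q (s c) = e (p c)" if "c \<in> carrier F" for c
    using that s lmod_hom_closed[OF p that] by (simp add: q_def compose_def)
  have "q ` carrier (image_module s F) = carrier (image_module e M)"
    using p_surj lmod_hom_closed[OF p] by (fastforce simp: q_eq image_iff)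
  \<comment> \<open>Lifting the isomorphism from \<open>M\<close> to its copy through
    \<open>q\<close> gives a section of the presentation into the copy of \<open>F\<close>;
    \<open>k\<close> is this section with values in \<open>F\<close> itself.\<close>
  then obtain h where h: "h \<in> lmod_hom R M (image_module s F)"
      "compose (carrier M) q h = restrict e (carrier M)"
    using proj q s.left_module_image_module e.left_module_image_module e.image_module_hom
    unfolding projective_def by blast
  define k where "k = compose (carrier M) (restrict (inv_into (carrier F) s) (s ` carrier F)) h"
  have k: "k \<in> lmod_hom R M F"
    unfolding k_def by (rule lmod_hom_compose[OF left_module_axioms h(1) F.image_module_inv_hom[OF s]])
  have pk: "p (k m) = m" if m: "m \<in> carrier M" for m
  proof -
    obtain c where c: "c \<in> carrier F" "h m = s c"
      using lmod_hom_closed[OF h(1) m] by auto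
    have "e (p c) = e m"
      using fun_cong[OF h(2), of m] m c by (simp add: compose_def q_eq)
    then show ?thesis
      using e lmod_hom_closed[OF p c(1)] m c s by (auto simp: k_def compose_def inj_on_def)
  qed
  have kc: "k m i \<in> carrier R" if "m \<in> carrier M" "i < n" for m i
    using lmod_hom_closed[OF k that(1)] that(2) by (auto simp: F_def)
  \<comment> \<open>The coordinates of the section are the dual functionals, since
    \<open>p (k m) = m\<close> is already the expansion of \<open>m\<close>.\<close>
  define \<xi> where "\<xi> i = (\<lambda>m\<in>carrier M. k m i)" for i
  have "\<xi> i \<in> lmod_hom R M (ext_module id R)" if "i < n" for i
    unfolding \<xi>_def using kc that
    by (intro lmod_hom_restrictI left_module_axioms)
      (auto simp: lmod_hom_add[OF k] lmod_hom_smult[OF k] F_def)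
  moreover have "m = (\<Oplus>\<^bsub>M\<^esub>i\<in>{..<n}. \<xi> i m \<odot>\<^bsub>M\<^esub> x i)" if m: "m \<in> carrier M" for m
  proof -
    have "m = p (k m)" using pk[OF m] by simp
    also have "\<dots> = (\<Oplus>\<^bsub>M\<^esub>i\<in>{..<n}. \<xi> i m \<odot>\<^bsub>M\<^esub> x i)"
      using m lmod_hom_closed[OF k m] by (simp add: p_def \<xi>_def)
    finally show ?thesis .
  qed
  ultimately have "dual_basis R M {..<n} x \<xi>"
    using x left_module_axioms by (auto simp: dual_basis_def)
  then show ?thesis by (rule that)
qed

text \<open>Every \<open>m\<close> in a test module is the sum over \<open>j\<close> of the values
  at \<open>u j\<close> of the homomorphisms \<open>\<lambda>v. g j v \<odot> m\<close> defined on
  \<open>G\<close>. Two maps that agree after composition with all of these agree at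
  \<open>m\<close>.\<close>

lemma generatorI:
  fixes R :: "('r, 'i) ring_scheme"
  assumes "left_module R G" "\<And>j. j \<in> J \<Longrightarrow> g j \<in> lmod_hom R G (ext_module id R)"
    and "\<And>j. j \<in> J \<Longrightarrow> u j \<in> carrier G" "(\<Oplus>\<^bsub>R\<^esub>j\<in>J. g j (u j)) = \<one>\<^bsub>R\<^esub>"
  shows "generator TYPE('u) R G"
  unfolding generator_def
proof (intro conjI allI impI assms(1))
  fix M N :: "('r, 'u) module" and f f'
  assume M: "left_module R M" and N: "left_module R N"
    and f: "f \<in> lmod_hom R M N" and f': "f' \<in> lmod_hom R M N" and "f \<noteq> f'"
  interpret G: left_module R G by fact
  interpret M: left_module R M by fact
  interpret N: left_module R N by fact
  show "\<exists>h\<in>lmod_hom R G M. compose (carrier G) f h \<noteq> compose (carrier G) f' h"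
  proof (rule ccontr)
    assume neg: "\<not> ?thesis"
    have "f m = f' m" if m: "m \<in> carrier M" for m
    proof -
      have gc: "g j v \<in> carrier R" if "j \<in> J" "v \<in> carrier G" for j v
        using lmod_hom_closed[OF assms(2)[OF that(1)] that(2)] by simp
      have *: "f (g j (u j) \<odot>\<^bsub>M\<^esub> m) = f' (g j (u j) \<odot>\<^bsub>M\<^esub> m)" if j: "j \<in> J" for j
      proof -
        have "(\<lambda>v\<in>carrier G. g j v \<odot>\<^bsub>M\<^esub> m) \<in> lmod_hom R G M"
          by (rule lmod_hom_smult_const[OF assms(1) M assms(2)[OF j] m])
        then have "compose (carrier G) f (\<lambda>v\<in>carrier G. g j v \<odot>\<^bsub>M\<^esub> m) =
            compose (carrier G) f' (\<lambda>v\<in>carrier G. g j v \<odot>\<^bsub>M\<^esub> m)"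
          using neg by blast
        from fun_cong[OF this, of "u j"] show ?thesis
          using assms(3)[OF j] by (simp add: compose_def)
      qed
      have c: "g j (u j) \<odot>\<^bsub>M\<^esub> m \<in> carrier M" if "j \<in> J" for j
        using gc[OF that assms(3)[OF that]] m by simp
      have "m = (\<Oplus>\<^bsub>M\<^esub>j\<in>J. g j (u j) \<odot>\<^bsub>M\<^esub> m)"
        using M.finsum_smult_l[OF m, of J "\<lambda>j. g j (u j)"] gc assms(3,4) m by simp
      moreover have "f (\<Oplus>\<^bsub>M\<^esub>j\<in>J. g j (u j) \<odot>\<^bsub>M\<^esub> m) = f' (\<Oplus>\<^bsub>M\<^esub>j\<in>J. g j (u j) \<odot>\<^bsub>M\<^esub> m)"
        using c lmod_hom_closed[OF f' c]
        by (simp add: lmod_hom_finsum[OF M N f] lmod_hom_finsum[OF M N f'] * cong: N.finsum_cong)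
      ultimately show ?thesis by simp
    qed
    then show False using \<open>f \<noteq> f'\<close> lmod_hom_eqI[OF f f'] by blast
  qed
qed

text \<open>Finite sums of values of functionals are built one summand at a time, so the closure
  properties follow by rule induction; an index set appears only in
  \<open>trace_ideal_finsum\<close>.\<close>

inductive_set trace_ideal :: "('r, 'i) ring_scheme \<Rightarrow> ('r, 'm, 'j) module_scheme \<Rightarrow> 'r set"
  for R M where
  zero: "\<zero>\<^bsub>R\<^esub> \<in> trace_ideal R M"
| step: "\<lbrakk>g \<in> lmod_hom R M (ext_module id R); u \<in> carrier M; r \<in> trace_ideal R M\<rbrakk> \<Longrightarrow>
    g u \<oplus>\<^bsub>R\<^esub> r \<in> trace_ideal R M"

context left_module
begin

lemma trace_ideal_closed: "r \<in> trace_ideal R M \<Longrightarrow> r \<in> carrier R"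
  by (induction rule: trace_ideal.induct) (auto dest: lmod_hom_closed)

lemma trace_ideal_add:
  assumes "r \<in> trace_ideal R M" "s \<in> trace_ideal R M"
  shows "r \<oplus> s \<in> trace_ideal R M"
  using assms
proof (induction rule: trace_ideal.induct)
  case (step g u r)
  then have "g u \<oplus> r \<oplus> s = g u \<oplus> (r \<oplus> s)"
    using lmod_hom_closed[OF step(1,2)] by (simp add: trace_ideal_closed R.a_assoc)
  then show ?case using step by (metis trace_ideal.step)
qed (simp add: trace_ideal_closed)

text \<open>The functional absorbs the factor, \<open>a \<otimes> g u = g (a \<odot> u)\<close>. So
  the trace ideal is a left ideal, as a quotient left module requires.\<close>

lemma trace_ideal_smult:
  assumes "r \<in> trace_ideal R M" "a \<in> carrier R"
  shows "a \<otimes> r \<in> trace_ideal R M"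
  using assms
proof (induction rule: trace_ideal.induct)
  case (step g u r)
  then have "a \<otimes> (g u \<oplus> r) = g (a \<odot>\<^bsub>M\<^esub> u) \<oplus> a \<otimes> r"
    using lmod_hom_closed[OF step(1,2)]
    by (simp add: trace_ideal_closed R.r_distr lmod_hom_smult[OF step(1)])
  then show ?case using step by (metis trace_ideal.step smult_closed)
qed (simp add: trace_ideal.zero)

lemma trace_ideal_minus:
  assumes "r \<in> trace_ideal R M"
  shows "\<ominus> r \<in> trace_ideal R M"
  using trace_ideal_smult[OF assms, of "\<ominus> \<one>"] trace_ideal_closed[OF assms]
  by (simp add: R.l_minus)

lemma hom_in_trace_ideal:
  assumes "g \<in> lmod_hom R M (ext_module id R)" "u \<in> carrier M"
  shows "g u \<in> trace_ideal R M"
  using trace_ideal.step[OF assms trace_ideal.zero] lmod_hom_closed[OF assms] by simp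

lemma trace_ideal_finsum:
  assumes "r \<in> trace_ideal R M"
  shows "\<exists>(n :: nat) g u. g \<in> {..<n} \<rightarrow> lmod_hom R M (ext_module id R) \<and> u \<in> {..<n} \<rightarrow> carrier M \<and>
    r = (\<Oplus>j\<in>{..<n}. g j (u j))"
  using assms
proof (induction rule: trace_ideal.induct)
  case zero
  show ?case by (intro exI[of _ 0]) auto
next
  case (step g u r)
  then obtain n :: nat and g' u' where *: "g' \<in> {..<n} \<rightarrow> lmod_hom R M (ext_module id R)"
    "u' \<in> {..<n} \<rightarrow> carrier M" "r = (\<Oplus>j\<in>{..<n}. g' j (u' j))" by blast
  \<comment> \<open>The new summand takes the index \<open>n\<close>, the first one that
    \<open>{..<n}\<close> leaves free.\<close>
  let ?g = "g'(n := g)" and ?u = "u'(n := u)"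
  have c: "g' j (u' j) \<in> carrier R" if "j < n" for j
    using lmod_hom_closed[of "g' j" R M "ext_module id R" "u' j"] * that by auto
  have "(\<Oplus>j\<in>insert n {..<n}. ?g j (?u j)) = g u \<oplus> (\<Oplus>j\<in>{..<n}. ?g j (?u j))"
    using lmod_hom_closed[OF step(1,2)] c by (subst R.finsum_insert) auto
  also have "(\<Oplus>j\<in>{..<n}. ?g j (?u j)) = r"
    unfolding *(3) using c by (intro R.finsum_cong') auto
  finally have "g u \<oplus> r = (\<Oplus>j\<in>{..<Suc n}. ?g j (?u j))"
    by (simp add: lessThan_Suc)
  moreover have "?g \<in> {..<Suc n} \<rightarrow> lmod_hom R M (ext_module id R)" "?u \<in> {..<Suc n} \<rightarrow> carrier M"
    using step * by (auto simp: less_Suc_eq)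
  ultimately show ?case by blast
qed

end

text \<open>If the trace ideal \<open>I\<close> were proper, then every map from \<open>G\<close> would fail to distinguish the
  projection \<open>R \<rightarrow> R / I\<close> from zero.\<close>

lemma generatorE:
  fixes R :: "('r, 'i) ring_scheme" (structure)
  assumes gen: "generator TYPE((nat \<Rightarrow> 'r) set) R G"
  obtains n :: nat and g u where "g \<in> {..<n} \<rightarrow> lmod_hom R G (ext_module id R)"
    "u \<in> {..<n} \<rightarrow> carrier G" "(\<Oplus>\<^bsub>R\<^esub>j\<in>{..<n}. g j (u j)) = \<one>\<^bsub>R\<^esub>"
proof -
  interpret left_module R G using assms by (simp add: generator_def)
  have "\<one> \<in> trace_ideal R G"
  proof (rule ccontr)
    assume one: "\<one> \<notin> trace_ideal R G"
    let ?R = "ext_module id R"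
    interpret L: left_module R ?R by (rule left_module_regular) (rule R.ring_axioms)
    \<comment> \<open>Coding ring elements by constant functions puts the module \<open>R\<close>
      and its quotient on the test type: \<open>s r\<close> is a singleton, and \<open>e r\<close>
      is the coset of \<open>r\<close> modulo the trace ideal.\<close>
    define s :: "'r \<Rightarrow> (nat \<Rightarrow> 'r) set" where "s r = {\<lambda>_. r}" for r
    have s: "inj_on s (carrier ?R)" by (auto simp: inj_on_def s_def fun_eq_iff)
    define e :: "'r \<Rightarrow> (nat \<Rightarrow> 'r) set"
      where "e r = {(\<lambda>_. t) | t. t \<in> carrier R \<and> t \<ominus> r \<in> trace_ideal R G}" for r
    have e_iff: "e r = e r' \<longleftrightarrow> r \<ominus> r' \<in> trace_ideal R G" if r: "r \<in> carrier R" "r' \<in> carrier R" for r r'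
    proof
      assume "e r = e r'"
      moreover have "(\<lambda>_. r) \<in> e r"
        using r by (auto simp: e_def R.minus_eq R.r_neg trace_ideal.zero)
      ultimately show "r \<ominus> r' \<in> trace_ideal R G"
        by (auto simp: e_def fun_eq_iff)
    next
      assume d: "r \<ominus> r' \<in> trace_ideal R G"
      have "\<ominus> (r \<ominus> r') = r' \<ominus> r"
        using r by (simp add: R.minus_eq R.minus_add R.a_comm)
      then have d': "r' \<ominus> r \<in> trace_ideal R G" using trace_ideal_minus[OF d] by simp
      have tel: "t \<ominus> a = (t \<ominus> b) \<oplus> (b \<ominus> a)" if "t \<in> carrier R" "a \<in> carrier R" "b \<in> carrier R" for t a b
        using that by (simp add: R.minus_eq R.a_assoc R.r_neg1)
      have "t \<ominus> r \<in> trace_ideal R G \<longleftrightarrow> t \<ominus> r' \<in> trace_ideal R G" if "t \<in> carrier R" for t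
        using trace_ideal_add[OF _ d'] trace_ideal_add[OF _ d] tel[OF that] r by metis
      then show "e r = e r'" by (auto simp: e_def)
    qed
    interpret e: module_congruence R ?R e
    proof
      fix x x' y y' assume c: "x \<in> carrier ?R" "x' \<in> carrier ?R" "y \<in> carrier ?R" "y' \<in> carrier ?R"
        "e x = e x'" "e y = e y'"
      have "(x \<oplus> y) \<ominus> (x' \<oplus> y') = (x \<ominus> x') \<oplus> (y \<ominus> y')"
        using c by (simp add: R.minus_eq R.a_ac R.minus_add)
      then show "e (x \<oplus>\<^bsub>?R\<^esub> y) = e (x' \<oplus>\<^bsub>?R\<^esub> y')"
        using c by (simp add: e_iff trace_ideal_add)
    next
      fix r x x' assume c: "r \<in> carrier R" "x \<in> carrier ?R" "x' \<in> carrier ?R" "e x = e x'"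
      have "r \<otimes> x \<ominus> r \<otimes> x' = r \<otimes> (x \<ominus> x')"
        using c by (simp add: R.minus_eq R.r_distr R.r_minus)
      then show "e (r \<odot>\<^bsub>?R\<^esub> x) = e (r \<odot>\<^bsub>?R\<^esub> x')"
        using c by (simp add: e_iff trace_ideal_smult)
    qed
    interpret s: module_congruence R ?R s using s by (rule L.module_congruence_inj)
    let ?M = "image_module s ?R" and ?N = "image_module e ?R"
    let ?inv = "restrict (inv_into (carrier ?R) s) (s ` carrier ?R)"
    have inv: "?inv \<in> lmod_hom R ?M ?R" by (rule L.image_module_inv_hom[OF s])
    interpret N: left_module R ?N by (rule e.left_module_image_module)
    define f where "f = compose (carrier ?M) (restrict e (carrier ?R)) ?inv"
    have f: "f \<in> lmod_hom R ?M ?N"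
      unfolding f_def by (rule lmod_hom_compose[OF s.left_module_image_module inv e.image_module_hom])
    have f_eq: "f (s r) = e r" if "r \<in> carrier R" for r
      using that s by (simp add: f_def compose_def)
    define z where "z = (\<lambda>m\<in>carrier ?M. \<zero>\<^bsub>?N\<^esub>)"
    have z: "z \<in> lmod_hom R ?M ?N"
      unfolding z_def by (intro lmod_hom_restrictI s.left_module_image_module) auto
    \<comment> \<open>The projection is nonzero at the unit because the trace ideal is supposed to
      be proper.\<close>
    have "f (s \<one>) \<noteq> z (s \<one>)"
      using one e_iff[of \<one> \<zero>] by (simp add: f_eq z_def R.minus_eq)
    then have "f \<noteq> z" by auto
    then obtain h where h: "h \<in> lmod_hom R G ?M" "compose (carrier G) f h \<noteq> compose (carrier G) z h"
      using gen f z s.left_module_image_module e.left_module_image_module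
      unfolding generator_def by blast
    have "f (h x) = z (h x)" if x: "x \<in> carrier G" for x
    proof -
      obtain r where r: "r \<in> carrier R" "h x = s r"
        using lmod_hom_closed[OF h(1) x] by auto
      \<comment> \<open>Composed with the inverse of \<open>s\<close>, the map \<open>h\<close>
        becomes a functional on \<open>G\<close>; its values lie in the trace ideal and vanish in
        the quotient.\<close>
      have "compose (carrier G) ?inv h x \<in> trace_ideal R G"
        by (rule hom_in_trace_ideal[OF lmod_hom_compose[OF left_module_axioms h(1) inv] x])
      then have "r \<in> trace_ideal R G"
        using x r s by (simp add: compose_def)
      then have "e r = e \<zero>"
        using r by (simp add: e_iff R.minus_eq)
      then show ?thesis using r by (simp add: f_eq z_def)
    qed
    then show False using h(2) by (auto simp: compose_def intro: restrict_ext)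
  qed
  from trace_ideal_finsum[OF this] show ?thesis by (elim exE conjE) (rule that, auto)
qed

section \<open>Endomorphism rings\<close>

lemma (in abelian_monoid) finsum_product3:
  assumes "finite K" "finite I" "finite J"
    and "\<And>k i j. k \<in> K \<Longrightarrow> i \<in> I \<Longrightarrow> j \<in> J \<Longrightarrow> h k i j \<in> carrier G"
  shows "(\<Oplus>q\<in>K \<times> I \<times> J. h (fst q) (fst (snd q)) (snd (snd q))) = (\<Oplus>k\<in>K. \<Oplus>i\<in>I. \<Oplus>j\<in>J. h k i j)"
proof -
  have "(\<Oplus>q\<in>K \<times> I \<times> J. h (fst q) (fst (snd q)) (snd (snd q))) =
      (\<Oplus>k\<in>K. \<Oplus>r\<in>I \<times> J. h k (fst r) (snd r))"
    using assms by (intro finsum_product) auto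
  also have "\<dots> = (\<Oplus>k\<in>K. \<Oplus>i\<in>I. \<Oplus>j\<in>J. h k i j)"
    using assms by (intro finsum_cong' refl finsum_product) (auto intro!: finsum_closed)
  finally show ?thesis .
qed

lemma lmod_End_simps [simp]:
  "carrier (lmod_End R M) = lmod_hom R M M"
  "s \<otimes>\<^bsub>lmod_End R M\<^esub> s' = compose (carrier M) s' s"
  "\<one>\<^bsub>lmod_End R M\<^esub> = (\<lambda>x\<in>carrier M. x)"
  "\<zero>\<^bsub>lmod_End R M\<^esub> = (\<lambda>x\<in>carrier M. \<zero>\<^bsub>M\<^esub>)"
  "s \<oplus>\<^bsub>lmod_End R M\<^esub> s' = (\<lambda>x\<in>carrier M. s x \<oplus>\<^bsub>M\<^esub> s' x)"
  by (simp_all add: lmod_End_def)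

context left_module
begin

lemma lmod_End_closed:
  "(\<lambda>x\<in>carrier M. x) \<in> lmod_hom R M M"
  "(\<lambda>x\<in>carrier M. \<zero>\<^bsub>M\<^esub>) \<in> lmod_hom R M M"
  "\<lbrakk>s \<in> lmod_hom R M M; s' \<in> lmod_hom R M M\<rbrakk> \<Longrightarrow> (\<lambda>x\<in>carrier M. s x \<oplus>\<^bsub>M\<^esub> s' x) \<in> lmod_hom R M M"
  "s \<in> lmod_hom R M M \<Longrightarrow> (\<lambda>x\<in>carrier M. \<ominus>\<^bsub>M\<^esub> s x) \<in> lmod_hom R M M"
proof -
  show "(\<lambda>x\<in>carrier M. x) \<in> lmod_hom R M M" "(\<lambda>x\<in>carrier M. \<zero>\<^bsub>M\<^esub>) \<in> lmod_hom R M M"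
    by (intro lmod_hom_restrictI left_module_axioms; simp)+
next
  assume s: "s \<in> lmod_hom R M M"
  note s = lmod_hom_closed[OF s] lmod_hom_add[OF s] lmod_hom_smult[OF s]
  have neg: "r \<odot>\<^bsub>M\<^esub> (\<ominus>\<^bsub>M\<^esub> x) = \<ominus>\<^bsub>M\<^esub> (r \<odot>\<^bsub>M\<^esub> x)" if "r \<in> carrier R" "x \<in> carrier M" for r x
    using smult_r_distr[of r "\<ominus>\<^bsub>M\<^esub> x" x] that
    by (intro M.minus_equality[symmetric]) (simp_all add: M.l_neg)
  show "(\<lambda>x\<in>carrier M. \<ominus>\<^bsub>M\<^esub> s x) \<in> lmod_hom R M M"
    using s by (intro lmod_hom_restrictI left_module_axioms) (simp_all add: M.minus_add neg)
  assume s': "s' \<in> lmod_hom R M M"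
  note s' = lmod_hom_closed[OF s'] lmod_hom_add[OF s'] lmod_hom_smult[OF s']
  show "(\<lambda>x\<in>carrier M. s x \<oplus>\<^bsub>M\<^esub> s' x) \<in> lmod_hom R M M"
    using s s' by (intro lmod_hom_restrictI left_module_axioms) (simp_all add: smult_r_distr M.a_ac)
qed

lemma ring_lmod_End: "ring (lmod_End R M)"
proof -
  let ?S = "lmod_End R M"
  note comp = lmod_hom_compose[OF left_module_axioms]
  note eqI = lmod_hom_eqI[of _ R M M _ M]
  have "abelian_group ?S"
  proof (rule abelian_groupI)
    fix s assume s: "s \<in> carrier ?S"
    show "\<exists>s'\<in>carrier ?S. s' \<oplus>\<^bsub>?S\<^esub> s = \<zero>\<^bsub>?S\<^esub>"
    proof
      show "(\<lambda>x\<in>carrier M. \<ominus>\<^bsub>M\<^esub> s x) \<in> carrier ?S"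
        using s lmod_End_closed(4) by simp
      show "(\<lambda>x\<in>carrier M. \<ominus>\<^bsub>M\<^esub> s x) \<oplus>\<^bsub>?S\<^esub> s = \<zero>\<^bsub>?S\<^esub>"
        using s lmod_hom_closed[of s R M M] by (simp add: M.l_neg cong: restrict_cong)
    qed
    show "\<zero>\<^bsub>?S\<^esub> \<oplus>\<^bsub>?S\<^esub> s = s"
      using s lmod_hom_closed[of s R M M] lmod_End_closed(3)[OF lmod_End_closed(2), of s]
      by (intro eqI) simp_all
  next
    fix s s' assume s: "s \<in> carrier ?S" "s' \<in> carrier ?S"
    then show "s \<oplus>\<^bsub>?S\<^esub> s' = s' \<oplus>\<^bsub>?S\<^esub> s"
      using lmod_hom_closed[of s R M M] lmod_hom_closed[of s' R M M]
      by (simp add: M.a_comm cong: restrict_cong)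
    fix s'' assume "s'' \<in> carrier ?S"
    with s show "s \<oplus>\<^bsub>?S\<^esub> s' \<oplus>\<^bsub>?S\<^esub> s'' = s \<oplus>\<^bsub>?S\<^esub> (s' \<oplus>\<^bsub>?S\<^esub> s'')"
      using lmod_hom_closed[of s R M M] lmod_hom_closed[of s' R M M] lmod_hom_closed[of s'' R M M]
      by (simp add: M.a_assoc cong: restrict_cong)
  qed (simp_all add: lmod_End_closed)
  moreover have "monoid ?S"
  proof (rule monoidI)
    fix s assume s: "s \<in> carrier ?S"
    then show "\<one>\<^bsub>?S\<^esub> \<otimes>\<^bsub>?S\<^esub> s = s" "s \<otimes>\<^bsub>?S\<^esub> \<one>\<^bsub>?S\<^esub> = s"
      using lmod_hom_closed[of s R M M] lmod_End_closed(1) comp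
      by (auto intro!: eqI simp: compose_eq)
    fix s' s'' assume s': "s' \<in> carrier ?S" "s'' \<in> carrier ?S"
    then show "s \<otimes>\<^bsub>?S\<^esub> s' \<otimes>\<^bsub>?S\<^esub> s'' = s \<otimes>\<^bsub>?S\<^esub> (s' \<otimes>\<^bsub>?S\<^esub> s'')"
      using s lmod_hom_closed[of s R M M]
      by (simp add: compose_def cong: restrict_cong)
  qed (simp_all add: lmod_End_closed comp)
  ultimately show ?thesis
  proof (rule ringI)
    fix s s' s'' assume s: "s \<in> carrier ?S" "s' \<in> carrier ?S" "s'' \<in> carrier ?S"
    \<comment> \<open>In the right-action convention the first law needs the additivity of
      \<open>s''\<close>, while the second holds pointwise.\<close>
    then show "(s \<oplus>\<^bsub>?S\<^esub> s') \<otimes>\<^bsub>?S\<^esub> s'' = s \<otimes>\<^bsub>?S\<^esub> s'' \<oplus>\<^bsub>?S\<^esub> s' \<otimes>\<^bsub>?S\<^esub> s''"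
      "s'' \<otimes>\<^bsub>?S\<^esub> (s \<oplus>\<^bsub>?S\<^esub> s') = s'' \<otimes>\<^bsub>?S\<^esub> s \<oplus>\<^bsub>?S\<^esub> s'' \<otimes>\<^bsub>?S\<^esub> s'"
      using lmod_hom_closed[of s R M M] lmod_hom_closed[of s' R M M] lmod_hom_closed[of s'' R M M]
      by (simp_all add: compose_def lmod_hom_add[of s'' R M M] cong: restrict_cong)
  qed
qed

text \<open>Evaluation at \<open>m\<close> is an additive map from the endomorphism ring to
  \<open>M\<close>.\<close>

lemma lmod_End_finsum:
  assumes "\<And>i. i \<in> I \<Longrightarrow> f i \<in> lmod_hom R M M" "m \<in> carrier M"
  shows "(\<Oplus>\<^bsub>lmod_End R M\<^esub>i\<in>I. f i) m = (\<Oplus>\<^bsub>M\<^esub>i\<in>I. f i m)"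
proof -
  interpret S: ring "lmod_End R M" by (rule ring_lmod_End)
  show ?thesis
    using assms lmod_hom_closed[of _ R M M]
    by (intro additive_finsum[where f="\<lambda>s. s m"] S.abelian_group_axioms M.abelian_group_axioms) auto
qed

end

section \<open>Frobenius systems\<close>

text \<open>\<open>left_dual\<close> says that the \<open>x i\<close> and the functionals
  \<open>\<lambda>a. E (a \<otimes> y i)\<close> form a dual basis; \<open>right_dual\<close>
  recovers an element from the functional that it represents under \<open>E\<close>. Being equations
  in \<open>R\<close> and \<open>A\<close>, the axioms serve both for unpacking the hypothesis and
  for building the conclusion.\<close>

locale frobenius_system = R: ring R + A: ring A
  for R :: "('r, 'i) ring_scheme" and A :: "('a, 'j) ring_scheme" +
  fixes \<iota> :: "'r \<Rightarrow> 'a" and E :: "'a \<Rightarrow> 'r" and I :: "'x set" and x y :: "'x \<Rightarrow> 'a"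
  assumes ext_hom: "\<iota> \<in> ring_hom R A"
    and E_hom: "E \<in> lmod_hom R (ext_module \<iota> A) (ext_module id R)"
    and E_right: "\<lbrakk>a \<in> carrier A; r \<in> carrier R\<rbrakk> \<Longrightarrow> E (a \<otimes>\<^bsub>A\<^esub> \<iota> r) = E a \<otimes>\<^bsub>R\<^esub> r"
    and finite_I: "finite I"
    and x_closed: "i \<in> I \<Longrightarrow> x i \<in> carrier A"
    and y_closed: "i \<in> I \<Longrightarrow> y i \<in> carrier A"
    and left_dual: "a \<in> carrier A \<Longrightarrow> (\<Oplus>\<^bsub>A\<^esub>i\<in>I. \<iota> (E (a \<otimes>\<^bsub>A\<^esub> y i)) \<otimes>\<^bsub>A\<^esub> x i) = a"
    and right_dual: "a \<in> carrier A \<Longrightarrow> (\<Oplus>\<^bsub>A\<^esub>i\<in>I. y i \<otimes>\<^bsub>A\<^esub> \<iota> (E (x i \<otimes>\<^bsub>A\<^esub> a))) = a"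
begin

lemma ext_closed [simp]: "r \<in> carrier R \<Longrightarrow> \<iota> r \<in> carrier A"
  and ext_add: "\<lbrakk>r \<in> carrier R; s \<in> carrier R\<rbrakk> \<Longrightarrow> \<iota> (r \<oplus>\<^bsub>R\<^esub> s) = \<iota> r \<oplus>\<^bsub>A\<^esub> \<iota> s"
  and ext_one [simp]: "\<iota> \<one>\<^bsub>R\<^esub> = \<one>\<^bsub>A\<^esub>"
  using ext_hom by (auto simp: ring_hom_def)

lemma ext_finsum:
  assumes "\<And>i. i \<in> I' \<Longrightarrow> f i \<in> carrier R"
  shows "\<iota> (\<Oplus>\<^bsub>R\<^esub>i\<in>I'. f i) = (\<Oplus>\<^bsub>A\<^esub>i\<in>I'. \<iota> (f i))"
  using assms by (intro additive_finsum R.abelian_group_axioms A.abelian_group_axioms) (auto simp: ext_add)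

lemma E_closed [simp]: "a \<in> carrier A \<Longrightarrow> E a \<in> carrier R"
  and E_add: "\<lbrakk>a \<in> carrier A; b \<in> carrier A\<rbrakk> \<Longrightarrow> E (a \<oplus>\<^bsub>A\<^esub> b) = E a \<oplus>\<^bsub>R\<^esub> E b"
  and E_left: "\<lbrakk>a \<in> carrier A; r \<in> carrier R\<rbrakk> \<Longrightarrow> E (\<iota> r \<otimes>\<^bsub>A\<^esub> a) = r \<otimes>\<^bsub>R\<^esub> E a"
  using lmod_hom_closed[OF E_hom] lmod_hom_add[OF E_hom] lmod_hom_smult[OF E_hom] by auto

lemma E_finsum:
  assumes "\<And>i. i \<in> I' \<Longrightarrow> f i \<in> carrier A"
  shows "E (\<Oplus>\<^bsub>A\<^esub>i\<in>I'. f i) = (\<Oplus>\<^bsub>R\<^esub>i\<in>I'. E (f i))"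
  using assms by (intro additive_finsum R.abelian_group_axioms A.abelian_group_axioms) (auto simp: E_add)

lemma A_left_module: "left_module R (ext_module \<iota> A)"
  by (intro left_module_ext_module R.ring_axioms A.ring_axioms ext_hom)

lemma E_mult_hom:
  assumes "b \<in> carrier A"
  shows "(\<lambda>a\<in>carrier A. E (a \<otimes>\<^bsub>A\<^esub> b)) \<in> lmod_hom R (ext_module \<iota> A) (ext_module id R)"
  using lmod_hom_restrictI[OF A_left_module, of "\<lambda>a. E (a \<otimes>\<^bsub>A\<^esub> b)" "ext_module id R"] assms
  by (simp add: A.l_distr A.m_assoc E_add E_left)

lemma A_dual_basis: "dual_basis R (ext_module \<iota> A) I x (\<lambda>i. \<lambda>a\<in>carrier A. E (a \<otimes>\<^bsub>A\<^esub> y i))"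
  using A_left_module finite_I x_closed y_closed left_dual
  by (auto simp: dual_basis_def intro!: E_mult_hom)

text \<open>The inverse sends a functional \<open>f\<close> to the sum of the
  \<open>y i \<otimes> \<iota> (f (x i))\<close>. One composite is the identity by
  \<open>right_dual\<close>, the other by \<open>left_dual\<close> and the linearity of
  \<open>f\<close>.\<close>

lemma frobenius_bimodule_iso:
  "(\<lambda>a. \<lambda>b\<in>carrier A. E (b \<otimes>\<^bsub>A\<^esub> a)) \<in> bimodule_iso A R (ext_bimodule \<iota> A) (ext_dual \<iota> R A)"
proof -
  let ?\<phi> = "\<lambda>a. \<lambda>b\<in>carrier A. E (b \<otimes>\<^bsub>A\<^esub> a)"
  let ?D = "lmod_hom R (ext_module \<iota> A) (ext_module id R)"
  let ?\<psi> = "\<lambda>f. \<Oplus>\<^bsub>A\<^esub>i\<in>I. y i \<otimes>\<^bsub>A\<^esub> \<iota> (f (x i))"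
  have D: "f a \<in> carrier R" if "f \<in> ?D" "a \<in> carrier A" for f a
    using lmod_hom_closed[OF that(1), of a] that(2) by simp
  have \<psi>: "?\<psi> f \<in> carrier A" if "f \<in> ?D" for f
    using D[OF that] x_closed y_closed by (intro A.finsum_closed) auto
  have "?\<phi> (?\<psi> f) = f" if f: "f \<in> ?D" for f
  proof (rule lmod_hom_eqI[OF E_mult_hom[OF \<psi>[OF f]] f])
    fix b assume "b \<in> carrier (ext_module \<iota> A)"
    then have b: "b \<in> carrier A" by simp
    note c = D[OF f x_closed] x_closed y_closed b
    have "E (b \<otimes>\<^bsub>A\<^esub> ?\<psi> f) = E (\<Oplus>\<^bsub>A\<^esub>i\<in>I. b \<otimes>\<^bsub>A\<^esub> (y i \<otimes>\<^bsub>A\<^esub> \<iota> (f (x i))))"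
      using finite_I c by (subst A.finsum_rdistr) auto
    also have "\<dots> = (\<Oplus>\<^bsub>R\<^esub>i\<in>I. E (b \<otimes>\<^bsub>A\<^esub> (y i \<otimes>\<^bsub>A\<^esub> \<iota> (f (x i)))))"
      using c by (intro E_finsum) auto
    \<comment> \<open>Right linearity of \<open>E\<close> extracts \<open>f (x i)\<close>, and left
      linearity of \<open>f\<close> absorbs the coefficient
      \<open>E (b \<otimes> y i)\<close>.\<close>
    also have "\<dots> = (\<Oplus>\<^bsub>R\<^esub>i\<in>I. f (\<iota> (E (b \<otimes>\<^bsub>A\<^esub> y i)) \<otimes>\<^bsub>A\<^esub> x i))"
      using c D[OF f] lmod_hom_smult[OF f]
      by (intro R.finsum_cong') (auto simp: A.m_assoc[symmetric] E_right)
    also have "\<dots> = f (\<Oplus>\<^bsub>A\<^esub>i\<in>I. \<iota> (E (b \<otimes>\<^bsub>A\<^esub> y i)) \<otimes>\<^bsub>A\<^esub> x i)"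
      using c lmod_hom_finsum[OF A_left_module left_module_regular[OF R.ring_axioms] f,
          of I "\<lambda>i. \<iota> (E (b \<otimes>\<^bsub>A\<^esub> y i)) \<otimes>\<^bsub>A\<^esub> x i"] by simp
    also have "\<dots> = f b" using b by (simp add: left_dual)
    finally show "?\<phi> (?\<psi> f) b = f b" using b by simp
  qed
  moreover have "?\<psi> (?\<phi> a) = a" if "a \<in> carrier A" for a
  proof -
    have "?\<psi> (?\<phi> a) = (\<Oplus>\<^bsub>A\<^esub>i\<in>I. y i \<otimes>\<^bsub>A\<^esub> \<iota> (E (x i \<otimes>\<^bsub>A\<^esub> a)))"
      using x_closed y_closed that by (intro A.finsum_cong') auto
    then show ?thesis using right_dual[OF that] by simp
  qed
  ultimately have "bij_betw ?\<phi> (carrier A) ?D"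
    using \<psi> E_mult_hom by (intro bij_betw_byWitness[of _ ?\<psi>]) auto
  moreover have "E (b \<otimes>\<^bsub>A\<^esub> (a \<otimes>\<^bsub>A\<^esub> \<iota> r)) = E (b \<otimes>\<^bsub>A\<^esub> a) \<otimes>\<^bsub>R\<^esub> r"
    if "a \<in> carrier A" "b \<in> carrier A" "r \<in> carrier R" for a b r
    using E_right[of "b \<otimes>\<^bsub>A\<^esub> a" r] that by (simp add: A.m_assoc)
  ultimately show ?thesis
    by (simp add: bimodule_iso_def ext_bimodule_def ext_dual_def A.r_distr E_add A.m_assoc
        cong: restrict_cong)
qed

lemma frobenius_extension: "frobenius_extension TYPE('u) R A \<iota>"
  unfolding frobenius_extension_def
  using R.ring_axioms A.ring_axioms ext_hom dual_basis_fin_gen[OF A_dual_basis]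
    dual_basis_projective[OF A_dual_basis] frobenius_bimodule_iso
  by blast

end

text \<open>For a bimodule isomorphism \<open>\<phi>\<close>, put \<open>E = \<phi> \<one>\<close>.
  Left \<open>A\<close>-linearity shows that \<open>\<phi> a\<close> is
  \<open>\<lambda>c. E (c \<otimes> a)\<close>, and right \<open>R\<close>-linearity makes
  \<open>E\<close> right linear. The \<open>x i\<close> come from a dual basis of \<open>A\<close>
  over \<open>R\<close>, and \<open>y i\<close> is the element that represents its functional
  \<open>\<xi> i\<close>.\<close>

lemma frobenius_extensionE:
  fixes R :: "('r, 'i) ring_scheme"
  assumes "frobenius_extension TYPE((nat \<Rightarrow> 'r) set) R A \<iota>"
  obtains E and n :: nat and x y where "frobenius_system R A \<iota> E {..<n} x y"
proof -
  interpret R: ring R using assms by (simp add: frobenius_extension_def)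
  interpret A: ring A using assms by (simp add: frobenius_extension_def)
  have \<iota>: "\<iota> \<in> ring_hom R A" using assms by (simp add: frobenius_extension_def)
  interpret L: left_module R "ext_module \<iota> A"
    by (intro left_module_ext_module R.ring_axioms A.ring_axioms \<iota>)
  have \<iota>_closed [simp]: "\<iota> r \<in> carrier A" if "r \<in> carrier R" for r
    using ring_hom_closed[OF \<iota> that] .
  obtain n :: nat and x \<xi> where db: "dual_basis R (ext_module \<iota> A) {..<n} x \<xi>"
  proof (rule fin_gen_projective_dual_basis)
    show "fin_gen R (ext_module \<iota> A)" "projective TYPE((nat \<Rightarrow> 'r) set) R (ext_module \<iota> A)"
      using assms by (simp_all add: frobenius_extension_def)
  qed (rule that)
  obtain \<phi> where "\<phi> \<in> bimodule_iso A R (ext_bimodule \<iota> A) (ext_dual \<iota> R A)"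
    using assms unfolding frobenius_extension_def by blast
  then have bij: "bij_betw \<phi> (carrier A) (lmod_hom R (ext_module \<iota> A) (ext_module id R))"
    and \<phi>_left: "\<And>a b. a \<in> carrier A \<Longrightarrow> b \<in> carrier A \<Longrightarrow>
      \<phi> (a \<otimes>\<^bsub>A\<^esub> b) = (\<lambda>c\<in>carrier A. \<phi> b (c \<otimes>\<^bsub>A\<^esub> a))"
    and \<phi>_right: "\<And>b r. b \<in> carrier A \<Longrightarrow> r \<in> carrier R \<Longrightarrow>
      \<phi> (b \<otimes>\<^bsub>A\<^esub> \<iota> r) = (\<lambda>c\<in>carrier A. \<phi> b c \<otimes>\<^bsub>R\<^esub> r)"
    by (auto simp: bimodule_iso_def ext_bimodule_def ext_dual_def)
  define E where "E = \<phi> \<one>\<^bsub>A\<^esub>"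
  have E: "E \<in> lmod_hom R (ext_module \<iota> A) (ext_module id R)"
    using bij by (auto simp: E_def bij_betw_def)
  have Ec [simp]: "E a \<in> carrier R" if "a \<in> carrier A" for a
    using lmod_hom_closed[OF E, of a] that by simp
  have \<phi>: "\<phi> a = (\<lambda>c\<in>carrier A. E (c \<otimes>\<^bsub>A\<^esub> a))" if "a \<in> carrier A" for a
    using \<phi>_left[OF that A.one_closed] that by (simp add: E_def)
  have E_right: "E (a \<otimes>\<^bsub>A\<^esub> \<iota> r) = E a \<otimes>\<^bsub>R\<^esub> r" if "a \<in> carrier A" "r \<in> carrier R" for a r
    using fun_cong[OF \<phi>_right[OF A.one_closed that(2)], of a] that by (simp add: E_def[symmetric] \<phi>)
  have x: "x i \<in> carrier A" if "i < n" for i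
    using db that by (auto simp: dual_basis_def)
  have \<xi>: "\<xi> i \<in> lmod_hom R (ext_module \<iota> A) (ext_module id R)" if "i < n" for i
    using db that by (auto simp: dual_basis_def)
  then have "\<exists>b\<in>carrier A. \<phi> b = \<xi> i" if "i < n" for i
    using that bij by (metis bij_betw_imp_surj_on imageE)
  then obtain y where y: "\<And>i. i < n \<Longrightarrow> y i \<in> carrier A" "\<And>i. i < n \<Longrightarrow> \<phi> (y i) = \<xi> i"
    by metis
  have \<xi>_eq: "\<xi> i a = E (a \<otimes>\<^bsub>A\<^esub> y i)" if "i < n" "a \<in> carrier A" for i a
    using y(2)[OF that(1)] \<phi>[OF y(1)[OF that(1)]] that(2) by (metis restrict_apply')
  have left: "(\<Oplus>\<^bsub>A\<^esub>i\<in>{..<n}. \<iota> (E (a \<otimes>\<^bsub>A\<^esub> y i)) \<otimes>\<^bsub>A\<^esub> x i) = a" if a: "a \<in> carrier A" for a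
  proof -
    have "a = (\<Oplus>\<^bsub>A\<^esub>i\<in>{..<n}. \<iota> (\<xi> i a) \<otimes>\<^bsub>A\<^esub> x i)"
      using db a by (simp add: dual_basis_def)
    also have "\<dots> = (\<Oplus>\<^bsub>A\<^esub>i\<in>{..<n}. \<iota> (E (a \<otimes>\<^bsub>A\<^esub> y i)) \<otimes>\<^bsub>A\<^esub> x i)"
      using a x y by (intro A.finsum_cong') (auto simp: \<xi>_eq)
    finally show ?thesis by simp
  qed
  have right: "(\<Oplus>\<^bsub>A\<^esub>i\<in>{..<n}. y i \<otimes>\<^bsub>A\<^esub> \<iota> (E (x i \<otimes>\<^bsub>A\<^esub> a))) = a" if a: "a \<in> carrier A" for a
  proof -
    let ?b = "\<Oplus>\<^bsub>A\<^esub>i\<in>{..<n}. y i \<otimes>\<^bsub>A\<^esub> \<iota> (E (x i \<otimes>\<^bsub>A\<^esub> a))"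
    have b: "?b \<in> carrier A" using a x y by (intro A.finsum_closed) auto
    \<comment> \<open>By injectivity of \<open>\<phi>\<close> it suffices that \<open>?b\<close> and
      \<open>a\<close> represent the same functional, which follows on expanding \<open>c\<close> by
      \<open>left\<close>.\<close>
    have "E (c \<otimes>\<^bsub>A\<^esub> ?b) = E (c \<otimes>\<^bsub>A\<^esub> a)" if c: "c \<in> carrier A" for c
    proof -
      have E_sum: "E (\<Oplus>\<^bsub>A\<^esub>i\<in>{..<n}. f i) = (\<Oplus>\<^bsub>R\<^esub>i\<in>{..<n}. E (f i))"
        if "\<And>i. i < n \<Longrightarrow> f i \<in> carrier A" for f
        using lmod_hom_finsum[OF L.left_module_axioms left_module_regular[OF R.ring_axioms] E, of "{..<n}" f] that
        by simp
      have "E (c \<otimes>\<^bsub>A\<^esub> ?b) = E (\<Oplus>\<^bsub>A\<^esub>i\<in>{..<n}. c \<otimes>\<^bsub>A\<^esub> (y i \<otimes>\<^bsub>A\<^esub> \<iota> (E (x i \<otimes>\<^bsub>A\<^esub> a))))"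
        using a x y c by (subst A.finsum_rdistr) auto
      also have "\<dots> = (\<Oplus>\<^bsub>R\<^esub>i\<in>{..<n}. E (c \<otimes>\<^bsub>A\<^esub> (y i \<otimes>\<^bsub>A\<^esub> \<iota> (E (x i \<otimes>\<^bsub>A\<^esub> a)))))"
        using a x y c by (intro E_sum) auto
      also have "\<dots> = (\<Oplus>\<^bsub>R\<^esub>i\<in>{..<n}. E (\<iota> (E (c \<otimes>\<^bsub>A\<^esub> y i)) \<otimes>\<^bsub>A\<^esub> x i \<otimes>\<^bsub>A\<^esub> a))"
      proof (intro R.finsum_cong' refl)
        fix i assume "i \<in> {..<n}"
        then have i: "x i \<in> carrier A" "y i \<in> carrier A" using x y by auto
        have "E (c \<otimes>\<^bsub>A\<^esub> (y i \<otimes>\<^bsub>A\<^esub> \<iota> (E (x i \<otimes>\<^bsub>A\<^esub> a)))) = E (c \<otimes>\<^bsub>A\<^esub> y i) \<otimes>\<^bsub>R\<^esub> E (x i \<otimes>\<^bsub>A\<^esub> a)"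
          using i a c E_right[of "c \<otimes>\<^bsub>A\<^esub> y i"] by (simp add: A.m_assoc)
        also have "\<dots> = E (\<iota> (E (c \<otimes>\<^bsub>A\<^esub> y i)) \<otimes>\<^bsub>A\<^esub> x i \<otimes>\<^bsub>A\<^esub> a)"
          using i a c lmod_hom_smult[OF E, of "E (c \<otimes>\<^bsub>A\<^esub> y i)" "x i \<otimes>\<^bsub>A\<^esub> a"] by (simp add: A.m_assoc)
        finally show "E (c \<otimes>\<^bsub>A\<^esub> (y i \<otimes>\<^bsub>A\<^esub> \<iota> (E (x i \<otimes>\<^bsub>A\<^esub> a)))) = E (\<iota> (E (c \<otimes>\<^bsub>A\<^esub> y i)) \<otimes>\<^bsub>A\<^esub> x i \<otimes>\<^bsub>A\<^esub> a)" .
      qed (use a x y c in auto)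
      also have "\<dots> = E (\<Oplus>\<^bsub>A\<^esub>i\<in>{..<n}. \<iota> (E (c \<otimes>\<^bsub>A\<^esub> y i)) \<otimes>\<^bsub>A\<^esub> x i \<otimes>\<^bsub>A\<^esub> a)"
        using a x y c by (intro E_sum[symmetric]) auto
      also have "(\<Oplus>\<^bsub>A\<^esub>i\<in>{..<n}. \<iota> (E (c \<otimes>\<^bsub>A\<^esub> y i)) \<otimes>\<^bsub>A\<^esub> x i \<otimes>\<^bsub>A\<^esub> a) = c \<otimes>\<^bsub>A\<^esub> a"
        using a x y c by (subst A.finsum_ldistr[symmetric]) (auto simp: left)
      finally show ?thesis .
    qed
    then have "\<phi> ?b = \<phi> a" using \<phi>[OF a] \<phi>[OF b] by (simp cong: restrict_cong)
    then show ?thesis using bij a b by (auto simp: bij_betw_def dest: inj_onD)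
  qed
  have "frobenius_system R A \<iota> E {..<n} x y"
    using R.ring_axioms A.ring_axioms \<iota> E E_right x y left right
    by (intro frobenius_system.intro frobenius_system_axioms.intro) auto
  then show ?thesis by (rule that)
qed

section \<open>The Frobenius system of the endomorphism rings\<close>

text \<open>The module \<open>A \<otimes>\<^sub>R T\<close> enters only through the pure tensors \<open>p a t\<close>, the extension of
  functionals on \<open>T\<close>, and the maps \<open>\<rho> s = 1 \<otimes> s\<close>.\<close>

locale induced_module = frobenius_system R A \<iota> E I x y + T: left_module R T + U: left_module A U
  for R :: "('r, 'i) ring_scheme" and A :: "('a, 'j) ring_scheme" and \<iota> and E
    and I :: "'x set" and x y and T :: "('r, 't, 'k) module_scheme" and U :: "('a, 'u, 'l) module_scheme" +
  fixes p :: "'a \<Rightarrow> 't \<Rightarrow> 'u" and \<rho> :: "('t \<Rightarrow> 't) \<Rightarrow> 'u \<Rightarrow> 'u"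
    and K :: "'y set" and t \<tau> and J :: "'z set" and u g
  assumes p_closed [simp]: "\<lbrakk>a \<in> carrier A; s \<in> carrier T\<rbrakk> \<Longrightarrow> p a s \<in> carrier U"
    and p_add_l: "\<lbrakk>a \<in> carrier A; b \<in> carrier A; s \<in> carrier T\<rbrakk> \<Longrightarrow>
      p (a \<oplus>\<^bsub>A\<^esub> b) s = p a s \<oplus>\<^bsub>U\<^esub> p b s"
    and p_add_r: "\<lbrakk>a \<in> carrier A; s \<in> carrier T; s' \<in> carrier T\<rbrakk> \<Longrightarrow>
      p a (s \<oplus>\<^bsub>T\<^esub> s') = p a s \<oplus>\<^bsub>U\<^esub> p a s'"
    and p_balanced: "\<lbrakk>a \<in> carrier A; r \<in> carrier R; s \<in> carrier T\<rbrakk> \<Longrightarrow>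
      p (a \<otimes>\<^bsub>A\<^esub> \<iota> r) s = p a (r \<odot>\<^bsub>T\<^esub> s)"
    and smult_p: "\<lbrakk>a \<in> carrier A; b \<in> carrier A; s \<in> carrier T\<rbrakk> \<Longrightarrow>
      b \<odot>\<^bsub>U\<^esub> p a s = p (b \<otimes>\<^bsub>A\<^esub> a) s"
    and p_induct: "\<lbrakk>v \<in> carrier U; \<And>a s. a \<in> carrier A \<Longrightarrow> s \<in> carrier T \<Longrightarrow> P (p a s);
      \<And>v w. v \<in> carrier U \<Longrightarrow> w \<in> carrier U \<Longrightarrow> P v \<Longrightarrow> P w \<Longrightarrow> P (v \<oplus>\<^bsub>U\<^esub> w)\<rbrakk> \<Longrightarrow> P v"
    and lift_exists: "\<sigma> \<in> lmod_hom R T (ext_module id R) \<Longrightarrow>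
      \<exists>f\<in>lmod_hom A U (ext_module id A). \<forall>a\<in>carrier A. \<forall>s\<in>carrier T. f (p a s) = a \<otimes>\<^bsub>A\<^esub> \<iota> (\<sigma> s)"
    and \<rho>_closed: "h \<in> lmod_hom R T T \<Longrightarrow> \<rho> h \<in> lmod_hom A U U"
    and \<rho>_p [simp]: "\<lbrakk>h \<in> lmod_hom R T T; a \<in> carrier A; s \<in> carrier T\<rbrakk> \<Longrightarrow> \<rho> h (p a s) = p a (h s)"
    and T_dual_basis: "dual_basis R T K t \<tau>"
    and finite_J: "finite J"
    and g_hom: "j \<in> J \<Longrightarrow> g j \<in> lmod_hom R T (ext_module id R)"
    and u_closed [simp]: "j \<in> J \<Longrightarrow> u j \<in> carrier T"
    and g_u: "(\<Oplus>\<^bsub>R\<^esub>j\<in>J. g j (u j)) = \<one>\<^bsub>R\<^esub>"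
begin

section \<open>Functionals extended from \<open>T\<close> to \<open>A \<otimes> T\<close>\<close>

lemma finite_K: "finite K"
  and t_closed [simp]: "k \<in> K \<Longrightarrow> t k \<in> carrier T"
  and \<tau>_hom: "k \<in> K \<Longrightarrow> \<tau> k \<in> lmod_hom R T (ext_module id R)"
  and T_expand: "s \<in> carrier T \<Longrightarrow> (\<Oplus>\<^bsub>T\<^esub>k\<in>K. \<tau> k s \<odot>\<^bsub>T\<^esub> t k) = s"
  using T_dual_basis by (auto simp: dual_basis_def)

lemma \<tau>_closed [simp]: "\<lbrakk>k \<in> K; s \<in> carrier T\<rbrakk> \<Longrightarrow> \<tau> k s \<in> carrier R"
  using lmod_hom_closed[OF \<tau>_hom] by simp

lemma g_closed [simp]: "\<lbrakk>j \<in> J; s \<in> carrier T\<rbrakk> \<Longrightarrow> g j s \<in> carrier R"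
  using lmod_hom_closed[OF g_hom] by simp

text \<open>This is the functional \<open>1 \<otimes> \<sigma>\<close>. The choice is harmless,
  since by \<open>hom_eqI\<close> an \<open>A\<close>-linear functional is determined by its values
  on pure tensors.\<close>

definition lift :: "('t \<Rightarrow> 'r) \<Rightarrow> 'u \<Rightarrow> 'a"
  where "lift \<sigma> = (SOME f. f \<in> lmod_hom A U (ext_module id A) \<and>
    (\<forall>a\<in>carrier A. \<forall>s\<in>carrier T. f (p a s) = a \<otimes>\<^bsub>A\<^esub> \<iota> (\<sigma> s)))"

lemma
  assumes "\<sigma> \<in> lmod_hom R T (ext_module id R)"
  shows lift_hom: "lift \<sigma> \<in> lmod_hom A U (ext_module id A)"
    and lift_p: "\<lbrakk>a \<in> carrier A; s \<in> carrier T\<rbrakk> \<Longrightarrow> lift \<sigma> (p a s) = a \<otimes>\<^bsub>A\<^esub> \<iota> (\<sigma> s)"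
proof -
  have "\<exists>f. f \<in> lmod_hom A U (ext_module id A) \<and>
      (\<forall>a\<in>carrier A. \<forall>s\<in>carrier T. f (p a s) = a \<otimes>\<^bsub>A\<^esub> \<iota> (\<sigma> s))"
    using lift_exists[OF assms] by blast
  from someI_ex[OF this]
  show "lift \<sigma> \<in> lmod_hom A U (ext_module id A)"
    and "\<lbrakk>a \<in> carrier A; s \<in> carrier T\<rbrakk> \<Longrightarrow> lift \<sigma> (p a s) = a \<otimes>\<^bsub>A\<^esub> \<iota> (\<sigma> s)"
    by (auto simp: lift_def)
qed

lemma lift_closed [simp]:
  "\<lbrakk>\<sigma> \<in> lmod_hom R T (ext_module id R); v \<in> carrier U\<rbrakk> \<Longrightarrow> lift \<sigma> v \<in> carrier A"
  using lmod_hom_closed[OF lift_hom] by simp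

lemma p_finsum_l:
  assumes "\<And>i. i \<in> I' \<Longrightarrow> f i \<in> carrier A" "s \<in> carrier T"
  shows "p (\<Oplus>\<^bsub>A\<^esub>i\<in>I'. f i) s = (\<Oplus>\<^bsub>U\<^esub>i\<in>I'. p (f i) s)"
  using assms
  by (intro additive_finsum[where f="\<lambda>a. p a s"] A.abelian_group_axioms U.M.abelian_group_axioms)
    (auto simp: p_add_l)

lemma p_finsum_r:
  assumes "\<And>i. i \<in> I' \<Longrightarrow> f i \<in> carrier T" "a \<in> carrier A"
  shows "p a (\<Oplus>\<^bsub>T\<^esub>i\<in>I'. f i) = (\<Oplus>\<^bsub>U\<^esub>i\<in>I'. p a (f i))"
  using assms
  by (intro additive_finsum T.M.abelian_group_axioms U.M.abelian_group_axioms) (auto simp: p_add_r)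

lemma p_eq_smult: "\<lbrakk>a \<in> carrier A; s \<in> carrier T\<rbrakk> \<Longrightarrow> p a s = a \<odot>\<^bsub>U\<^esub> p \<one>\<^bsub>A\<^esub> s"
  by (simp add: smult_p)

text \<open>The image of \<open>T\<close> generates \<open>U\<close> over \<open>A\<close>, because
  \<open>p a s = a \<odot> p \<one> s\<close>. This is the injectivity half of the adjunction
  between extension and restriction of scalars; it reduces identities in \<open>B\<close> to
  elements of \<open>T\<close>.\<close>

lemma hom_eqI:
  assumes "f \<in> lmod_hom A U N" "f' \<in> lmod_hom A U N"
    and "\<And>s. s \<in> carrier T \<Longrightarrow> f (p \<one>\<^bsub>A\<^esub> s) = f' (p \<one>\<^bsub>A\<^esub> s)"
  shows "f = f'"
proof (rule lmod_hom_eqI[OF assms(1,2)])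
  fix v assume "v \<in> carrier U"
  then show "f v = f' v"
  proof (rule p_induct)
    fix a s assume as: "a \<in> carrier A" "s \<in> carrier T"
    then show "f (p a s) = f' (p a s)"
      unfolding p_eq_smult[OF as]
      by (simp add: lmod_hom_smult[OF assms(1)] lmod_hom_smult[OF assms(2)] assms(3))
  qed (simp add: lmod_hom_add[OF assms(1)] lmod_hom_add[OF assms(2)])
qed

text \<open>Both sides are linear in \<open>v\<close>, so the case \<open>v = p \<one> s\<close>
  suffices. There the balancing relation moves each \<open>\<tau> k s\<close> to the right factor,
  where \<open>T_expand\<close> applies.\<close>

lemma U_expand:
  assumes "v \<in> carrier U"
  shows "(\<Oplus>\<^bsub>U\<^esub>k\<in>K. lift (\<tau> k) v \<odot>\<^bsub>U\<^esub> p \<one>\<^bsub>A\<^esub> (t k)) = v"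
proof -
  have "(\<lambda>v\<in>carrier U. \<Oplus>\<^bsub>U\<^esub>k\<in>K. lift (\<tau> k) v \<odot>\<^bsub>U\<^esub> p \<one>\<^bsub>A\<^esub> (t k)) = (\<lambda>v\<in>carrier U. v)"
  proof (rule hom_eqI)
    show "(\<lambda>v\<in>carrier U. \<Oplus>\<^bsub>U\<^esub>k\<in>K. lift (\<tau> k) v \<odot>\<^bsub>U\<^esub> p \<one>\<^bsub>A\<^esub> (t k)) \<in> lmod_hom A U U"
      by (intro lmod_hom_lincomb U.left_module_axioms lift_hom \<tau>_hom) auto
    show "(\<lambda>v\<in>carrier U. v) \<in> lmod_hom A U U" by (rule U.lmod_End_closed)
    fix s assume s: "s \<in> carrier T"
    have "(\<Oplus>\<^bsub>U\<^esub>k\<in>K. lift (\<tau> k) (p \<one>\<^bsub>A\<^esub> s) \<odot>\<^bsub>U\<^esub> p \<one>\<^bsub>A\<^esub> (t k)) =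
        (\<Oplus>\<^bsub>U\<^esub>k\<in>K. p \<one>\<^bsub>A\<^esub> (\<tau> k s \<odot>\<^bsub>T\<^esub> t k))"
      using s p_balanced[OF A.one_closed]
      by (intro U.M.finsum_cong') (auto simp: lift_p \<tau>_hom smult_p)
    also have "\<dots> = p \<one>\<^bsub>A\<^esub> s"
      using s p_finsum_r[of K "\<lambda>k. \<tau> k s \<odot>\<^bsub>T\<^esub> t k" "\<one>\<^bsub>A\<^esub>"] by (simp add: T_expand)
    finally show "(\<lambda>v\<in>carrier U. \<Oplus>\<^bsub>U\<^esub>k\<in>K. lift (\<tau> k) v \<odot>\<^bsub>U\<^esub> p \<one>\<^bsub>A\<^esub> (t k)) (p \<one>\<^bsub>A\<^esub> s) =
        (\<lambda>v\<in>carrier U. v) (p \<one>\<^bsub>A\<^esub> s)"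
      using s by simp
  qed
  from fun_cong[OF this, of v] show ?thesis using assms by simp
qed

lemma U_fg_projective_generator: "fg_projective_generator TYPE('w) A U"
proof -
  have "dual_basis A U K (\<lambda>k. p \<one>\<^bsub>A\<^esub> (t k)) (\<lambda>k. lift (\<tau> k))"
    using finite_K U_expand by (auto simp: dual_basis_def U.left_module_axioms lift_hom \<tau>_hom)
  moreover have "generator TYPE('w) A U"
  proof (rule generatorI[OF U.left_module_axioms])
    have "(\<Oplus>\<^bsub>A\<^esub>j\<in>J. lift (g j) (p \<one>\<^bsub>A\<^esub> (u j))) = (\<Oplus>\<^bsub>A\<^esub>j\<in>J. \<iota> (g j (u j)))"
      by (intro A.finsum_cong') (auto simp: lift_p g_hom)
    also have "\<dots> = \<one>\<^bsub>A\<^esub>"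
      by (simp add: ext_finsum[symmetric] g_u)
    finally show "(\<Oplus>\<^bsub>A\<^esub>j\<in>J. lift (g j) (p \<one>\<^bsub>A\<^esub> (u j))) = \<one>\<^bsub>A\<^esub>" .
  qed (auto intro: lift_hom g_hom)
  ultimately show ?thesis
    unfolding fg_projective_generator_def using dual_basis_fin_gen dual_basis_projective by blast
qed

text \<open>The map \<open>E \<otimes> 1 : A \<otimes>\<^sub>R T \<rightarrow> T\<close>.\<close>

definition eps :: "'u \<Rightarrow> 't"
  where "eps v = (\<Oplus>\<^bsub>T\<^esub>k\<in>K. E (lift (\<tau> k) v) \<odot>\<^bsub>T\<^esub> t k)"

lemma eps_closed [simp]: "v \<in> carrier U \<Longrightarrow> eps v \<in> carrier T"
  unfolding eps_def by (intro T.M.finsum_closed) (auto simp: \<tau>_hom)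

lemma eps_add:
  assumes "v \<in> carrier U" "w \<in> carrier U"
  shows "eps (v \<oplus>\<^bsub>U\<^esub> w) = eps v \<oplus>\<^bsub>T\<^esub> eps w"
proof -
  have "eps (v \<oplus>\<^bsub>U\<^esub> w) =
      (\<Oplus>\<^bsub>T\<^esub>k\<in>K. E (lift (\<tau> k) v) \<odot>\<^bsub>T\<^esub> t k \<oplus>\<^bsub>T\<^esub> E (lift (\<tau> k) w) \<odot>\<^bsub>T\<^esub> t k)"
    unfolding eps_def using assms
    by (intro T.M.finsum_cong')
      (auto simp: \<tau>_hom lmod_hom_add[OF lift_hom] E_add T.smult_l_distr)
  also have "\<dots> = eps v \<oplus>\<^bsub>T\<^esub> eps w"
    unfolding eps_def using assms by (intro T.M.finsum_addf) (auto simp: \<tau>_hom)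
  finally show ?thesis .
qed

lemma eps_smult:
  assumes "v \<in> carrier U" "r \<in> carrier R"
  shows "eps (\<iota> r \<odot>\<^bsub>U\<^esub> v) = r \<odot>\<^bsub>T\<^esub> eps v"
proof -
  have "eps (\<iota> r \<odot>\<^bsub>U\<^esub> v) = (\<Oplus>\<^bsub>T\<^esub>k\<in>K. r \<odot>\<^bsub>T\<^esub> (E (lift (\<tau> k) v) \<odot>\<^bsub>T\<^esub> t k))"
    unfolding eps_def using assms
    by (intro T.M.finsum_cong')
      (auto simp: \<tau>_hom lmod_hom_smult[OF lift_hom] E_left T.smult_assoc)
  also have "\<dots> = r \<odot>\<^bsub>T\<^esub> eps v"
    unfolding eps_def using assms by (intro T.finsum_smult_r[symmetric]) (auto simp: \<tau>_hom)
  finally show ?thesis .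
qed

text \<open>Right linearity turns \<open>E (a \<otimes> \<iota> (\<tau> k s))\<close> into
  \<open>E a \<otimes> \<tau> k s\<close>, after which the expansion of \<open>s\<close> collapses.
  With \<open>eps_add\<close> it follows that \<open>eps\<close> does not depend on the dual basis
  in its definition.\<close>

lemma eps_p:
  assumes "a \<in> carrier A" "s \<in> carrier T"
  shows "eps (p a s) = E a \<odot>\<^bsub>T\<^esub> s"
proof -
  have "eps (p a s) = (\<Oplus>\<^bsub>T\<^esub>k\<in>K. E a \<odot>\<^bsub>T\<^esub> (\<tau> k s \<odot>\<^bsub>T\<^esub> t k))"
    unfolding eps_def using assms
    by (intro T.M.finsum_cong') (auto simp: \<tau>_hom lift_p E_right T.smult_assoc)
  also have "\<dots> = E a \<odot>\<^bsub>T\<^esub> s"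
    using assms by (simp add: T.finsum_smult_r[symmetric] T_expand)
  finally show ?thesis .
qed

text \<open>\<open>E \<otimes> 1\<close> and \<open>1 \<otimes> s\<close> act on different factors.
  This interchange yields the right \<open>S\<close>-linearity of \<open>End_E\<close>.\<close>

lemma eps_\<rho>:
  assumes s: "s \<in> lmod_hom R T T" and v: "v \<in> carrier U"
  shows "eps (\<rho> s v) = s (eps v)"
  using v
proof (rule p_induct)
  note s_closed = lmod_hom_closed[OF s]
  show "eps (\<rho> s (p a s')) = s (eps (p a s'))" if "a \<in> carrier A" "s' \<in> carrier T" for a s'
    using that s s_closed by (simp add: eps_p lmod_hom_smult[OF s])
  show "eps (\<rho> s (v \<oplus>\<^bsub>U\<^esub> w)) = s (eps (v \<oplus>\<^bsub>U\<^esub> w))"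
    if "v \<in> carrier U" "w \<in> carrier U" "eps (\<rho> s v) = s (eps v)" "eps (\<rho> s w) = s (eps w)" for v w
    using that lmod_hom_closed[OF \<rho>_closed[OF s]]
    by (simp add: lmod_hom_add[OF \<rho>_closed[OF s]] eps_add lmod_hom_add[OF s])
qed

text \<open>This is \<open>right_dual\<close> with \<open>T\<close> attached: on
  \<open>p a s\<close> the scalar \<open>E (x i \<otimes> a)\<close> moves to the left factor. The
  proof is by induction on tensors, because the single summands are additive in \<open>v\<close> but
  in general not \<open>A\<close>-linear.\<close>

lemma U_right_dual:
  assumes "v \<in> carrier U"
  shows "(\<Oplus>\<^bsub>U\<^esub>i\<in>I. p (y i) (eps (x i \<odot>\<^bsub>U\<^esub> v))) = v"
  using assms
proof (rule p_induct)
  fix a s assume as: "a \<in> carrier A" "s \<in> carrier T"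
  have "(\<Oplus>\<^bsub>U\<^esub>i\<in>I. p (y i) (eps (x i \<odot>\<^bsub>U\<^esub> p a s))) = (\<Oplus>\<^bsub>U\<^esub>i\<in>I. p (y i \<otimes>\<^bsub>A\<^esub> \<iota> (E (x i \<otimes>\<^bsub>A\<^esub> a))) s)"
    using as x_closed y_closed by (intro U.M.finsum_cong') (auto simp: smult_p eps_p p_balanced)
  also have "\<dots> = p a s"
    using as x_closed y_closed by (simp add: p_finsum_l[symmetric] right_dual)
  finally show "(\<Oplus>\<^bsub>U\<^esub>i\<in>I. p (y i) (eps (x i \<odot>\<^bsub>U\<^esub> p a s))) = p a s" .
next
  fix v w assume vw: "v \<in> carrier U" "w \<in> carrier U"
    and IH: "(\<Oplus>\<^bsub>U\<^esub>i\<in>I. p (y i) (eps (x i \<odot>\<^bsub>U\<^esub> v))) = v" "(\<Oplus>\<^bsub>U\<^esub>i\<in>I. p (y i) (eps (x i \<odot>\<^bsub>U\<^esub> w))) = w"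
  have "(\<Oplus>\<^bsub>U\<^esub>i\<in>I. p (y i) (eps (x i \<odot>\<^bsub>U\<^esub> (v \<oplus>\<^bsub>U\<^esub> w)))) =
      (\<Oplus>\<^bsub>U\<^esub>i\<in>I. p (y i) (eps (x i \<odot>\<^bsub>U\<^esub> v)) \<oplus>\<^bsub>U\<^esub> p (y i) (eps (x i \<odot>\<^bsub>U\<^esub> w)))"
    using vw x_closed y_closed
    by (intro U.M.finsum_cong') (auto simp: U.smult_r_distr eps_add p_add_r)
  also have "\<dots> = v \<oplus>\<^bsub>U\<^esub> w"
    using vw x_closed y_closed IH by (subst U.M.finsum_addf) auto
  finally show "(\<Oplus>\<^bsub>U\<^esub>i\<in>I. p (y i) (eps (x i \<odot>\<^bsub>U\<^esub> (v \<oplus>\<^bsub>U\<^esub> w)))) = v \<oplus>\<^bsub>U\<^esub> w" .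
qed

lemma \<rho>_ring_hom: "\<rho> \<in> ring_hom (lmod_End R T) (lmod_End A U)"
proof (rule ring_hom_memI)
  fix s assume "s \<in> carrier (lmod_End R T)"
  then have s: "s \<in> lmod_hom R T T" by simp
  then show "\<rho> s \<in> carrier (lmod_End A U)" by (simp add: \<rho>_closed)
  fix s' assume "s' \<in> carrier (lmod_End R T)"
  then have s': "s' \<in> lmod_hom R T T" by simp
  have comp: "compose (carrier T) s' s \<in> lmod_hom R T T"
    by (rule lmod_hom_compose[OF T.left_module_axioms s s'])
  \<comment> \<open>Both rings multiply by reversed composition, so this is compatibility with
    products; it is checked on the elements \<open>p \<one> s\<close>.\<close>
  have "\<rho> (compose (carrier T) s' s) = compose (carrier U) (\<rho> s') (\<rho> s)"
    using s s' comp lmod_hom_closed[OF s] lmod_hom_closed[OF s']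
    by (intro hom_eqI[of _ U] \<rho>_closed lmod_hom_compose[OF U.left_module_axioms, of _ U]) (simp_all add: compose_eq)
  then show "\<rho> (s \<otimes>\<^bsub>lmod_End R T\<^esub> s') = \<rho> s \<otimes>\<^bsub>lmod_End A U\<^esub> \<rho> s'" by simp
  have sum: "(\<lambda>v\<in>carrier T. s v \<oplus>\<^bsub>T\<^esub> s' v) \<in> lmod_hom R T T"
    by (rule T.lmod_End_closed(3)[OF s s'])
  have "\<rho> (\<lambda>v\<in>carrier T. s v \<oplus>\<^bsub>T\<^esub> s' v) = (\<lambda>v\<in>carrier U. \<rho> s v \<oplus>\<^bsub>U\<^esub> \<rho> s' v)"
    using s s' sum lmod_hom_closed[OF s] lmod_hom_closed[OF s']
    by (intro hom_eqI[of _ U] \<rho>_closed U.lmod_End_closed(3)) (simp_all add: p_add_r)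
  then show "\<rho> (s \<oplus>\<^bsub>lmod_End R T\<^esub> s') = \<rho> s \<oplus>\<^bsub>lmod_End A U\<^esub> \<rho> s'" by simp
next
  have "\<rho> (\<lambda>v\<in>carrier T. v) = (\<lambda>v\<in>carrier U. v)"
    using T.lmod_End_closed(1) by (intro hom_eqI[of _ U] \<rho>_closed U.lmod_End_closed(1)) simp_all
  then show "\<rho> \<one>\<^bsub>lmod_End R T\<^esub> = \<one>\<^bsub>lmod_End A U\<^esub>" by simp
qed

definition End_E :: "('u \<Rightarrow> 'u) \<Rightarrow> 't \<Rightarrow> 't"
  where "End_E = (\<lambda>b\<in>lmod_hom A U U. \<lambda>s\<in>carrier T. eps (b (p \<one>\<^bsub>A\<^esub> s)))"

text \<open>The balancing relation at \<open>\<one>\<close>, read as \<open>R\<close>-linearity of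
  the unit \<open>T \<rightarrow> U\<close> of the adjunction.\<close>

lemma p_one_smult:
  assumes "r \<in> carrier R" "s \<in> carrier T"
  shows "p \<one>\<^bsub>A\<^esub> (r \<odot>\<^bsub>T\<^esub> s) = \<iota> r \<odot>\<^bsub>U\<^esub> p \<one>\<^bsub>A\<^esub> s"
  using assms p_balanced[OF A.one_closed assms] by (simp add: smult_p)

lemma End_E_closed:
  assumes b: "b \<in> lmod_hom A U U"
  shows "End_E b \<in> lmod_hom R T T"
proof -
  note bc = lmod_hom_closed[OF b]
  show ?thesis
    using b bc
    by (simp add: End_E_def, intro lmod_hom_restrictI T.left_module_axioms)
      (simp_all add: p_add_r lmod_hom_add[OF b] eps_add p_one_smult lmod_hom_smult[OF b] eps_smult)
qed

lemma End_E_apply [simp]: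
  "\<lbrakk>b \<in> lmod_hom A U U; s \<in> carrier T\<rbrakk> \<Longrightarrow> End_E b s = eps (b (p \<one>\<^bsub>A\<^esub> s))"
  by (simp add: End_E_def)

definition End_x :: "'y \<times> 'x \<times> 'z \<Rightarrow> 'u \<Rightarrow> 'u"
  where "End_x q = (\<lambda>v\<in>carrier U. lift (g (snd (snd q))) v \<odot>\<^bsub>U\<^esub> p (x (fst (snd q))) (t (fst q)))"

definition End_y :: "'y \<times> 'x \<times> 'z \<Rightarrow> 'u \<Rightarrow> 'u"
  where "End_y q = (\<lambda>v\<in>carrier U. lift (\<tau> (fst q)) v \<odot>\<^bsub>U\<^esub> p (y (fst (snd q))) (u (snd (snd q))))"

lemma End_x_closed: "q \<in> K \<times> I \<times> J \<Longrightarrow> End_x q \<in> lmod_hom A U U"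
  and End_y_closed: "q \<in> K \<times> I \<times> J \<Longrightarrow> End_y q \<in> lmod_hom A U U"
  unfolding End_x_def End_y_def
  by (intro lmod_hom_smult_const U.left_module_axioms lift_hom g_hom \<tau>_hom p_closed x_closed y_closed
      t_closed u_closed; auto)+

text \<open>For \<open>w = b (p \<one> s)\<close> this is the left dual basis identity of
  \<open>b\<close>, evaluated at \<open>p \<one> s\<close>. The sum over \<open>j\<close>
  contributes the factor \<open>\<one>\<close> by \<open>g_u\<close>, the sum over \<open>i\<close>
  is \<open>left_dual\<close> for \<open>lift (\<tau> k) w\<close>, and the sum over
  \<open>k\<close> is \<open>U_expand\<close>.\<close>

lemma End_left_dual:
  assumes w: "w \<in> carrier U"
  shows "(\<Oplus>\<^bsub>U\<^esub>q\<in>K \<times> I \<times> J. End_x q (p \<one>\<^bsub>A\<^esub> (eps (End_y q w)))) = w"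
proof -
  let ?r = "\<lambda>k i. E (lift (\<tau> k) w \<otimes>\<^bsub>A\<^esub> y i)"
  have r: "?r k i \<in> carrier R" if "k \<in> K" "i \<in> I" for k i
    using that w y_closed by (simp add: \<tau>_hom)
  have "End_x (k, i, j) (p \<one>\<^bsub>A\<^esub> (eps (End_y (k, i, j) w))) =
      \<iota> (?r k i) \<odot>\<^bsub>U\<^esub> (\<iota> (g j (u j)) \<odot>\<^bsub>U\<^esub> p (x i) (t k))" if "k \<in> K" "i \<in> I" "j \<in> J" for k i j
  proof -
    have "p \<one>\<^bsub>A\<^esub> (eps (End_y (k, i, j) w)) = \<iota> (?r k i) \<odot>\<^bsub>U\<^esub> p \<one>\<^bsub>A\<^esub> (u j)"
      using that w r y_closed by (simp add: End_y_def smult_p eps_p p_one_smult \<tau>_hom)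
    then show ?thesis
      using that w r x_closed
      by (simp add: End_x_def lmod_hom_smult[OF lift_hom] g_hom lift_p U.smult_assoc)
  qed
  \<comment> \<open>The summand is written as a curried function of the three projections, the shape
    that \<open>finsum_product3\<close> splits.\<close>
  then have "(\<Oplus>\<^bsub>U\<^esub>q\<in>K \<times> I \<times> J. End_x q (p \<one>\<^bsub>A\<^esub> (eps (End_y q w)))) =
      (\<Oplus>\<^bsub>U\<^esub>q\<in>K \<times> I \<times> J. (\<lambda>k i j. \<iota> (?r k i) \<odot>\<^bsub>U\<^esub> (\<iota> (g j (u j)) \<odot>\<^bsub>U\<^esub> p (x i) (t k)))
        (fst q) (fst (snd q)) (snd (snd q)))"
    using r x_closed by (intro U.M.finsum_cong') auto
  also have "\<dots> = (\<Oplus>\<^bsub>U\<^esub>k\<in>K. \<Oplus>\<^bsub>U\<^esub>i\<in>I. \<Oplus>\<^bsub>U\<^esub>j\<in>J. \<iota> (?r k i) \<odot>\<^bsub>U\<^esub> (\<iota> (g j (u j)) \<odot>\<^bsub>U\<^esub> p (x i) (t k)))"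
    using r x_closed by (intro U.M.finsum_product3 finite_K finite_I finite_J) auto
  also have "\<dots> = (\<Oplus>\<^bsub>U\<^esub>k\<in>K. lift (\<tau> k) w \<odot>\<^bsub>U\<^esub> p \<one>\<^bsub>A\<^esub> (t k))"
  proof (intro U.M.finsum_cong' refl)
    fix k assume k: "k \<in> K"
    have "(\<Oplus>\<^bsub>U\<^esub>j\<in>J. \<iota> (?r k i) \<odot>\<^bsub>U\<^esub> (\<iota> (g j (u j)) \<odot>\<^bsub>U\<^esub> p (x i) (t k))) = p (\<iota> (?r k i) \<otimes>\<^bsub>A\<^esub> x i) (t k)"
      if i: "i \<in> I" for i
    proof -
      have "(\<Oplus>\<^bsub>U\<^esub>j\<in>J. \<iota> (?r k i) \<odot>\<^bsub>U\<^esub> (\<iota> (g j (u j)) \<odot>\<^bsub>U\<^esub> p (x i) (t k))) =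
          \<iota> (?r k i) \<odot>\<^bsub>U\<^esub> ((\<Oplus>\<^bsub>A\<^esub>j\<in>J. \<iota> (g j (u j))) \<odot>\<^bsub>U\<^esub> p (x i) (t k))"
        using k i r x_closed by (simp add: U.finsum_smult_r[symmetric] U.finsum_smult_l[symmetric])
      also have "(\<Oplus>\<^bsub>A\<^esub>j\<in>J. \<iota> (g j (u j))) = \<one>\<^bsub>A\<^esub>"
        by (simp add: ext_finsum[symmetric] g_u)
      finally show ?thesis using k i r x_closed by (simp add: smult_p)
    qed
    then have "(\<Oplus>\<^bsub>U\<^esub>i\<in>I. \<Oplus>\<^bsub>U\<^esub>j\<in>J. \<iota> (?r k i) \<odot>\<^bsub>U\<^esub> (\<iota> (g j (u j)) \<odot>\<^bsub>U\<^esub> p (x i) (t k))) =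
        (\<Oplus>\<^bsub>U\<^esub>i\<in>I. p (\<iota> (?r k i) \<otimes>\<^bsub>A\<^esub> x i) (t k))"
      using k r x_closed by (intro U.M.finsum_cong') auto
    also have "\<dots> = p (lift (\<tau> k) w) (t k)"
      using k r w x_closed by (simp add: p_finsum_l[symmetric] left_dual \<tau>_hom)
    also have "\<dots> = lift (\<tau> k) w \<odot>\<^bsub>U\<^esub> p \<one>\<^bsub>A\<^esub> (t k)"
      using k w by (intro p_eq_smult) (auto simp: \<tau>_hom)
    finally show "(\<Oplus>\<^bsub>U\<^esub>i\<in>I. \<Oplus>\<^bsub>U\<^esub>j\<in>J. \<iota> (?r k i) \<odot>\<^bsub>U\<^esub> (\<iota> (g j (u j)) \<odot>\<^bsub>U\<^esub> p (x i) (t k))) =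
        lift (\<tau> k) w \<odot>\<^bsub>U\<^esub> p \<one>\<^bsub>A\<^esub> (t k)" .
  qed (use w in \<open>auto simp: \<tau>_hom\<close>)
  also have "\<dots> = w" by (rule U_expand[OF w])
  finally show ?thesis .
qed

text \<open>The factor \<open>g j (u j)\<close> again disappears on summing over \<open>j\<close>.
  The sum over \<open>i\<close> recovers \<open>b (p \<one> (t k))\<close> by
  \<open>U_right_dual\<close>, and the sum over \<open>k\<close> is the image under \<open>b\<close>
  of the expansion of \<open>v\<close>.\<close>

lemma End_right_dual:
  assumes b: "b \<in> lmod_hom A U U" and v: "v \<in> carrier U"
  shows "(\<Oplus>\<^bsub>U\<^esub>q\<in>K \<times> I \<times> J. \<rho> (End_E (compose (carrier U) b (End_x q))) (End_y q v)) = b v"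
proof -
  let ?e = "\<lambda>k i. eps (x i \<odot>\<^bsub>U\<^esub> b (p \<one>\<^bsub>A\<^esub> (t k)))"
  note bc = lmod_hom_closed[OF b]
  have e: "?e k i \<in> carrier T" if "k \<in> K" "i \<in> I" for k i
    using that bc x_closed by simp
  have lc: "lift (\<tau> k) v \<in> carrier A" if "k \<in> K" for k using that v by (simp add: \<tau>_hom)
  have "\<rho> (End_E (compose (carrier U) b (End_x (k, i, j)))) (End_y (k, i, j) v) =
      lift (\<tau> k) v \<odot>\<^bsub>U\<^esub> p (y i) (g j (u j) \<odot>\<^bsub>T\<^esub> ?e k i)" if "k \<in> K" "i \<in> I" "j \<in> J" for k i j
  proof -
    let ?c = "compose (carrier U) b (End_x (k, i, j))"
    have c: "?c \<in> lmod_hom A U U"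
      using that by (intro lmod_hom_compose[OF U.left_module_axioms End_x_closed b]) auto
    have "End_x (k, i, j) (p \<one>\<^bsub>A\<^esub> (u j)) = \<iota> (g j (u j)) \<odot>\<^bsub>U\<^esub> (x i \<odot>\<^bsub>U\<^esub> p \<one>\<^bsub>A\<^esub> (t k))"
      using that x_closed by (simp add: End_x_def lift_p g_hom smult_p)
    then have "End_E ?c (u j) = g j (u j) \<odot>\<^bsub>T\<^esub> ?e k i"
      using that c x_closed bc by (simp add: compose_eq lmod_hom_smult[OF b] eps_smult)
    \<comment> \<open>The map \<open>\<rho> (End_E ?c)\<close> is linear and acts on
      \<open>p (y i) (u j)\<close> through the value of \<open>End_E ?c\<close> at
      \<open>u j\<close> just computed; \<open>End_E\<close> has to stay folded for this.\<close>
    then show ?thesis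
      using that lc[OF that(1)] v y_closed lmod_hom_smult[OF \<rho>_closed[OF End_E_closed[OF c]]] End_E_closed[OF c]
      by (simp add: End_y_def del: End_E_apply)
  qed
  then have "(\<Oplus>\<^bsub>U\<^esub>q\<in>K \<times> I \<times> J. \<rho> (End_E (compose (carrier U) b (End_x q))) (End_y q v)) =
      (\<Oplus>\<^bsub>U\<^esub>q\<in>K \<times> I \<times> J. (\<lambda>k i j. lift (\<tau> k) v \<odot>\<^bsub>U\<^esub> p (y i) (g j (u j) \<odot>\<^bsub>T\<^esub> ?e k i))
        (fst q) (fst (snd q)) (snd (snd q)))"
    using e lc y_closed by (intro U.M.finsum_cong') auto
  also have "\<dots> = (\<Oplus>\<^bsub>U\<^esub>k\<in>K. \<Oplus>\<^bsub>U\<^esub>i\<in>I. \<Oplus>\<^bsub>U\<^esub>j\<in>J. lift (\<tau> k) v \<odot>\<^bsub>U\<^esub> p (y i) (g j (u j) \<odot>\<^bsub>T\<^esub> ?e k i))"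
    using e lc y_closed by (intro U.M.finsum_product3 finite_K finite_I finite_J) auto
  also have "\<dots> = (\<Oplus>\<^bsub>U\<^esub>k\<in>K. b (lift (\<tau> k) v \<odot>\<^bsub>U\<^esub> p \<one>\<^bsub>A\<^esub> (t k)))"
  proof (intro U.M.finsum_cong' refl)
    fix k assume k: "k \<in> K"
    have "(\<Oplus>\<^bsub>U\<^esub>j\<in>J. lift (\<tau> k) v \<odot>\<^bsub>U\<^esub> p (y i) (g j (u j) \<odot>\<^bsub>T\<^esub> ?e k i)) = lift (\<tau> k) v \<odot>\<^bsub>U\<^esub> p (y i) (?e k i)"
      if i: "i \<in> I" for i
      using k i e lc y_closed
      by (simp add: U.finsum_smult_r[symmetric] p_finsum_r[symmetric] T.finsum_smult_l[symmetric] g_u)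
    then have "(\<Oplus>\<^bsub>U\<^esub>i\<in>I. \<Oplus>\<^bsub>U\<^esub>j\<in>J. lift (\<tau> k) v \<odot>\<^bsub>U\<^esub> p (y i) (g j (u j) \<odot>\<^bsub>T\<^esub> ?e k i)) =
        (\<Oplus>\<^bsub>U\<^esub>i\<in>I. lift (\<tau> k) v \<odot>\<^bsub>U\<^esub> p (y i) (?e k i))"
      using k e lc y_closed by (intro U.M.finsum_cong') auto
    also have "\<dots> = lift (\<tau> k) v \<odot>\<^bsub>U\<^esub> b (p \<one>\<^bsub>A\<^esub> (t k))"
      using k e lc y_closed bc by (simp add: U.finsum_smult_r[symmetric] U_right_dual)
    finally show "(\<Oplus>\<^bsub>U\<^esub>i\<in>I. \<Oplus>\<^bsub>U\<^esub>j\<in>J. lift (\<tau> k) v \<odot>\<^bsub>U\<^esub> p (y i) (g j (u j) \<odot>\<^bsub>T\<^esub> ?e k i)) =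
        b (lift (\<tau> k) v \<odot>\<^bsub>U\<^esub> p \<one>\<^bsub>A\<^esub> (t k))"
      using k lc by (simp add: lmod_hom_smult[OF b])
  qed (use lc bc in auto)
  also have "\<dots> = b v"
    using lc v by (simp add: lmod_hom_finsum[OF U.left_module_axioms U.left_module_axioms b, symmetric] U_expand)
  finally show ?thesis .
qed

text \<open>Products in \<open>B\<close> are reversed composites, so at \<open>p \<one> s\<close>
  the product of \<open>\<rho> (End_E (b \<otimes> End_y q))\<close> and \<open>End_x q\<close> has
  the value \<open>End_x q (p \<one> (eps (End_y q (b (p \<one> s)))))\<close>, a summand of
  \<open>End_left_dual\<close>. The other dual identity unfolds to \<open>End_right_dual\<close> in
  the same way.\<close>

lemma End_frobenius_system:
  "frobenius_system (lmod_End R T) (lmod_End A U) \<rho> End_E (K \<times> I \<times> J) End_x End_y"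
proof -
  let ?S = "lmod_End R T" and ?B = "lmod_End A U"
  interpret S: ring ?S by (rule T.ring_lmod_End)
  interpret B: ring ?B by (rule U.ring_lmod_End)
  interpret BS: left_module ?S "ext_module \<rho> ?B"
    by (intro left_module_ext_module S.ring_axioms B.ring_axioms \<rho>_ring_hom)
  note comp = lmod_hom_compose[OF U.left_module_axioms]
  note eval = lmod_hom_closed[of _ A U U]
  show ?thesis
  proof (intro frobenius_system.intro frobenius_system_axioms.intro S.ring_axioms B.ring_axioms \<rho>_ring_hom)
    have "restrict End_E (carrier (ext_module \<rho> ?B)) \<in> lmod_hom ?S (ext_module \<rho> ?B) (ext_module id ?S)"
    proof (rule lmod_hom_restrictI[OF BS.left_module_axioms])
      fix b assume "b \<in> carrier (ext_module \<rho> ?B)"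
      then have b: "b \<in> lmod_hom A U U" by simp
      then show "End_E b \<in> carrier (ext_module id ?S)" by (simp add: End_E_closed)
      {
        fix c assume "c \<in> carrier (ext_module \<rho> ?B)"
        then have c: "c \<in> lmod_hom A U U" by simp
        show "End_E (b \<oplus>\<^bsub>ext_module \<rho> ?B\<^esub> c) = End_E b \<oplus>\<^bsub>ext_module id ?S\<^esub> End_E c"
          using U.lmod_End_closed(3)[OF b c] b c eval[OF b] eval[OF c]
            T.lmod_End_closed(3)[OF End_E_closed[OF b] End_E_closed[OF c]]
          by (intro lmod_hom_eqI[of _ R T T _ T]) (simp_all add: End_E_closed eps_add)
      next
        fix s assume "s \<in> carrier ?S"
        then have s: "s \<in> lmod_hom R T T" by simp
        \<comment> \<open>Left multiplication by \<open>\<rho> s\<close> is precomposition, and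
          \<open>\<rho> s\<close> takes \<open>p \<one> s'\<close> to
          \<open>p \<one> (s s')\<close>.\<close>
        have "End_E (compose (carrier U) b (\<rho> s)) = compose (carrier T) (End_E b) s"
          using comp[OF \<rho>_closed[OF s] b] b s lmod_hom_closed[OF s]
            lmod_hom_compose[OF T.left_module_axioms s End_E_closed[OF b]]
          by (intro lmod_hom_eqI[of _ R T T _ T]) (simp_all add: End_E_closed compose_eq)
        then show "End_E (s \<odot>\<^bsub>ext_module \<rho> ?B\<^esub> b) = s \<odot>\<^bsub>ext_module id ?S\<^esub> End_E b" by simp
      }
    qed
    then show "End_E \<in> lmod_hom ?S (ext_module \<rho> ?B) (ext_module id ?S)"
      by (simp add: End_E_def)
  next
    fix b s assume "b \<in> carrier ?B" "s \<in> carrier ?S"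
    then have b: "b \<in> lmod_hom A U U" and s: "s \<in> lmod_hom R T T" by simp_all
    \<comment> \<open>Right multiplication by \<open>\<rho> s\<close> is postcomposition, which
      \<open>eps_\<rho>\<close> moves past \<open>eps\<close>.\<close>
    have "End_E (compose (carrier U) (\<rho> s) b) = compose (carrier T) s (End_E b)"
      using comp[OF b \<rho>_closed[OF s]] b s eval[OF b]
        lmod_hom_compose[OF T.left_module_axioms End_E_closed[OF b] s]
      by (intro lmod_hom_eqI[of _ R T T _ T]) (simp_all add: End_E_closed compose_eq eps_\<rho>)
    then show "End_E (b \<otimes>\<^bsub>?B\<^esub> \<rho> s) = End_E b \<otimes>\<^bsub>?S\<^esub> s" by simp
  next
    show "finite (K \<times> I \<times> J)" using finite_I finite_J finite_K by simp
  next
    fix q assume "q \<in> K \<times> I \<times> J"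
    then show "End_x q \<in> carrier ?B" "End_y q \<in> carrier ?B"
      by (simp_all add: End_x_closed End_y_closed del: mem_Sigma_iff)
  next
    fix b assume "b \<in> carrier ?B"
    then have b: "b \<in> lmod_hom A U U" by simp
    let ?f = "\<lambda>q. \<rho> (End_E (b \<otimes>\<^bsub>?B\<^esub> End_y q)) \<otimes>\<^bsub>?B\<^esub> End_x q"
    have c: "End_E (compose (carrier U) (End_y q) b) \<in> lmod_hom R T T"
      "compose (carrier U) (End_y q) b \<in> lmod_hom A U U" if "q \<in> K \<times> I \<times> J" for q
      using comp[OF b End_y_closed[OF that]] by (simp_all add: End_E_closed)
    have f: "?f q \<in> lmod_hom A U U" if "q \<in> K \<times> I \<times> J" for q
      using comp[OF \<rho>_closed[OF c(1)[OF that]] End_x_closed[OF that]] by simp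
    show "(\<Oplus>\<^bsub>?B\<^esub>q\<in>K \<times> I \<times> J. ?f q) = b"
    proof (rule hom_eqI[OF _ b])
      show "(\<Oplus>\<^bsub>?B\<^esub>q\<in>K \<times> I \<times> J. ?f q) \<in> lmod_hom A U U"
        using B.finsum_closed[of ?f "K \<times> I \<times> J"] f by (simp del: mem_Sigma_iff)
      fix s assume s: "s \<in> carrier T"
      have "(\<Oplus>\<^bsub>?B\<^esub>q\<in>K \<times> I \<times> J. ?f q) (p \<one>\<^bsub>A\<^esub> s) = (\<Oplus>\<^bsub>U\<^esub>q\<in>K \<times> I \<times> J. ?f q (p \<one>\<^bsub>A\<^esub> s))"
        using s f by (intro U.lmod_End_finsum) auto
      also have "\<dots> = (\<Oplus>\<^bsub>U\<^esub>q\<in>K \<times> I \<times> J. End_x q (p \<one>\<^bsub>A\<^esub> (eps (End_y q (b (p \<one>\<^bsub>A\<^esub> s))))))"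
        using s c eval[OF End_x_closed] eval[OF End_y_closed] eval[OF b]
        by (intro U.M.finsum_cong') (auto simp: compose_eq simp del: mem_Sigma_iff)
      also have "\<dots> = b (p \<one>\<^bsub>A\<^esub> s)"
        using s eval[OF b] by (intro End_left_dual) simp
      finally show "(\<Oplus>\<^bsub>?B\<^esub>q\<in>K \<times> I \<times> J. ?f q) (p \<one>\<^bsub>A\<^esub> s) = b (p \<one>\<^bsub>A\<^esub> s)" .
    qed
  next
    fix b assume "b \<in> carrier ?B"
    then have b: "b \<in> lmod_hom A U U" by simp
    let ?f = "\<lambda>q. End_y q \<otimes>\<^bsub>?B\<^esub> \<rho> (End_E (End_x q \<otimes>\<^bsub>?B\<^esub> b))"
    have c: "\<rho> (End_E (compose (carrier U) b (End_x q))) \<in> lmod_hom A U U" if "q \<in> K \<times> I \<times> J" for q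
      using comp[OF End_x_closed[OF that] b] by (simp add: End_E_closed \<rho>_closed)
    have f: "?f q \<in> lmod_hom A U U" if "q \<in> K \<times> I \<times> J" for q
      using comp[OF End_y_closed[OF that] c[OF that]] by simp
    show "(\<Oplus>\<^bsub>?B\<^esub>q\<in>K \<times> I \<times> J. ?f q) = b"
    proof (rule lmod_hom_eqI[OF _ b])
      show "(\<Oplus>\<^bsub>?B\<^esub>q\<in>K \<times> I \<times> J. ?f q) \<in> lmod_hom A U U"
        using B.finsum_closed[of ?f "K \<times> I \<times> J"] f by (simp del: mem_Sigma_iff)
      fix v assume v: "v \<in> carrier U"
      have "(\<Oplus>\<^bsub>?B\<^esub>q\<in>K \<times> I \<times> J. ?f q) v = (\<Oplus>\<^bsub>U\<^esub>q\<in>K \<times> I \<times> J. ?f q v)"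
        using v f by (intro U.lmod_End_finsum) auto
      also have "\<dots> = (\<Oplus>\<^bsub>U\<^esub>q\<in>K \<times> I \<times> J. \<rho> (End_E (compose (carrier U) b (End_x q))) (End_y q v))"
        using v eval[OF c] eval[OF End_y_closed]
        by (intro U.M.finsum_cong') (auto simp: compose_eq simp del: mem_Sigma_iff)
      also have "\<dots> = b v" by (rule End_right_dual[OF b v])
      finally show "(\<Oplus>\<^bsub>?B\<^esub>q\<in>K \<times> I \<times> J. ?f q) v = b v" .
    qed
  qed
qed

end

section \<open>The tensor product\<close>

text \<open>Provides for the cosets of formal sums what \<open>induced_module\<close> assumes about
  \<open>U\<close>, \<open>p\<close> and \<open>\<rho>\<close>. These facts hold along any ring
  homomorphism.\<close>

locale extension_of_scalars = R: ring R + A: ring A + T: left_module R T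
  for R :: "('r, 'i) ring_scheme" and A :: "('a, 'j) ring_scheme" and T :: "('r, 't, 'k) module_scheme" +
  fixes \<iota> :: "'r \<Rightarrow> 'a"
  assumes ext_hom: "\<iota> \<in> ring_hom R A"
begin

abbreviation "AR \<equiv> ext_bimodule \<iota> A"
abbreviation "F \<equiv> free_Abelian_group (carrier A \<times> carrier T)"
abbreviation "N \<equiv> tensor_ker R AR T"
abbreviation "U \<equiv> tensor R AR T"
abbreviation "p \<equiv> pure_tensor R AR T"
abbreviation "cl c \<equiv> N #>\<^bsub>F\<^esub> c"

section \<open>Arithmetic of cosets modulo the tensor relations\<close>

lemma ext_closed [simp]: "r \<in> carrier R \<Longrightarrow> \<iota> r \<in> carrier A"
  using ext_hom by (rule ring_hom_closed)

lemma AR_simps [simp]: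
  "carrier AR = carrier A" "add AR = add A" "smult AR = mult A" "rsmult AR = (\<lambda>a r. a \<otimes>\<^bsub>A\<^esub> \<iota> r)"
  by (simp_all add: ext_bimodule_def)

sublocale F: comm_group F
  by (rule abelian_free_Abelian_group)

lemma rel_subset: "tensor_rel R AR T \<subseteq> carrier F"
  using tensor_rel_subset[of AR T R] by simp

lemma ker_eq: "N = generate F (tensor_rel R AR T)"
  by (simp add: tensor_ker_def)

lemma ker_subgroup: "subgroup N F"
  unfolding ker_eq by (rule F.generate_is_subgroup[OF rel_subset])

lemma ker_normal: "N \<lhd> F"
  by (rule F.subgroup_imp_normal[OF ker_subgroup])

lemma ker_subset: "N \<subseteq> carrier F"
  by (rule subgroup.subset[OF ker_subgroup])

lemma ker_diff: "\<lbrakk>c \<in> N; d \<in> N\<rbrakk> \<Longrightarrow> c - d \<in> N"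
  using subgroup.m_closed[OF ker_subgroup, of c "- d"] subgroup.m_inv_closed[OF ker_subgroup, of d]
    ker_subset by auto

lemma ker_add: "\<lbrakk>c \<in> N; d \<in> N\<rbrakk> \<Longrightarrow> c + d \<in> N"
  using subgroup.m_closed[OF ker_subgroup, of c d] by simp

lemma coset_eq: "cl c = (\<lambda>k. k + c) ` N"
  by (auto simp: r_coset_def)

lemma coset_eqI:
  assumes "c - d \<in> N"
  shows "cl c = cl d"
proof -
  have "k + c \<in> (\<lambda>k. k + d) ` N" if "k \<in> N" for k
    using ker_add[OF that assms] by (intro image_eqI[of _ _ "k + (c - d)"]) auto
  moreover have "k + d \<in> (\<lambda>k. k + c) ` N" if "k \<in> N" for k
    using ker_diff[OF that assms] by (intro image_eqI[of _ _ "k - (c - d)"]) auto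
  ultimately show ?thesis unfolding coset_eq by blast
qed

lemma rel_in_ker: "c \<in> tensor_rel R AR T \<Longrightarrow> c \<in> N"
  unfolding ker_eq by (rule generate.incl)

lemma carrier_U: "carrier U = cl ` carrier F"
  by (simp add: tensor_def tensor_group_def carrier_FactGroup)

lemma add_U:
  assumes "c \<in> carrier F" "d \<in> carrier F"
  shows "cl c \<oplus>\<^bsub>U\<^esub> cl d = cl (c + d)"
  using normal.rcos_sum[OF ker_normal assms] by (simp add: tensor_def tensor_group_def)

lemma abelian_group_U: "abelian_group U"
proof -
  have "comm_group (tensor_group R AR T)"
    unfolding tensor_group_def using F.abelian_FactGroup[of N] ker_subgroup by simp
  note Q = comm_groupE[OF this]
  show ?thesis
    by (rule abelian_groupI) (use Q in \<open>auto simp: tensor_def\<close>)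
qed

sublocale U: abelian_group U
  by (rule abelian_group_U)

lemma p_eq: "p a s = cl (frag_of (a, s))"
  by (simp add: pure_tensor_def)

lemma p_closed [simp]: "\<lbrakk>a \<in> carrier A; s \<in> carrier T\<rbrakk> \<Longrightarrow> p a s \<in> carrier U"
  unfolding p_eq carrier_U by (intro imageI) simp

lemma p_add_l:
  assumes "a \<in> carrier A" "b \<in> carrier A" "s \<in> carrier T"
  shows "p (a \<oplus>\<^bsub>A\<^esub> b) s = p a s \<oplus>\<^bsub>U\<^esub> p b s"
proof -
  have "frag_of (a \<oplus>\<^bsub>A\<^esub> b, s) - frag_of (a, s) - frag_of (b, s) \<in> tensor_rel R AR T"
    unfolding tensor_rel_def using assms by auto
  then have "cl (frag_of (a \<oplus>\<^bsub>A\<^esub> b, s)) = cl (frag_of (a, s) + frag_of (b, s))"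
    by (intro coset_eqI) (simp add: rel_in_ker diff_diff_eq)
  then show ?thesis using assms by (simp add: p_eq add_U)
qed

lemma p_add_r:
  assumes "a \<in> carrier A" "s \<in> carrier T" "s' \<in> carrier T"
  shows "p a (s \<oplus>\<^bsub>T\<^esub> s') = p a s \<oplus>\<^bsub>U\<^esub> p a s'"
proof -
  have "frag_of (a, s \<oplus>\<^bsub>T\<^esub> s') - frag_of (a, s) - frag_of (a, s') \<in> tensor_rel R AR T"
    unfolding tensor_rel_def using assms by auto
  then have "cl (frag_of (a, s \<oplus>\<^bsub>T\<^esub> s')) = cl (frag_of (a, s) + frag_of (a, s'))"
    by (intro coset_eqI) (simp add: rel_in_ker diff_diff_eq)
  then show ?thesis using assms by (simp add: p_eq add_U)
qed

lemma p_balanced: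
  assumes "a \<in> carrier A" "r \<in> carrier R" "s \<in> carrier T"
  shows "p (a \<otimes>\<^bsub>A\<^esub> \<iota> r) s = p a (r \<odot>\<^bsub>T\<^esub> s)"
proof -
  have "frag_of (a \<otimes>\<^bsub>A\<^esub> \<iota> r, s) - frag_of (a, r \<odot>\<^bsub>T\<^esub> s) \<in> tensor_rel R AR T"
    unfolding tensor_rel_def using assms by auto
  then show ?thesis unfolding p_eq by (intro coset_eqI rel_in_ker)
qed

text \<open>Zero and negatives require no cases of their own, since \<open>p \<zero> s\<close> is
  zero and the negative of \<open>p a s\<close> is the pure tensor \<open>p (\<ominus> a) s\<close>.
  So every element is a sum of pure tensors.\<close>

lemma tensor_induct:
  assumes v: "v \<in> carrier U"
    and pure: "\<And>a s. a \<in> carrier A \<Longrightarrow> s \<in> carrier T \<Longrightarrow> P (p a s)"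
    and add: "\<And>v w. v \<in> carrier U \<Longrightarrow> w \<in> carrier U \<Longrightarrow> P v \<Longrightarrow> P w \<Longrightarrow> P (v \<oplus>\<^bsub>U\<^esub> w)"
  shows "P v"
proof -
  obtain c where c: "c \<in> carrier F" "v = cl c" using v unfolding carrier_U by blast
  have p_zero: "p \<zero>\<^bsub>A\<^esub> s = cl 0" if "s \<in> carrier T" for s
  proof -
    have "p \<zero>\<^bsub>A\<^esub> s \<oplus>\<^bsub>U\<^esub> p \<zero>\<^bsub>A\<^esub> s = p \<zero>\<^bsub>A\<^esub> s"
      using p_add_l[of "\<zero>\<^bsub>A\<^esub>" "\<zero>\<^bsub>A\<^esub>" s] that by simp
    then have "p \<zero>\<^bsub>A\<^esub> s = \<zero>\<^bsub>U\<^esub>" using that by simp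
    also have "\<dots> = cl 0" by (simp add: coset_eq tensor_def tensor_group_def)
    finally show ?thesis .
  qed
  \<comment> \<open>Closure under negation is not assumed, so it is carried along.\<close>
  have "c \<in> carrier F \<and> P (cl c) \<and> P (cl (- c))"
    using c(1) unfolding carrier_free_Abelian_group_iff
  proof (induction c rule: frag_induction)
    case zero
    have "P (cl 0)"
      unfolding p_zero[OF T.M.zero_closed, symmetric] by (intro pure) simp_all
    then show ?case by simp
  next
    case (one z)
    then obtain a s where z: "z = (a, s)" and as: "a \<in> carrier A" "s \<in> carrier T" by auto
    \<comment> \<open>Cancelling \<open>p a s\<close> identifies the coset of
      \<open>- frag_of z\<close> with a pure tensor.\<close>
    have "p (\<ominus>\<^bsub>A\<^esub> a) s \<oplus>\<^bsub>U\<^esub> p a s = cl (- frag_of z) \<oplus>\<^bsub>U\<^esub> p a s"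
      using as p_add_l[of "\<ominus>\<^bsub>A\<^esub> a" a s] by (simp add: A.l_neg p_zero p_eq[of a] z add_U)
    moreover have "cl (- frag_of z) \<in> carrier U"
      unfolding carrier_U using as by (intro imageI) (simp add: z)
    ultimately have "p (\<ominus>\<^bsub>A\<^esub> a) s = cl (- frag_of z)"
      using as U.add.right_cancel[of "p a s"] by simp
    then have "P (cl (- frag_of z))" using pure[of "\<ominus>\<^bsub>A\<^esub> a" s] as by simp
    then show ?case using pure[OF as] as by (simp add: z p_eq)
  next
    case (diff c d)
    then have k: "c \<in> carrier F" "d \<in> carrier F" "- c \<in> carrier F" "- d \<in> carrier F" by simp_all
    have mem: "cl c \<in> carrier U" "cl d \<in> carrier U" "cl (- c) \<in> carrier U" "cl (- d) \<in> carrier U"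
      unfolding carrier_U using k by blast+
    have "P (cl c \<oplus>\<^bsub>U\<^esub> cl (- d))" "P (cl (- c) \<oplus>\<^bsub>U\<^esub> cl d)"
      using diff mem by (blast intro: add)+
    moreover have "Poly_Mapping.keys (c - d) \<subseteq> carrier A \<times> carrier T"
      using k keys_diff[of c d] by auto
    ultimately show ?case using k by (simp add: add_U)
  qed
  then show ?thesis using c(2) by simp
qed

text \<open>The map of free groups is additive whatever \<open>f\<close> and \<open>h\<close> are,
  and \<open>N\<close> is closed under addition. The claim thereby becomes an equality of two sets
  of formal sums.\<close>

lemma tensor_map_add:
  assumes "v \<in> carrier U" "w \<in> carrier U"
  shows "tensor_map R AR T AR T f h (v \<oplus>\<^bsub>U\<^esub> w) =
    tensor_map R AR T AR T f h v \<oplus>\<^bsub>U\<^esub> tensor_map R AR T AR T f h w"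
proof -
  let ?m = "frag_extend (\<lambda>(a, s). frag_of (f a, h s))"
  have carr: "carrier U = carrier (tensor_group R AR T)" by (simp add: tensor_def)
  have add: "v \<oplus>\<^bsub>U\<^esub> w = {c + d | c d. c \<in> v \<and> d \<in> w}" for v w
    by (auto simp: tensor_def tensor_group_def set_mult_def)
  have map: "tensor_map R AR T AR T f h v = {k + ?m c | k c. k \<in> N \<and> c \<in> v}" if "v \<in> carrier U" for v
    using that unfolding carr by (auto simp: tensor_map_def set_mult_def)
  have "{k + ?m c | k c. k \<in> N \<and> c \<in> v \<oplus>\<^bsub>U\<^esub> w} =
      {a + b | a b. a \<in> {k + ?m c | k c. k \<in> N \<and> c \<in> v} \<and> b \<in> {k + ?m d | k d. k \<in> N \<and> d \<in> w}}"
    (is "?lhs = ?rhs")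
  proof (intro equalityI subsetI)
    fix e assume "e \<in> ?lhs"
    then obtain k c d where "k \<in> N" "c \<in> v" "d \<in> w" "e = k + ?m (c + d)"
      unfolding add by blast
    then have "e = (k + ?m c) + (0 + ?m d)" "k \<in> N" "c \<in> v" "d \<in> w"
      by (simp_all add: frag_extend_add add.assoc)
    \<comment> \<open>The single element of \<open>N\<close> has to be distributed over two
      summands; the second one receives zero.\<close>
    moreover have "0 \<in> N" using subgroup.one_closed[OF ker_subgroup] by simp
    ultimately show "e \<in> ?rhs" by blast
  next
    fix e assume "e \<in> ?rhs"
    then obtain k k' c d where e: "k \<in> N" "k' \<in> N" "c \<in> v" "d \<in> w" "e = (k + ?m c) + (k' + ?m d)"
      by blast
    then have "e = (k + k') + ?m (c + d)" by (simp add: frag_extend_add)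
    then show "e \<in> ?lhs" unfolding add using e ker_add by blast
  qed
  then have "tensor_map R AR T AR T f h (v \<oplus>\<^bsub>U\<^esub> w) = ?rhs"
    using map[OF U.a_closed[OF assms]] by (rule trans[rotated])
  also have "\<dots> = tensor_map R AR T AR T f h v \<oplus>\<^bsub>U\<^esub> tensor_map R AR T AR T f h w"
    by (simp only: map[OF assms(1)] map[OF assms(2)] add)
  finally show ?thesis .
qed

context
  fixes f :: "'a \<Rightarrow> 'a" and h :: "'t \<Rightarrow> 't"
  assumes f: "\<And>a. a \<in> carrier A \<Longrightarrow> f a \<in> carrier A"
      "\<And>a b. a \<in> carrier A \<Longrightarrow> b \<in> carrier A \<Longrightarrow> f (a \<oplus>\<^bsub>A\<^esub> b) = f a \<oplus>\<^bsub>A\<^esub> f b"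
      "\<And>a r. a \<in> carrier A \<Longrightarrow> r \<in> carrier R \<Longrightarrow> f (a \<otimes>\<^bsub>A\<^esub> \<iota> r) = f a \<otimes>\<^bsub>A\<^esub> \<iota> r"
    and h: "\<And>s. s \<in> carrier T \<Longrightarrow> h s \<in> carrier T"
      "\<And>s s'. s \<in> carrier T \<Longrightarrow> s' \<in> carrier T \<Longrightarrow> h (s \<oplus>\<^bsub>T\<^esub> s') = h s \<oplus>\<^bsub>T\<^esub> h s'"
      "\<And>s r. s \<in> carrier T \<Longrightarrow> r \<in> carrier R \<Longrightarrow> h (r \<odot>\<^bsub>T\<^esub> s) = r \<odot>\<^bsub>T\<^esub> h s"
begin

lemma tensor_map_p: "\<lbrakk>a \<in> carrier A; s \<in> carrier T\<rbrakk> \<Longrightarrow> tensor_map R AR T AR T f h (p a s) = p (f a) (h s)"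
  using f h by (intro tensor_map_pure_tensor) simp_all

lemma tensor_map_closed: "v \<in> carrier U \<Longrightarrow> tensor_map R AR T AR T f h v \<in> carrier U"
  by (erule tensor_induct) (simp_all add: tensor_map_p tensor_map_add f h)

end

section \<open>The action of \<open>A\<close> on the tensor product\<close>

lemma smult_U: "a \<odot>\<^bsub>U\<^esub> v = tensor_map R AR T AR T (\<lambda>b. a \<otimes>\<^bsub>A\<^esub> b) (\<lambda>s. s) v"
  by (simp add: tensor_def)

lemma smult_U_closed: "\<lbrakk>a \<in> carrier A; v \<in> carrier U\<rbrakk> \<Longrightarrow> a \<odot>\<^bsub>U\<^esub> v \<in> carrier U"
  unfolding smult_U by (rule tensor_map_closed) (simp_all add: A.r_distr A.m_assoc)

lemma smult_U_p:
  "\<lbrakk>a \<in> carrier A; b \<in> carrier A; s \<in> carrier T\<rbrakk> \<Longrightarrow> b \<odot>\<^bsub>U\<^esub> p a s = p (b \<otimes>\<^bsub>A\<^esub> a) s"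
  by (intro tensor_smult_pure_tensor R.ring_axioms A.ring_axioms T.left_module_axioms ext_hom)

lemma smult_U_add:
  "\<lbrakk>v \<in> carrier U; w \<in> carrier U\<rbrakk> \<Longrightarrow> a \<odot>\<^bsub>U\<^esub> (v \<oplus>\<^bsub>U\<^esub> w) = a \<odot>\<^bsub>U\<^esub> v \<oplus>\<^bsub>U\<^esub> a \<odot>\<^bsub>U\<^esub> w"
  unfolding smult_U by (rule tensor_map_add)

lemma left_module_U: "left_module A U"
proof (intro left_module.intro left_module_axioms.intro A.ring_axioms abelian_group_U)
  fix v assume v: "v \<in> carrier U"
  then show "\<one>\<^bsub>A\<^esub> \<odot>\<^bsub>U\<^esub> v = v"
    by (rule tensor_induct) (simp_all add: smult_U_p smult_U_add)
  fix a b assume a: "a \<in> carrier A" and b: "b \<in> carrier A"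
  show "(a \<oplus>\<^bsub>A\<^esub> b) \<odot>\<^bsub>U\<^esub> v = a \<odot>\<^bsub>U\<^esub> v \<oplus>\<^bsub>U\<^esub> b \<odot>\<^bsub>U\<^esub> v"
    using v
  proof (rule tensor_induct)
    fix v w assume "v \<in> carrier U" "w \<in> carrier U"
      "(a \<oplus>\<^bsub>A\<^esub> b) \<odot>\<^bsub>U\<^esub> v = a \<odot>\<^bsub>U\<^esub> v \<oplus>\<^bsub>U\<^esub> b \<odot>\<^bsub>U\<^esub> v"
      "(a \<oplus>\<^bsub>A\<^esub> b) \<odot>\<^bsub>U\<^esub> w = a \<odot>\<^bsub>U\<^esub> w \<oplus>\<^bsub>U\<^esub> b \<odot>\<^bsub>U\<^esub> w"
    then show "(a \<oplus>\<^bsub>A\<^esub> b) \<odot>\<^bsub>U\<^esub> (v \<oplus>\<^bsub>U\<^esub> w) = a \<odot>\<^bsub>U\<^esub> (v \<oplus>\<^bsub>U\<^esub> w) \<oplus>\<^bsub>U\<^esub> b \<odot>\<^bsub>U\<^esub> (v \<oplus>\<^bsub>U\<^esub> w)"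
      using a b by (simp add: smult_U_add smult_U_closed U.a_ac)
  qed (use a b in \<open>simp add: smult_U_p A.l_distr p_add_l\<close>)
  show "(a \<otimes>\<^bsub>A\<^esub> b) \<odot>\<^bsub>U\<^esub> v = a \<odot>\<^bsub>U\<^esub> (b \<odot>\<^bsub>U\<^esub> v)"
    using v by (rule tensor_induct) (use a b in \<open>simp_all add: smult_U_p smult_U_add smult_U_closed A.m_assoc\<close>)
qed (simp_all add: smult_U_closed smult_U_add)

text \<open>The assignment of \<open>a \<otimes> \<iota> (\<sigma> s)\<close> to
  \<open>(a, s)\<close> is biadditive and balanced, so its extension to the free abelian group kills
  \<open>N\<close> and factors through the quotient. Linearity over \<open>A\<close> can then be
  checked on pure tensors.\<close>

lemma lift_functional:
  assumes \<sigma>: "\<sigma> \<in> lmod_hom R T (ext_module id R)"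
  shows "\<exists>f\<in>lmod_hom A U (ext_module id A). \<forall>a\<in>carrier A. \<forall>s\<in>carrier T. f (p a s) = a \<otimes>\<^bsub>A\<^esub> \<iota> (\<sigma> s)"
proof -
  have \<sigma>_closed: "\<sigma> s \<in> carrier R" if "s \<in> carrier T" for s
    using lmod_hom_closed[OF \<sigma> that] by simp
  let ?A = "add_monoid A"
  obtain h where h: "h \<in> hom F ?A"
    and h_frag: "\<And>z. z \<in> carrier A \<times> carrier T \<Longrightarrow> h (frag_of z) = (case z of (a, s) \<Rightarrow> a \<otimes>\<^bsub>A\<^esub> \<iota> (\<sigma> s))"
  proof (rule comm_group.free_Abelian_group_universal[OF A.a_comm_group])
    show "(\<lambda>z. case z of (a, s) \<Rightarrow> a \<otimes>\<^bsub>A\<^esub> \<iota> (\<sigma> s)) ` (carrier A \<times> carrier T) \<subseteq> carrier ?A"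
      using \<sigma>_closed by auto
  qed (rule that)
  interpret h: group_hom F ?A h
    using h A.a_group by (simp add: group_hom_def group_hom_axioms_def F.is_group)
  have h_diff: "h (c - d) = h c \<ominus>\<^bsub>A\<^esub> h d" if "c \<in> carrier F" "d \<in> carrier F" for c d
  proof -
    have "h (c \<otimes>\<^bsub>F\<^esub> inv\<^bsub>F\<^esub> d) = h c \<otimes>\<^bsub>?A\<^esub> inv\<^bsub>?A\<^esub> h d"
      using that by (simp only: h.hom_mult h.hom_inv F.inv_closed)
    then show ?thesis using that by (simp add: A.minus_eq a_inv_def)
  qed
  have F_diff: "c - d \<in> carrier F" if "c \<in> carrier F" "d \<in> carrier F" for c d
    using that keys_diff[of c d] by auto
  have cancel: "a \<oplus>\<^bsub>A\<^esub> b \<ominus>\<^bsub>A\<^esub> a \<ominus>\<^bsub>A\<^esub> b = \<zero>\<^bsub>A\<^esub>" if "a \<in> carrier A" "b \<in> carrier A" for a b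
    using that by (simp add: A.minus_eq A.a_assoc[of "a \<oplus>\<^bsub>A\<^esub> b"] A.minus_add[symmetric] A.r_neg)
  have "tensor_rel R AR T \<subseteq> kernel F ?A h"
  proof
    fix c assume c: "c \<in> tensor_rel R AR T"
    have "h c = \<zero>\<^bsub>A\<^esub>"
      using c unfolding tensor_rel_def
    proof (elim UnE CollectE exE conjE)
      fix a a' s assume "c = frag_of (a \<oplus>\<^bsub>AR\<^esub> a', s) - frag_of (a, s) - frag_of (a', s)"
        and "a \<in> carrier AR" "a' \<in> carrier AR" "s \<in> carrier T"
      then show ?thesis
        using \<sigma>_closed by (simp add: h_diff F_diff h_frag A.l_distr cancel del: carrier_free_Abelian_group_iff)
    next
      fix a s s' assume "c = frag_of (a, s \<oplus>\<^bsub>T\<^esub> s') - frag_of (a, s) - frag_of (a, s')"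
        and "a \<in> carrier AR" "s \<in> carrier T" "s' \<in> carrier T"
      then show ?thesis
        using \<sigma>_closed lmod_hom_add[OF \<sigma>]
        by (simp add: h_diff F_diff h_frag ring_hom_add[OF ext_hom] A.r_distr cancel
            del: carrier_free_Abelian_group_iff)
    next
      \<comment> \<open>Since \<open>\<iota>\<close> is multiplicative and \<open>\<sigma>\<close>
        is linear, both generators go to the product of \<open>a\<close>, \<open>\<iota> r\<close>
        and \<open>\<iota> (\<sigma> s)\<close>.\<close>
      fix a r s assume "c = frag_of (rsmult AR a r, s) - frag_of (a, r \<odot>\<^bsub>T\<^esub> s)"
        and "a \<in> carrier AR" "r \<in> carrier R" "s \<in> carrier T"
      then show ?thesis
        using \<sigma>_closed lmod_hom_smult[OF \<sigma>]
        by (simp add: h_diff h_frag ring_hom_mult[OF ext_hom] A.m_assoc A.minus_eq A.r_neg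
            del: carrier_free_Abelian_group_iff)
    qed
    then show "c \<in> kernel F ?A h" using subsetD[OF rel_subset c] by (simp add: kernel_def)
  qed
  then have "N \<subseteq> kernel F ?A h"
    unfolding ker_eq by (rule F.generate_subgroup_incl[OF _ h.subgroup_kernel])
  then obtain f where f: "f \<in> hom (F Mod N) ?A" and f_cl: "\<And>c. c \<in> carrier F \<Longrightarrow> f (cl c) = h c"
    using h.FactGroup_universal_kernel[OF ker_normal] by metis
  have f_closed: "f v \<in> carrier A" if "v \<in> carrier U" for v
    using hom_in_carrier[OF f, of v] that by (simp add: tensor_def tensor_group_def)
  have f_add: "f (v \<oplus>\<^bsub>U\<^esub> w) = f v \<oplus>\<^bsub>A\<^esub> f w" if "v \<in> carrier U" "w \<in> carrier U" for v w
    using hom_mult[OF f, of v w] that by (simp add: tensor_def tensor_group_def)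
  have f_p: "f (p a s) = a \<otimes>\<^bsub>A\<^esub> \<iota> (\<sigma> s)" if "a \<in> carrier A" "s \<in> carrier T" for a s
    using that by (simp add: p_eq f_cl h_frag)
  have f_smult: "f (b \<odot>\<^bsub>U\<^esub> v) = b \<otimes>\<^bsub>A\<^esub> f v" if b: "b \<in> carrier A" and v: "v \<in> carrier U" for b v
    using v
  proof (rule tensor_induct)
    show "f (b \<odot>\<^bsub>U\<^esub> p a s) = b \<otimes>\<^bsub>A\<^esub> f (p a s)" if "a \<in> carrier A" "s \<in> carrier T" for a s
      using that b \<sigma>_closed by (simp add: smult_U_p f_p A.m_assoc)
  qed (use b in \<open>simp add: smult_U_add smult_U_closed f_add f_closed A.r_distr\<close>)
  have "restrict f (carrier U) \<in> lmod_hom A U (ext_module id A)"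
    using f_closed f_add f_smult by (intro lmod_hom_restrictI left_module_U) auto
  then show ?thesis using f_p by (intro bexI[of _ "restrict f (carrier U)"]) auto
qed

lemma tensor_map_hom:
  assumes h: "h \<in> lmod_hom R T T"
  shows "tensor_map R AR T AR T (\<lambda>a. a) h \<in> lmod_hom A U U"
    and "\<lbrakk>a \<in> carrier A; s \<in> carrier T\<rbrakk> \<Longrightarrow> tensor_map R AR T AR T (\<lambda>a. a) h (p a s) = p a (h s)"
proof -
  note hs = lmod_hom_closed[OF h] lmod_hom_add[OF h] lmod_hom_smult[OF h]
  let ?m = "tensor_map R AR T AR T (\<lambda>a. a) h"
  show p: "?m (p a s) = p a (h s)" if "a \<in> carrier A" "s \<in> carrier T" for a s
    using that by (intro tensor_map_p) (simp_all add: hs)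
  have closed: "?m v \<in> carrier U" if "v \<in> carrier U" for v
    using that by (intro tensor_map_closed) (simp_all add: hs)
  show "?m \<in> lmod_hom A U U"
  proof (rule lmod_homI)
    show "?m (b \<odot>\<^bsub>U\<^esub> v) = b \<odot>\<^bsub>U\<^esub> ?m v" if b: "b \<in> carrier A" and v: "v \<in> carrier U" for b v
      using v
      by (rule tensor_induct)
        (use b in \<open>simp_all add: p smult_U_p hs smult_U_add tensor_map_add smult_U_closed closed\<close>)
    show "?m v = undefined" if "v \<notin> carrier U" for v
      using that by (simp add: tensor_map_def tensor_def)
  qed (simp_all add: closed tensor_map_add)
qed

end

theorem corollary3p5:
  fixes R :: "('r, 'i) ring_scheme"
    and A :: "('a, 'j) ring_scheme"
    and \<iota> :: "'r \<Rightarrow> 'a"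
    and T :: "('r, 't, 'k) module_scheme"
    and U :: "('a, ('a \<times> 't \<Rightarrow>\<^sub>0 int) set) module"
    and S :: "('t \<Rightarrow> 't) ring"
    and B :: "(('a \<times> 't \<Rightarrow>\<^sub>0 int) set \<Rightarrow> ('a \<times> 't \<Rightarrow>\<^sub>0 int) set) ring"
    and \<rho> :: "('t \<Rightarrow> 't) \<Rightarrow> ('a \<times> 't \<Rightarrow>\<^sub>0 int) set \<Rightarrow> ('a \<times> 't \<Rightarrow>\<^sub>0 int) set"
  assumes "frobenius_extension TYPE((nat \<Rightarrow> 'r) set) R A \<iota>"
    and "fg_projective_generator TYPE((nat \<Rightarrow> 'r) set) R T"
    and "U = tensor R (ext_bimodule \<iota> A) T"
    and "S = lmod_End R T"
    and "B = lmod_End A U"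
    and "\<rho> = (\<lambda>s. tensor_map R (ext_bimodule \<iota> A) T (ext_bimodule \<iota> A) T (\<lambda>a. a) s)"
  shows "fg_projective_generator TYPE('u) A U \<and> frobenius_extension TYPE('v) S B \<rho>"
proof -
  \<comment> \<open>The test type of the hypotheses is used up by this \<open>obtain\<close> and by
    those for \<open>t\<close>, \<open>\<tau>\<close> and for \<open>g\<close>, \<open>u\<close>;
    what follows works with finite data only.\<close>
  obtain E and n :: nat and x y where "frobenius_system R A \<iota> E {..<n} x y"
    by (rule frobenius_extensionE[OF assms(1)]) (rule that)
  then interpret frobenius_system R A \<iota> E "{..<n}" x y .
  have T: "fin_gen R T" "projective TYPE((nat \<Rightarrow> 'r) set) R T" "generator TYPE((nat \<Rightarrow> 'r) set) R T"
    using assms(2) by (simp_all add: fg_projective_generator_def)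
  interpret T: left_module R T using T(1) by (simp add: fin_gen_def)
  interpret tensor: extension_of_scalars R A T \<iota>
    by unfold_locales (rule ext_hom)
  obtain m :: nat and t \<tau> where db: "dual_basis R T {..<m} t \<tau>"
    by (rule fin_gen_projective_dual_basis[OF T(1,2)]) (rule that)
  obtain l :: nat and g u where g: "g \<in> {..<l} \<rightarrow> lmod_hom R T (ext_module id R)"
    "u \<in> {..<l} \<rightarrow> carrier T" "(\<Oplus>\<^bsub>R\<^esub>j\<in>{..<l}. g j (u j)) = \<one>\<^bsub>R\<^esub>"
    by (rule generatorE[OF T(3)]) (rule that)
  interpret induced_module R A \<iota> E "{..<n}" x y T U "pure_tensor R (ext_bimodule \<iota> A) T" \<rho>
    "{..<m}" t \<tau> "{..<l}" u g
    unfolding assms(3,6)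
  proof (intro induced_module.intro induced_module_axioms.intro frobenius_system_axioms
      T.left_module_axioms tensor.left_module_U)
  qed (use db g in \<open>auto simp: tensor.p_add_l tensor.p_add_r tensor.p_balanced tensor.smult_U_p
      tensor.lift_functional tensor.tensor_map_hom intro: tensor.tensor_induct\<close>)
  \<comment> \<open>Both facts hold for every type of test modules, so \<open>'u\<close> and
    \<open>'v\<close> can be instantiated independently.\<close>
  show ?thesis
    unfolding assms(4,5)
    using U_fg_projective_generator frobenius_system.frobenius_extension[OF End_frobenius_system]
    by blast
qed

end
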